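(* Let $n\ge2$ and $\hat{\mathfrak g}=\hat{\mathfrak{sl}}_n$ with standard Borel subalgebra $\hat{\mathfrak b}$. The map $\Phi$ induces a bijection between the set of quasi-abelian basic ideals in $\hat{\mathfrak b}$ and the set of all pairs $(p,q)$ of Dyck paths of semilength $n$ satisfying $\overline p\leq q\leq p$.
   Context: **Affine algebra.** Let $\mathfrak g=\mathfrak{sl}_n(\mathbb C)$ with standard triangular decomposition $\mathfrak g=\mathfrak n_-\oplus\mathfrak h\oplus\mathfrak n_+$, roots $\Delta=\Delta_+\cup\Delta_-$, simple roots $\alpha_1,\dots,\alpha_{n-1}$ ($\alpha_i$ is the root of the matrix unit $e_{i,i+1}$). $\hat{\mathfrak g}=\mathfrak g\otimes\mathbb C[t,t^{-1}]\oplus\mathbb Cc\oplus\mathbb Cd$ is the untwisted affine Lie algebra (universal central extension of the loop algebra, with derivation $d$, $[d,x\otimes t^k]=k\,x\otimes t^k$), $\hat{\mathfrak h}=\mathfrak h\oplus\mathbb Cc\oplus\mathbb Cd$; $\hat{\mathfrak n}_+$ is spanned by $\mathfrak n_+\otimes1$ and all $x\otimes t^k$, $x\in\mathfrak g$, $k>0$; $\hat{\mathfrak b}=\hat{\mathfrak h}\oplus\hat{\mathfrak n}_+$. $\hat{\mathfrak g}_\alpha$ is a root space, $\delta$ the indivisible positive imaginary root ($\hat{\mathfrak g}_\delta=\mathfrak h\otimes t$). Put $D=\Delta_+\cup\{\delta\}\cup\{\alpha+\delta:\alpha\in\Delta_-\}$ and $D'=\bigcup_{k>0}(D+k\delta)$.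 **Basic ideals.** An ideal $\mathfrak i$ of $\hat{\mathfrak b}$ is *combinatorial* if $\mathfrak i\subset\hat{\mathfrak n}_+$, $\mathfrak i$ has finite codimension, and for every root $\alpha$, $\mathfrak i\cap\hat{\mathfrak g}_\alpha\ne0$ implies $\hat{\mathfrak g}_\alpha\subset\mathfrak i$; $\mathrm{supp}(\mathfrak i)$ is the set of roots $\alpha$ with $\hat{\mathfrak g}_\alpha\subset\mathfrak i$; $\mathfrak i$ is *basic* if moreover $\mathrm{supp}(\mathfrak i)\cap D\neq\varnothing$. Let $\mathfrak a=\bigoplus_{\alpha\in D'}\hat{\mathfrak g}_\alpha$. A basic ideal $\mathfrak i$ is *quasi-abelian* if its image in $\hat{\mathfrak n}_+/\mathfrak a$ is an abelian ideal. **Dyck paths.** A Dyck path of semilength $n$ is a path in the first quadrant from $(0,0)$ to $(2n,0)$ with steps $r=(1,1)$ (rises) and $f=(1,-1)$ (falls). A peak is the end point of a rise followed by a fall; its height is its $y$-coordinate. Write $p\le q$ if $q$ never goes below $p$. $\mathcal D_n(i,j)$ is the set of Dyck paths of semilength $n$ whose first (leftmost) peak has height $i$ and last peak has height $j$; set $\mathcal D_n(0,0):=\mathcal D_n(1,1)$. For $p\in\mathcal D_n(i,j)$, $\overline p$ denotes the unique minimal (with respect to $\le$) path in $\mathcal D_n(n-j,n-i)$. **The map $\Phi$.** Consider an $n\times n$ array of boxes; the box in row $a$, column $b$ corresponds to the root $\alpha_a+\dots+\alpha_{b-1}$ if $a<b$ and to $-(\alpha_b+\dots+\alpha_{a-1})$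 if $a>b$. For a basic ideal $\mathfrak i$ let $\mathbf s_+(\mathfrak i)=\Delta_+\cap\mathrm{supp}(\mathfrak i)$ and $\mathbf s_-(\mathfrak i)=\{\alpha\in\Delta_-:\alpha+\delta\in\mathrm{supp}(\mathfrak i)\}$. The lattice path with unit east and south steps from the top-left to the bottom-right corner of the array, such that the boxes to its north-east are exactly those of $\mathbf s_+(\mathfrak i)$, gives $p$ by reading east steps as rises and south steps as falls. The lattice path with unit east and south steps between the same corners, such that the boxes to its north-east are exactly all boxes on or above the main diagonal together with the boxes of $\mathbf s_-(\mathfrak i)$, gives $q$ by reading south steps as rises and east steps as falls. Then $\Phi(\mathfrak i)=(p,q)$, a pair of Dyck paths of semilength $n$. *)

theory Defs
  imports Complex_Main "HOL-Library.Poly_Mapping" "HOL-Library.Function_Algebras"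
    "HOL-Library.Product_Plus"
begin

text \<open>
  An \<open>n \<times> n\<close> matrix is a function of two indices ranging over \<open>{1..n}\<close>, equal to zero
  outside this range.
\<close>

type_synonym cmatrix = "nat \<Rightarrow> nat \<Rightarrow> complex"

definition matrices :: "nat \<Rightarrow> cmatrix set" where
  "matrices n = {A. \<forall>a b. a \<notin> {1..n} \<or> b \<notin> {1..n} \<longrightarrow> A a b = 0}"

definition mat_mul :: "nat \<Rightarrow> cmatrix \<Rightarrow> cmatrix \<Rightarrow> cmatrix" where
  "mat_mul n A B = (\<lambda>a b. \<Sum>c = 1..n. A a c * B c b)"

definition mat_trace :: "nat \<Rightarrow> cmatrix \<Rightarrow> complex" where
  "mat_trace n A = (\<Sum>a = 1..n. A a a)"

definition mat_bracket :: "nat \<Rightarrow> cmatrix \<Rightarrow> cmatrix \<Rightarrow> cmatrix" where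
  "mat_bracket n A B = mat_mul n A B - mat_mul n B A"

definition mat_scale :: "complex \<Rightarrow> cmatrix \<Rightarrow> cmatrix" where
  "mat_scale z A = (\<lambda>a b. z * A a b)"

definition sl :: "nat \<Rightarrow> cmatrix set" where
  "sl n = {A \<in> matrices n. mat_trace n A = 0}"

definition sl_cartan :: "nat \<Rightarrow> cmatrix set" where
  "sl_cartan n = {A \<in> sl n. \<forall>a b. a \<noteq> b \<longrightarrow> A a b = 0}"

definition sl_nplus :: "nat \<Rightarrow> cmatrix set" where
  "sl_nplus n = {A \<in> sl n. \<forall>a b. b \<le> a \<longrightarrow> A a b = 0}"

text \<open>
  The triple \<open>(x, u, v)\<close> stands for \<open>x + u c + v d\<close>, where \<open>x\<close> is a Laurent polynomial in \<open>t\<close>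
  with matrix coefficients; \<open>Poly_Mapping.single k A\<close> is \<open>A \<otimes> t\<^sup>k\<close>.
\<close>

type_synonym affine = "(int \<Rightarrow>\<^sub>0 cmatrix) \<times> complex \<times> complex"

definition affine_scale :: "complex \<Rightarrow> affine \<Rightarrow> affine" where
  "affine_scale z = (\<lambda>(x, u, v). (Poly_Mapping.map (mat_scale z) x, z * u, z * v))"

lemma lookup_map_mat_scale [simp]:
  "Poly_Mapping.lookup (Poly_Mapping.map (mat_scale z) x) k = mat_scale z (Poly_Mapping.lookup x k)"
  by (auto simp: Poly_Mapping.map.rep_eq when_def mat_scale_def fun_eq_iff)

interpretation affine: vector_space affine_scale
  by unfold_locales
    (auto simp: affine_scale_def fun_eq_iff lookup_add mat_scale_def plus_prod_def algebra_simps
      split: prod.splits intro!: poly_mapping_eqI)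

definition loop_bracket :: "nat \<Rightarrow> (int \<Rightarrow>\<^sub>0 cmatrix) \<Rightarrow> (int \<Rightarrow>\<^sub>0 cmatrix) \<Rightarrow> (int \<Rightarrow>\<^sub>0 cmatrix)" where
  "loop_bracket n x y = (\<Sum>k\<in>Poly_Mapping.keys x. \<Sum>m\<in>Poly_Mapping.keys y.
     Poly_Mapping.single (k + m)
       (mat_bracket n (Poly_Mapping.lookup x k) (Poly_Mapping.lookup y m)))"

definition loop_cocycle :: "nat \<Rightarrow> (int \<Rightarrow>\<^sub>0 cmatrix) \<Rightarrow> (int \<Rightarrow>\<^sub>0 cmatrix) \<Rightarrow> complex" where
  "loop_cocycle n x y = (\<Sum>k\<in>Poly_Mapping.keys x.
     of_int k * mat_trace n (mat_mul n (Poly_Mapping.lookup x k) (Poly_Mapping.lookup y (- k))))"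

definition loop_deriv :: "complex \<Rightarrow> (int \<Rightarrow>\<^sub>0 cmatrix) \<Rightarrow> (int \<Rightarrow>\<^sub>0 cmatrix)" where
  "loop_deriv v x = (\<Sum>k\<in>Poly_Mapping.keys x.
     Poly_Mapping.single k (mat_scale (v * of_int k) (Poly_Mapping.lookup x k)))"

text \<open>
  Bilinear extension of
  \<open>[A \<otimes> t\<^sup>k, B \<otimes> t\<^sup>m] = [A, B] \<otimes> t\<^bsup>k+m\<^esup> + k \<delta>\<^bsub>k,-m\<^esub> tr(AB) c\<close> and
  \<open>[d, A \<otimes> t\<^sup>k] = k A \<otimes> t\<^sup>k\<close>, with \<open>c\<close> central; \<open>loop_deriv v\<close> is the action of \<open>v d\<close>.
\<close>

definition bracket :: "nat \<Rightarrow> affine \<Rightarrow> affine \<Rightarrow> affine" where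
  "bracket n = (\<lambda>(x, u, v) (y, u', v').
     (loop_bracket n x y + loop_deriv v y - loop_deriv v' x, loop_cocycle n x y, 0))"

definition affine_sl :: "nat \<Rightarrow> affine set" where
  "affine_sl n = {(x, u, v) | x u v. \<forall>k. Poly_Mapping.lookup x k \<in> sl n}"

definition affine_cartan :: "nat \<Rightarrow> affine set" where
  "affine_cartan n = {(Poly_Mapping.single 0 A, u, v) | A u v. A \<in> sl_cartan n}"

definition affine_nplus :: "nat \<Rightarrow> affine set" where
  "affine_nplus n = affine.span
     ({(Poly_Mapping.single 0 A, 0, 0) | A. A \<in> sl_nplus n} \<union>
      {(Poly_Mapping.single k A, 0, 0) | A k. A \<in> sl n \<and> k > 0})"

definition affine_borel :: "nat \<Rightarrow> affine set" where
  "affine_borel n = {h + x | h x. h \<in> affine_cartan n \<and> x \<in> affine_nplus n}"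

text \<open>
  A functional on the affine Cartan subalgebra is extended by zero to all of \<^typ>\<open>affine\<close>, so that
  equality, sums and multiples of functionals are those of functions.
\<close>

definition cartan_dual :: "nat \<Rightarrow> (affine \<Rightarrow> complex) set" where
  "cartan_dual n = {\<alpha>. (\<forall>h. h \<notin> affine_cartan n \<longrightarrow> \<alpha> h = 0) \<and>
     (\<forall>h\<in>affine_cartan n. \<forall>h'\<in>affine_cartan n. \<alpha> (h + h') = \<alpha> h + \<alpha> h') \<and>
     (\<forall>z. \<forall>h\<in>affine_cartan n. \<alpha> (affine_scale z h) = z * \<alpha> h)}"

definition root_space :: "nat \<Rightarrow> (affine \<Rightarrow> complex) \<Rightarrow> affine set" where
  "root_space n \<alpha> =
     {x \<in> affine_sl n. \<forall>h\<in>affine_cartan n. bracket n h x = affine_scale (\<alpha> h) x}"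

definition roots :: "nat \<Rightarrow> (affine \<Rightarrow> complex) set" where
  "roots n = {\<alpha> \<in> cartan_dual n. \<alpha> \<noteq> 0 \<and> root_space n \<alpha> \<noteq> {0}}"

definition simple_root :: "nat \<Rightarrow> nat \<Rightarrow> affine \<Rightarrow> complex" where
  "simple_root n i = (\<lambda>h. if h \<in> affine_cartan n
     then Poly_Mapping.lookup (fst h) 0 i i - Poly_Mapping.lookup (fst h) 0 (Suc i) (Suc i) else 0)"

definition delta :: "nat \<Rightarrow> affine \<Rightarrow> complex" where
  "delta n = (\<lambda>h. if h \<in> affine_cartan n then snd (snd h) else 0)"

definition box_root :: "nat \<Rightarrow> nat \<Rightarrow> nat \<Rightarrow> affine \<Rightarrow> complex" where
  "box_root n a b =
     (if a < b then (\<Sum>i = a..<b. simple_root n i) else - (\<Sum>i = b..<a. simple_root n i))"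

definition pos_roots :: "nat \<Rightarrow> (affine \<Rightarrow> complex) set" where
  "pos_roots n = {box_root n a b | a b. a \<in> {1..n} \<and> b \<in> {1..n} \<and> a < b}"

definition neg_roots :: "nat \<Rightarrow> (affine \<Rightarrow> complex) set" where
  "neg_roots n = {box_root n a b | a b. a \<in> {1..n} \<and> b \<in> {1..n} \<and> b < a}"

definition D_roots :: "nat \<Rightarrow> (affine \<Rightarrow> complex) set" where
  "D_roots n = pos_roots n \<union> {delta n} \<union> {\<alpha> + delta n | \<alpha>. \<alpha> \<in> neg_roots n}"

definition D'_roots :: "nat \<Rightarrow> (affine \<Rightarrow> complex) set" where
  "D'_roots n = {\<alpha> + (\<lambda>h. of_nat k * delta n h) | \<alpha> k. \<alpha> \<in> D_roots n \<and> k > 0}"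

definition is_ideal :: "nat \<Rightarrow> affine set \<Rightarrow> affine set \<Rightarrow> bool" where
  "is_ideal n L I \<longleftrightarrow> I \<subseteq> L \<and> affine.subspace I \<and> (\<forall>x\<in>L. \<forall>y\<in>I. bracket n x y \<in> I)"

definition finite_codim :: "affine set \<Rightarrow> affine set \<Rightarrow> bool" where
  "finite_codim L I \<longleftrightarrow> (\<exists>S. finite S \<and> S \<subseteq> L \<and> L \<subseteq> affine.span (I \<union> S))"

definition combinatorial_ideal :: "nat \<Rightarrow> affine set \<Rightarrow> bool" where
  "combinatorial_ideal n I \<longleftrightarrow> is_ideal n (affine_borel n) I \<and> I \<subseteq> affine_nplus n \<and>
     finite_codim (affine_borel n) I \<and>
     (\<forall>\<alpha>\<in>roots n. I \<inter> root_space n \<alpha> \<noteq> {0} \<longrightarrow> root_space n \<alpha> \<subseteq> I)"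

definition supp :: "nat \<Rightarrow> affine set \<Rightarrow> (affine \<Rightarrow> complex) set" where
  "supp n I = {\<alpha> \<in> roots n. root_space n \<alpha> \<subseteq> I}"

definition basic_ideal :: "nat \<Rightarrow> affine set \<Rightarrow> bool" where
  "basic_ideal n I \<longleftrightarrow> combinatorial_ideal n I \<and> supp n I \<inter> D_roots n \<noteq> {}"

definition ideal_a :: "nat \<Rightarrow> affine set" where
  "ideal_a n = affine.span (\<Union>\<alpha>\<in>D'_roots n. root_space n \<alpha>)"

text \<open>
  Elements of a quotient by \<open>K\<close> are cosets of \<open>K\<close>.  For an ideal \<open>K\<close> each of the unions below
  is a union of equal cosets, namely the result of the operation induced on the quotient.
\<close>

definition coset :: "affine set \<Rightarrow> affine \<Rightarrow> affine set" where
  "coset K x = {x + z | z. z \<in> K}"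

definition quot_add :: "affine set \<Rightarrow> affine set \<Rightarrow> affine set \<Rightarrow> affine set" where
  "quot_add K U V = (\<Union>u\<in>U. \<Union>v\<in>V. coset K (u + v))"

definition quot_scale :: "affine set \<Rightarrow> complex \<Rightarrow> affine set \<Rightarrow> affine set" where
  "quot_scale K z U = (\<Union>u\<in>U. coset K (affine_scale z u))"

definition quot_bracket :: "nat \<Rightarrow> affine set \<Rightarrow> affine set \<Rightarrow> affine set \<Rightarrow> affine set" where
  "quot_bracket n K U V = (\<Union>u\<in>U. \<Union>v\<in>V. coset K (bracket n u v))"

definition is_abelian_ideal_quot :: "nat \<Rightarrow> affine set \<Rightarrow> affine set \<Rightarrow> affine set set \<Rightarrow> bool" where
  "is_abelian_ideal_quot n L K J \<longleftrightarrow>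
     J \<subseteq> coset K ` L \<and> coset K 0 \<in> J \<and>
     (\<forall>U\<in>J. \<forall>V\<in>J. quot_add K U V \<in> J) \<and>
     (\<forall>z. \<forall>U\<in>J. quot_scale K z U \<in> J) \<and>
     (\<forall>U\<in>coset K ` L. \<forall>V\<in>J. quot_bracket n K U V \<in> J) \<and>
     (\<forall>U\<in>J. \<forall>V\<in>J. quot_bracket n K U V = coset K 0)"

definition quasi_abelian :: "nat \<Rightarrow> affine set \<Rightarrow> bool" where
  "quasi_abelian n I \<longleftrightarrow> basic_ideal n I \<and>
     is_abelian_ideal_quot n (affine_nplus n) (ideal_a n) (coset (ideal_a n) ` I)"

datatype dyck_step = Rise | Fall

definition height :: "dyck_step list \<Rightarrow> nat \<Rightarrow> int" where
  "height p k = int (count_list (take k p) Rise) - int (count_list (take k p) Fall)"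

definition dyck_paths :: "nat \<Rightarrow> dyck_step list set" where
  "dyck_paths n =
     {p. length p = 2 * n \<and> (\<forall>k\<le>2 * n. height p k \<ge> 0) \<and> height p (2 * n) = 0}"

definition path_le :: "dyck_step list \<Rightarrow> dyck_step list \<Rightarrow> bool" where
  "path_le p q \<longleftrightarrow> length p = length q \<and> (\<forall>k\<le>length p. height p k \<le> height q k)"

definition peaks :: "dyck_step list \<Rightarrow> nat set" where
  "peaks p = {k. 0 < k \<and> k < length p \<and> p ! (k - 1) = Rise \<and> p ! k = Fall}"

definition dyck_peaks :: "nat \<Rightarrow> nat \<Rightarrow> nat \<Rightarrow> dyck_step list set" where
  "dyck_peaks n i j =
     {p \<in> dyck_paths n. height p (Min (peaks p)) = int i \<and> height p (Max (peaks p)) = int j}"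

text \<open>
  The convention \<open>\<D>\<^sub>n(0,0) = \<D>\<^sub>n(1,1)\<close> matters only for the set in which the minimal path is taken;
  the pair \<open>(i, j)\<close> attached to \<open>p\<close> consists of its actual first and last peak heights.
\<close>

definition dyck_peaks' :: "nat \<Rightarrow> nat \<Rightarrow> nat \<Rightarrow> dyck_step list set" where
  "dyck_peaks' n i j = (if i = 0 \<and> j = 0 then dyck_peaks n 1 1 else dyck_peaks n i j)"

definition dyck_bar :: "nat \<Rightarrow> dyck_step list \<Rightarrow> dyck_step list" where
  "dyck_bar n p = (THE m. \<exists>i j. p \<in> dyck_peaks n i j \<and> m \<in> dyck_peaks' n (n - j) (n - i) \<and>
     (\<forall>q \<in> dyck_peaks' n (n - j) (n - i). path_le q m \<longrightarrow> q = m))"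

datatype lattice_step = East | South

definition lattice_paths :: "nat \<Rightarrow> lattice_step list set" where
  "lattice_paths n = {w. count_list w East = n \<and> count_list w South = n}"

text \<open>
  A path starting in the top-left corner crosses row \<open>a\<close> in its \<open>a\<close>-th south step; the boxes of
  row \<open>a\<close> to its north-east are those whose column exceeds the number of preceding east steps.
\<close>

definition ne_boxes :: "nat \<Rightarrow> lattice_step list \<Rightarrow> (nat \<times> nat) set" where
  "ne_boxes n w = {(a, b). a \<in> {1..n} \<and> b \<in> {1..n} \<and>
     (\<exists>k<length w. w ! k = South \<and> Suc (count_list (take k w) South) = a \<and>
        count_list (take k w) East < b)}"

definition boundary_path :: "nat \<Rightarrow> (nat \<times> nat) set \<Rightarrow> lattice_step list" where
  "boundary_path n B = (THE w. w \<in> lattice_paths n \<and> ne_boxes n w = B)"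

definition s_plus :: "nat \<Rightarrow> affine set \<Rightarrow> (affine \<Rightarrow> complex) set" where
  "s_plus n I = pos_roots n \<inter> supp n I"

definition s_minus :: "nat \<Rightarrow> affine set \<Rightarrow> (affine \<Rightarrow> complex) set" where
  "s_minus n I = {\<alpha> \<in> neg_roots n. \<alpha> + delta n \<in> supp n I}"

definition boxes :: "nat \<Rightarrow> (affine \<Rightarrow> complex) set \<Rightarrow> (nat \<times> nat) set" where
  "boxes n R = {(a, b). a \<in> {1..n} \<and> b \<in> {1..n} \<and> a \<noteq> b \<and> box_root n a b \<in> R}"

definition upper_boxes :: "nat \<Rightarrow> (nat \<times> nat) set" where
  "upper_boxes n = {(a, b). a \<in> {1..n} \<and> b \<in> {1..n} \<and> a \<le> b}"

definition Phi :: "nat \<Rightarrow> affine set \<Rightarrow> dyck_step list \<times> dyck_step list" where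
  "Phi n I =
     (map (\<lambda>s. case s of East \<Rightarrow> Rise | South \<Rightarrow> Fall) (boundary_path n (boxes n (s_plus n I))),
      map (\<lambda>s. case s of South \<Rightarrow> Rise | East \<Rightarrow> Fall)
        (boundary_path n (upper_boxes n \<union> boxes n (s_minus n I))))"

end

theory Submission
  imports Defs
begin

text \<open>
  Every combinatorial ideal is a sum of root spaces.  A basic one contains \<open>h \<otimes> t\<close>, hence
  all root spaces for \<open>D'\<close> and for the roots \<open>\<alpha> + \<delta>\<close> with \<open>\<alpha>\<close> positive, so it
  is determined by the boxes \<open>P\<close> of \<open>s\<^sub>+\<close> and \<open>M\<close> of \<open>s\<^sub>-\<close>.  Stability under the Borel
  subalgebra means that \<open>P\<close> and \<open>M\<close> are closed under moving north and east, and that a box \<open>(a, b)\<close>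
  of \<open>P\<close> forces the part of row \<open>a\<close> and of column \<open>b\<close> below the diagonal into \<open>M\<close>.
  The image in the quotient is abelian iff no box of \<open>P\<close> has its transpose in \<open>M\<close>.

  For the paths \<open>p\<close> and \<open>q\<close> the last condition says that \<open>q \<le> p\<close>.  If the outer peaks of \<open>p\<close>
  have heights \<open>i\<close> and \<open>j\<close>, the nonempty rows of \<open>P\<close> are the first \<open>n - j\<close> and the nonempty columns
  the last \<open>n - i\<close>, so the forcing condition says that \<open>q\<close> starts with \<open>n - j\<close> rises and ends with
  \<open>n - i\<close> falls, which means that it lies above the least path with this property.
\<close>

section \<open>Brackets and supports\<close>

text \<open>The translation into paths works because a box and its transpose lie on one
  antidiagonal, which the boundary paths of \<open>P\<close> and of \<open>M\<close> both cross at
  time \<open>a + b - 1\<close>. As \<open>Phi\<close> exchanges the roles of east and south for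
  \<open>q\<close>, a box of \<open>P\<close> whose transpose is in \<open>M\<close> shows up as a
  height of \<open>q\<close> exceeding that of \<open>p\<close> at one time. Such pairs are also the
  only obstruction to commutativity: any product of two members of the ideal that falls outside
  \<open>ideal_a\<close> would, by closure and forcing, produce one. The forcing condition ranges
  over all boxes of \<open>P\<close>, but it is decided by the last nonempty row and the first
  nonempty column. This is why only two heights of \<open>q\<close>, and only the outer peaks of
  \<open>p\<close>, enter. If \<open>p\<close> is a single peak of height \<open>n\<close>, then
  \<open>P\<close> is empty and nothing is forced; the convention for \<open>\<D>(0,0)\<close> then
  selects the zigzag path, below every Dyck path, so the lower bound on \<open>q\<close> holds
  automatically.\<close>

abbreviation coef :: "(int \<Rightarrow>\<^sub>0 cmatrix) \<Rightarrow> int \<Rightarrow> cmatrix" where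
  "coef \<equiv> Poly_Mapping.lookup"

lemma mat_bracket_zero [simp]: "mat_bracket n 0 B = 0" "mat_bracket n A 0 = 0"
  by (auto simp: mat_bracket_def mat_mul_def fun_eq_iff)

lemma mat_bracket_add:
  "mat_bracket n (A + A') B = mat_bracket n A B + mat_bracket n A' B"
  "mat_bracket n A (B + B') = mat_bracket n A B + mat_bracket n A B'"
  by (auto simp: mat_bracket_def mat_mul_def fun_eq_iff algebra_simps sum.distrib)

lemma mat_scale_simps [simp]:
  "mat_scale z 0 = 0" "mat_scale 0 A = 0"
  "mat_scale z (A + B) = mat_scale z A + mat_scale z B"
  by (auto simp: mat_scale_def fun_eq_iff algebra_simps)

lemma mat_trace_add: "mat_trace n (A + B) = mat_trace n A + mat_trace n B"
  by (simp add: mat_trace_def sum.distrib)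

lemma mat_mul_zero [simp]: "mat_mul n 0 B = 0" "mat_mul n A 0 = 0"
  by (auto simp: mat_mul_def fun_eq_iff)

lemma mat_mul_add:
  "mat_mul n (A + A') B = mat_mul n A B + mat_mul n A' B"
  "mat_mul n A (B + B') = mat_mul n A B + mat_mul n A B'"
  by (auto simp: mat_mul_def fun_eq_iff algebra_simps sum.distrib)

lemma mat_trace_mul_commute: "mat_trace n (mat_mul n A B) = mat_trace n (mat_mul n B A)"
  unfolding mat_trace_def mat_mul_def
  by (subst sum.swap) (simp add: mult.commute)

lemma mat_trace_zero [simp]: "mat_trace n 0 = 0"
  by (simp add: mat_trace_def)

text \<open>The keys of a sum may be fewer than the union of the keys; with an arbitrary finite
  superset \<open>F\<close>, additivity in \<open>x\<close> can be checked over one index set common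
  to both summands.\<close>

lemma lookup_loop_bracket:
  assumes "finite F" "Poly_Mapping.keys x \<subseteq> F"
  shows "coef (loop_bracket n x y) m = (\<Sum>k\<in>F. mat_bracket n (coef x k) (coef y (m - k)))"
proof -
  have inner: "(\<Sum>j\<in>Poly_Mapping.keys y. coef (Poly_Mapping.single (k + j)
       (mat_bracket n (coef x k) (coef y j))) m) = mat_bracket n (coef x k) (coef y (m - k))" for k
  proof -
    have "(\<Sum>j\<in>Poly_Mapping.keys y. coef (Poly_Mapping.single (k + j)
       (mat_bracket n (coef x k) (coef y j))) m) =
      (\<Sum>j\<in>Poly_Mapping.keys y. if j = m - k then mat_bracket n (coef x k) (coef y j) else 0)"
      by (intro sum.cong) (auto simp: lookup_single when_def)
    also have "\<dots> = mat_bracket n (coef x k) (coef y (m - k))"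
      by (auto simp: sum.delta in_keys_iff)
    finally show ?thesis .
  qed
  have "coef (loop_bracket n x y) m =
    (\<Sum>k\<in>Poly_Mapping.keys x. mat_bracket n (coef x k) (coef y (m - k)))"
    unfolding loop_bracket_def lookup_sum by (intro sum.cong refl inner)
  also have "\<dots> = (\<Sum>k\<in>F. mat_bracket n (coef x k) (coef y (m - k)))"
    using assms by (intro sum.mono_neutral_left) (auto simp: in_keys_iff)
  finally show ?thesis .
qed

lemma lookup_loop_deriv: "coef (loop_deriv v x) m = mat_scale (v * of_int m) (coef x m)"
proof -
  have "coef (loop_deriv v x) m =
    (\<Sum>k\<in>Poly_Mapping.keys x. if k = m then mat_scale (v * of_int k) (coef x k) else 0)"
    unfolding loop_deriv_def lookup_sum by (intro sum.cong) (auto simp: lookup_single when_def)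
  then show ?thesis by (auto simp: sum.delta in_keys_iff)
qed

lemma loop_cocycle_superset:
  assumes "finite F" "Poly_Mapping.keys x \<subseteq> F"
  shows "loop_cocycle n x y = (\<Sum>k\<in>F. of_int k * mat_trace n (mat_mul n (coef x k) (coef y (- k))))"
  unfolding loop_cocycle_def using assms
  by (intro sum.mono_neutral_left) (auto simp: in_keys_iff)

section \<open>Additivity of the bracket in each argument\<close>

lemma loop_bracket_add_left: "loop_bracket n (x + x') y = loop_bracket n x y + loop_bracket n x' y"
proof (rule poly_mapping_eqI)
  fix m
  let ?F = "Poly_Mapping.keys x \<union> Poly_Mapping.keys x'"
  have "Poly_Mapping.keys (x + x') \<subseteq> ?F" by (rule keys_add)
  then show "coef (loop_bracket n (x + x') y) m = coef (loop_bracket n x y + loop_bracket n x' y) m"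
    by (simp add: lookup_add lookup_loop_bracket[of ?F] mat_bracket_add sum.distrib)
qed

lemma loop_bracket_add_right: "loop_bracket n x (y + y') = loop_bracket n x y + loop_bracket n x y'"
  by (rule poly_mapping_eqI)
    (simp add: lookup_add lookup_loop_bracket[of "Poly_Mapping.keys x"] mat_bracket_add sum.distrib)

lemma loop_cocycle_add_left: "loop_cocycle n (x + x') y = loop_cocycle n x y + loop_cocycle n x' y"
proof -
  let ?F = "Poly_Mapping.keys x \<union> Poly_Mapping.keys x'"
  have "Poly_Mapping.keys (x + x') \<subseteq> ?F" by (rule keys_add)
  then show ?thesis
    by (simp add: lookup_add loop_cocycle_superset[of ?F] mat_mul_add mat_trace_add
      sum.distrib distrib_left)
qed

lemma loop_cocycle_add_right: "loop_cocycle n x (y + y') = loop_cocycle n x y + loop_cocycle n x y'"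
  by (simp add: lookup_add loop_cocycle_def mat_mul_add mat_trace_add sum.distrib distrib_left)

lemma loop_deriv_add:
  "loop_deriv v (x + x') = loop_deriv v x + loop_deriv v x'"
  "loop_deriv (v + v') x = loop_deriv v x + loop_deriv v' x"
  by (auto intro!: poly_mapping_eqI
    simp: lookup_loop_deriv lookup_add mat_scale_def fun_eq_iff algebra_simps)

lemma bracket_add:
  "bracket n (x + x') y = bracket n x y + bracket n x' y"
  "bracket n x (y + y') = bracket n x y + bracket n x y'"
  by (cases x; cases x'; cases y; simp add: bracket_def loop_bracket_add_left loop_deriv_add
      loop_cocycle_add_left algebra_simps)
    (cases x; cases y; cases y'; simp add: bracket_def loop_bracket_add_right loop_deriv_add
      loop_cocycle_add_right algebra_simps)

lemma loop_deriv_zero [simp]: "loop_deriv 0 x = 0"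
  by (rule poly_mapping_eqI) (simp add: lookup_loop_deriv)

section \<open>Traceless matrices and subspaces given by a support\<close>

lemma mat_bracket_in_sl:
  assumes "A \<in> matrices n" "B \<in> matrices n"
  shows "mat_bracket n A B \<in> sl n"
proof -
  have "mat_trace n (mat_bracket n A B) = 0"
    using mat_trace_mul_commute[of n A B]
    by (simp add: mat_bracket_def mat_trace_def sum_subtractf)
  with assms show ?thesis
    by (auto simp: sl_def matrices_def mat_bracket_def mat_mul_def)
qed

lemma sl_zero [simp]: "0 \<in> sl n"
  by (simp add: sl_def matrices_def)

lemma sl_add: "A \<in> sl n \<Longrightarrow> B \<in> sl n \<Longrightarrow> A + B \<in> sl n"
  by (simp add: sl_def matrices_def mat_trace_add)

lemma sl_scale: "A \<in> sl n \<Longrightarrow> mat_scale z A \<in> sl n"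
  by (auto simp: sl_def matrices_def mat_trace_def mat_scale_def simp flip: sum_distrib_left)

lemma sl_sum: "(\<And>i. i \<in> F \<Longrightarrow> f i \<in> sl n) \<Longrightarrow> sum f F \<in> sl n"
  by (induction F rule: infinite_finite_induct) (auto intro: sl_add)

lemma sl_matrices: "A \<in> sl n \<Longrightarrow> A \<in> matrices n"
  by (simp add: sl_def)

text \<open>
  Sums of root spaces, the real ones being indexed by their matrix entry and degree; \<open>T k\<close> is meant to
  contain all diagonal entries or none.
\<close>

definition supported :: "nat \<Rightarrow> (int \<Rightarrow> nat \<Rightarrow> nat \<Rightarrow> bool) \<Rightarrow> affine set" where
  "supported n T = {(x, 0, 0) | x.
     \<forall>k. coef x k \<in> sl n \<and> (\<forall>a b. coef x k a b \<noteq> 0 \<longrightarrow> T k a b)}"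

lemma in_supported_iff: "(x, u, v) \<in> supported n T \<longleftrightarrow> u = 0 \<and> v = 0 \<and>
    (\<forall>k. coef x k \<in> sl n \<and> (\<forall>a b. coef x k a b \<noteq> 0 \<longrightarrow> T k a b))"
  by (auto simp: supported_def)

lemma supported_mono:
  assumes T: "\<And>k a b. a \<in> {1..n} \<Longrightarrow> b \<in> {1..n} \<Longrightarrow> T k a b \<Longrightarrow> T' k a b"
  shows "supported n T \<subseteq> supported n T'"
proof
  fix x assume x: "x \<in> supported n T"
  obtain y u v where eq: "x = (y, u, v)" by (cases x)
  have "T' k a b" if nz: "coef y k a b \<noteq> 0" for k a b
  proof -
    have "coef y k \<in> matrices n" "T k a b"
      using x nz by (auto simp: eq in_supported_iff sl_def)
    then show ?thesis using nz T unfolding matrices_def by blast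
  qed
  then show "x \<in> supported n T'"
    using x by (simp add: eq in_supported_iff)
qed

lemma supported_cong:
  assumes "\<And>k a b. a \<in> {1..n} \<Longrightarrow> b \<in> {1..n} \<Longrightarrow> T k a b \<longleftrightarrow> T' k a b"
  shows "supported n T = supported n T'"
  using assms by (intro subset_antisym supported_mono) auto

lemma subspace_supported: "affine.subspace (supported n T)"
proof (rule affine.subspaceI)
  show "0 \<in> supported n T" by (simp add: zero_prod_def in_supported_iff)
next
  fix x y assume xy: "x \<in> supported n T" "y \<in> supported n T"
  obtain x1 x2 x3 y1 y2 y3 where eq: "x = (x1, x2, x3)" "y = (y1, y2, y3)" by (cases x; cases y)
  have "T k a b" if "coef x1 k a b + coef y1 k a b \<noteq> 0" for k a b
    using xy that by (cases "coef x1 k a b = 0") (auto simp: in_supported_iff eq)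
  then show "x + y \<in> supported n T"
    using xy by (auto simp: in_supported_iff eq lookup_add sl_add)
next
  fix c x assume "x \<in> supported n T"
  then show "affine_scale c x \<in> supported n T"
    by (cases x) (auto simp: in_supported_iff affine_scale_def sl_scale, auto simp: mat_scale_def)
qed

lemma mat_mul_nonzero: "mat_mul n A B a b \<noteq> 0 \<Longrightarrow> \<exists>c\<in>{1..n}. A a c \<noteq> 0 \<and> B c b \<noteq> 0"
  unfolding mat_mul_def by (rule ccontr) (auto intro!: sum.neutral)

lemma sum_fun_apply2: "(\<Sum>i\<in>F. f i) a b = (\<Sum>i\<in>F. f i a b)"
  for f :: "'i \<Rightarrow> nat \<Rightarrow> nat \<Rightarrow> 'c::comm_monoid_add"
  by (induction F rule: infinite_finite_induct) auto

text \<open>Reduces every closure claim to index pairs: supports multiply like matrix units, so both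
  orders of the product have to be checked. The cocycle pairs degrees \<open>k\<close> and
  \<open>- k\<close>; if both are nonnegative then \<open>k = 0\<close>, and its factor
  \<open>k\<close> vanishes. The component \<open>v\<close> of \<open>d\<close> merely rescales each
  degree of \<open>y\<close>, whence the last assumption.\<close>

lemma bracket_supported:
  assumes x: "\<And>k. coef x k \<in> sl n" "\<And>k a b. coef x k a b \<noteq> 0 \<Longrightarrow> T1 k a b"
    and y: "(y, 0, 0) \<in> supported n T2"
    and nonneg: "\<And>k a b. T1 k a b \<Longrightarrow> k \<ge> 0" "\<And>k a b. T2 k a b \<Longrightarrow> k \<ge> 0"
    and T12: "\<And>k m a b c. {a, b, c} \<subseteq> {1..n} \<Longrightarrow> T1 k a c \<Longrightarrow> T2 m c b \<Longrightarrow> T3 (k + m) a b"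
    and T21: "\<And>k m a b c. {a, b, c} \<subseteq> {1..n} \<Longrightarrow> T2 k a c \<Longrightarrow> T1 m c b \<Longrightarrow> T3 (k + m) a b"
    and v: "v = 0 \<or> (\<forall>k a b. T2 k a b \<longrightarrow> T3 k a b)"
  shows "bracket n (x, u, v) (y, 0, 0) \<in> supported n T3"
proof -
  have ysl: "coef y k \<in> sl n" and yT: "coef y k a b \<noteq> 0 \<Longrightarrow> T2 k a b" for k a b
    using y by (auto simp: in_supported_iff)
  have co: "loop_cocycle n x y = 0"
    unfolding loop_cocycle_def
  proof (rule sum.neutral, rule ballI)
    fix k
    have "mat_mul n (coef x k) (coef y (- k)) = 0" if "k \<noteq> 0"
    proof (rule ccontr)
      assume "mat_mul n (coef x k) (coef y (- k)) \<noteq> 0"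
      then obtain a b where "mat_mul n (coef x k) (coef y (- k)) a b \<noteq> 0"
        by (auto simp: fun_eq_iff)
      from mat_mul_nonzero[OF this] obtain c where "coef x k a c \<noteq> 0" "coef y (-k) c b \<noteq> 0"
        by auto
      then have "k \<ge> 0" "-k \<ge> 0" using x(2) yT nonneg by blast+
      then show False using that by simp
    qed
    then show "of_int k * mat_trace n (mat_mul n (coef x k) (coef y (- k))) = 0"
      by (cases "k = 0") auto
  qed
  let ?z = "loop_bracket n x y + loop_deriv v y"
  have z: "coef ?z m = (\<Sum>k\<in>Poly_Mapping.keys x. mat_bracket n (coef x k) (coef y (m - k)))
      + mat_scale (v * of_int m) (coef y m)" for m
    by (simp add: lookup_add lookup_loop_bracket[of "Poly_Mapping.keys x"] lookup_loop_deriv)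
  have zsl: "coef ?z m \<in> sl n" for m
    unfolding z
    by (intro sl_add sl_sum sl_scale mat_bracket_in_sl sl_matrices x ysl)
  have zT: "T3 m a b" if nz: "coef ?z m a b \<noteq> 0" for m a b
  proof (cases "mat_scale (v * of_int m) (coef y m) a b = 0")
    case False
    then show ?thesis using v yT by (auto simp: mat_scale_def)
  next
    case True
    have ab: "a \<in> {1..n}" "b \<in> {1..n}" using zsl[of m] nz by (auto simp: sl_def matrices_def)
    from True nz have "(\<Sum>k\<in>Poly_Mapping.keys x. mat_bracket n (coef x k) (coef y (m - k)) a b) \<noteq> 0"
      by (simp add: z sum_fun_apply2)
    then obtain k where "mat_bracket n (coef x k) (coef y (m - k)) a b \<noteq> 0"
      by (rule sum.not_neutral_contains_not_neutral)
    then have "mat_mul n (coef x k) (coef y (m - k)) a b \<noteq> 0 \<or>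
      mat_mul n (coef y (m - k)) (coef x k) a b \<noteq> 0"
      by (auto simp: mat_bracket_def)
    then show ?thesis
    proof
      assume "mat_mul n (coef x k) (coef y (m - k)) a b \<noteq> 0"
      from mat_mul_nonzero[OF this] obtain c where
        "c \<in> {1..n}" "coef x k a c \<noteq> 0" "coef y (m - k) c b \<noteq> 0" by auto
      then show ?thesis using T12[of a b c k "m - k"] ab x(2) yT by auto
    next
      assume "mat_mul n (coef y (m - k)) (coef x k) a b \<noteq> 0"
      from mat_mul_nonzero[OF this] obtain c where
        "c \<in> {1..n}" "coef y (m - k) a c \<noteq> 0" "coef x k c b \<noteq> 0" by auto
      then show ?thesis using T21[of a b c "m - k" k] ab x(2) yT by auto
    qed
  qed
  show ?thesis using zsl zT by (simp add: bracket_def co in_supported_iff)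
qed

section \<open>Root spaces\<close>

text \<open>Identifies the diagonal boxes with one another, as they share the weight \<open>0\<close>.\<close>

definition rep :: "nat \<Rightarrow> nat \<Rightarrow> nat \<times> nat" where
  "rep a b = (if a = b then (0, 0) else (a, b))"

text \<open>The weight \<open>\<epsilon>_a - \<epsilon>_b + k \<delta>\<close> of
  \<open>e_ab \<otimes> t^k\<close>, extended by zero off the Cartan subalgebra as
  \<open>cartan_dual\<close> demands.\<close>

definition wt :: "nat \<Rightarrow> int \<Rightarrow> nat \<Rightarrow> nat \<Rightarrow> affine \<Rightarrow> complex" where
  "wt n k a b = (\<lambda>h. if h \<in> affine_cartan n
     then coef (fst h) 0 a a - coef (fst h) 0 b b + of_int k * snd (snd h) else 0)"

text \<open>A root space described by matrix entries instead of eigenvalues. The two descriptions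
  agree for nonzero weights only: the eigenspace of weight 0 also contains \<open>c\<close> and
  \<open>d\<close>.\<close>

definition weight_space :: "nat \<Rightarrow> int \<Rightarrow> nat \<Rightarrow> nat \<Rightarrow> affine set" where
  "weight_space n k a b = supported n (\<lambda>m i j. m = k \<and> rep i j = rep a b)"

definition unit_mat :: "nat \<Rightarrow> nat \<Rightarrow> cmatrix" where
  "unit_mat a b = (\<lambda>i j. if i = a \<and> j = b then 1 else 0)"

lemma unit_mat_sl: "a \<in> {1..n} \<Longrightarrow> b \<in> {1..n} \<Longrightarrow> a \<noteq> b \<Longrightarrow> unit_mat a b \<in> sl n"
  by (auto simp: unit_mat_def sl_def matrices_def mat_trace_def intro!: sum.neutral)

lemma unit_mat_diff_cartan:
  assumes "a \<in> {1..n}" "b \<in> {1..n}"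
  shows "unit_mat a a - unit_mat b b \<in> sl_cartan n"
proof -
  have "(\<Sum>i = 1..n. (if i = a then 1 else 0) - (if i = b then 1 else (0::complex))) = 0"
    using assms by (simp add: sum_subtractf)
  then show ?thesis
    using assms by (auto simp: unit_mat_def sl_cartan_def sl_def matrices_def mat_trace_def)
qed

lemma sl_cartan_sl: "A \<in> sl_cartan n \<Longrightarrow> A \<in> sl n"
  by (simp add: sl_cartan_def)

lemma sl_cartan_zero [simp]: "0 \<in> sl_cartan n"
  by (simp add: sl_cartan_def)

lemma affine_cartan_iff:
  "h \<in> affine_cartan n \<longleftrightarrow> (\<exists>H u v. h = (Poly_Mapping.single 0 H, u, v) \<and> H \<in> sl_cartan n)"
  by (auto simp: affine_cartan_def)

lemma wt_apply:
  "H \<in> sl_cartan n \<Longrightarrow>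
    wt n k a b (Poly_Mapping.single 0 H, u, v) = H a a - H b b + of_int k * v"
  by (auto simp: wt_def affine_cartan_iff)

text \<open>Evaluation at \<open>d\<close> gives the degree. For \<open>a \<noteq> b\<close> the
  element \<open>e_aa - e_bb\<close> takes the value 2 on its own root, and on no other pair of
  indices.\<close>

lemma wt_eqD:
  assumes eq: "wt n k a b = wt n k' a' b'"
    and rng: "{a, b, a', b'} \<subseteq> {1..n}"
  shows "k = k' \<and> rep a b = rep a' b'"
proof -
  have ev: "H a a - H b b + of_int k * v = H a' a' - H b' b' + of_int k' * v"
    if "H \<in> sl_cartan n" for H v
    using fun_cong[OF eq, of "(Poly_Mapping.single 0 H, 0, v)"] that by (simp add: wt_apply)
  have k: "k = k'" using ev[of 0 1] by simp
  have "(a, b) = (a', b')" if "a \<noteq> b \<or> a' \<noteq> b'"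
    using that
  proof
    assume "a \<noteq> b"
    then show ?thesis
      using ev[of "unit_mat a a - unit_mat b b" 0] unit_mat_diff_cartan[of a n b] rng
      by (auto simp: unit_mat_def split: if_splits)
  next
    assume "a' \<noteq> b'"
    then show ?thesis
      using ev[of "unit_mat a' a' - unit_mat b' b'" 0] unit_mat_diff_cartan[of a' n b'] rng
      by (auto simp: unit_mat_def split: if_splits)
  qed
  then show ?thesis using k by (auto simp: rep_def)
qed

lemma mat_mul_diag:
  assumes "\<And>a b. a \<noteq> b \<Longrightarrow> H a b = 0" "B \<in> matrices n"
  shows "mat_mul n H B a b = H a a * B a b" "mat_mul n B H a b = B a b * H b b"
proof -
  have "mat_mul n H B a b = (\<Sum>c = 1..n. if c = a then H a a * B a b else 0)"
    unfolding mat_mul_def using assms(1) by (intro sum.cong) auto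
  then show "mat_mul n H B a b = H a a * B a b"
    using assms(2) by (auto simp: matrices_def)
  have "mat_mul n B H a b = (\<Sum>c = 1..n. if c = b then B a b * H b b else 0)"
    unfolding mat_mul_def using assms(1) by (intro sum.cong) auto
  then show "mat_mul n B H a b = B a b * H b b"
    using assms(2) by (auto simp: matrices_def)
qed

lemma lookup_loop_bracket_single:
  "coef (loop_bracket n (Poly_Mapping.single k A) y) m = mat_bracket n A (coef y (m - k))"
  by (simp add: lookup_loop_bracket[of "{k}"])

lemma bracket_cartan:
  assumes "H \<in> sl_cartan n" "\<And>k. coef y k \<in> matrices n"
  obtains z where "bracket n (Poly_Mapping.single 0 H, u, v) (y, u', v') = (z, 0, 0)"
    "\<And>m a b. coef z m a b = (H a a - H b b + of_int m * v) * coef y m a b"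
proof
  have *: "loop_deriv v' (Poly_Mapping.single 0 H) = 0"
    by (rule poly_mapping_eqI) (auto simp: lookup_loop_deriv lookup_single when_def)
  show "bracket n (Poly_Mapping.single 0 H, u, v) (y, u', v') =
    (loop_bracket n (Poly_Mapping.single 0 H) y + loop_deriv v y, 0, 0)"
    by (simp add: bracket_def * loop_cocycle_superset[of "{0}"])
  show "coef (loop_bracket n (Poly_Mapping.single 0 H) y + loop_deriv v y) m a b =
    (H a a - H b b + of_int m * v) * coef y m a b" for m a b
    using assms mat_mul_diag[of H "coef y m" n]
    by (simp add: lookup_add lookup_loop_bracket_single lookup_loop_deriv mat_bracket_def
        mat_scale_def sl_cartan_def algebra_simps)
qed

lemma subspace_weight_space: "affine.subspace (weight_space n k a b)"
  unfolding weight_space_def by (rule subspace_supported)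

lemma weight_space_eigen:
  assumes x: "x \<in> weight_space n k a b" and ab: "a \<noteq> 0" "b \<noteq> 0" and h: "h \<in> affine_cartan n"
  shows "bracket n h x = affine_scale (wt n k a b h) x"
proof -
  from h obtain H u v where hd: "h = (Poly_Mapping.single 0 H, u, v)" "H \<in> sl_cartan n"
    by (auto simp: affine_cartan_iff)
  from x obtain y where y: "x = (y, 0, 0)" "\<And>m. coef y m \<in> sl n"
    "\<And>m i j. coef y m i j \<noteq> 0 \<Longrightarrow> m = k \<and> rep i j = rep a b"
    unfolding weight_space_def by (cases x) (auto simp: in_supported_iff)
  obtain z where z: "bracket n h x = (z, 0, 0)"
    "\<And>m a b. coef z m a b = (H a a - H b b + of_int m * v) * coef y m a b"
    using bracket_cartan[OF hd(2), of y u v 0 0] y(2) unfolding hd(1) y(1)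
    by (metis sl_matrices)
  have "coef z m i j = wt n k a b h * coef y m i j" for m i j
  proof (cases "coef y m i j = 0")
    case False
    from y(3)[OF this] have "m = k" "rep i j = rep a b" by auto
    then show ?thesis using ab hd(2)
      by (auto simp: z(2) hd(1) wt_apply rep_def split: if_splits)
  qed (simp add: z)
  then have "z = Poly_Mapping.map (mat_scale (wt n k a b h)) y"
    by (intro poly_mapping_eqI) (simp add: fun_eq_iff mat_scale_def)
  with z(1) show ?thesis by (simp add: y(1) affine_scale_def)
qed

lemma wt_eq_zeroD:
  assumes "wt n k a b = 0" "a \<in> {1..n}" "b \<in> {1..n}"
  shows "k = 0 \<and> a = b"
proof -
  have "wt n k a b = wt n 0 a a" using assms by (auto simp: wt_def fun_eq_iff)
  from wt_eqD[OF this] assms show ?thesis by (auto simp: rep_def split: if_splits)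
qed

lemma cartan_dual_outside: "\<alpha> \<in> cartan_dual n \<Longrightarrow> h \<notin> affine_cartan n \<Longrightarrow> \<alpha> h = 0"
  unfolding cartan_dual_def by blast

text \<open>A bracket with a Cartan element has no \<open>c\<close> or \<open>d\<close> component,
  so an eigenvector with nonzero eigenvalue has none either. Comparing one nonzero matrix entry on
  both sides of the eigenvalue equation then determines \<open>\<alpha>\<close>.\<close>

lemma root_space_coef:
  assumes x: "x \<in> root_space n \<alpha>" and \<alpha>: "\<alpha> \<in> cartan_dual n" "\<alpha> \<noteq> 0"
  obtains y where "x = (y, 0, 0)" "\<And>m. coef y m \<in> sl n"
    "\<And>m i j. coef y m i j \<noteq> 0 \<Longrightarrow> \<alpha> = wt n m i j"
proof -
  obtain y u v where y: "x = (y, u, v)" by (cases x)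
  have ysl: "coef y m \<in> sl n" for m
    using x by (auto simp: root_space_def affine_sl_def y)
  have br: "bracket n h x = affine_scale (\<alpha> h) x" if "h \<in> affine_cartan n" for h
    using x that by (auto simp: root_space_def)
  from \<alpha> obtain h0 where h0: "\<alpha> h0 \<noteq> 0" by (auto simp: fun_eq_iff)
  then have h0c: "h0 \<in> affine_cartan n" using cartan_dual_outside[OF \<alpha>(1)] by blast
  have "snd (bracket n h0 x) = (0, 0)"
  proof -
    from h0c obtain H u' v' where hd: "h0 = (Poly_Mapping.single 0 H, u', v')" "H \<in> sl_cartan n"
      by (auto simp: affine_cartan_iff)
    show ?thesis
      using bracket_cartan[OF hd(2), of y u' v' u v] ysl unfolding hd(1) y
      by (metis sl_matrices snd_conv)
  qed
  then have uv: "u = 0" "v = 0" using h0 br[OF h0c] by (auto simp: y affine_scale_def)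
  have "\<alpha> = wt n m i j" if nz: "coef y m i j \<noteq> 0" for m i j
  proof
    fix h
    show "\<alpha> h = wt n m i j h"
    proof (cases "h \<in> affine_cartan n")
      case False
      then show ?thesis using cartan_dual_outside[OF \<alpha>(1)] by (simp add: wt_def)
    next
      case True
      then obtain H u' v' where hd: "h = (Poly_Mapping.single 0 H, u', v')" "H \<in> sl_cartan n"
        by (auto simp: affine_cartan_iff)
      obtain z where z: "bracket n h x = (z, 0, 0)"
        "\<And>m a b. coef z m a b = (H a a - H b b + of_int m * v') * coef y m a b"
        using bracket_cartan[OF hd(2), of y u' v' u v] ysl unfolding hd(1) y
        by (metis sl_matrices)
      have "z = Poly_Mapping.map (mat_scale (\<alpha> h)) y"
        using br[OF True] z(1) by (simp add: y affine_scale_def)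
      then have "coef z m i j = \<alpha> h * coef y m i j" by (simp add: mat_scale_def)
      then show ?thesis using z(2)[of m i j] nz hd by (simp add: wt_apply)
    qed
  qed
  then show ?thesis using that y ysl uv by blast
qed

lemma wt_cartan_dual: "wt n k a b \<in> cartan_dual n"
proof -
  have "h + h' \<in> affine_cartan n" if "h \<in> affine_cartan n" "h' \<in> affine_cartan n" for h h'
  proof -
    from that obtain H u v H' u' v' where "h = (Poly_Mapping.single 0 H, u, v)" "H \<in> sl_cartan n"
      "h' = (Poly_Mapping.single 0 H', u', v')" "H' \<in> sl_cartan n"
      by (auto simp: affine_cartan_iff)
    moreover from this have "H + H' \<in> sl_cartan n"
      by (auto simp: sl_cartan_def sl_add)
    ultimately show ?thesis by (auto simp: affine_cartan_iff simp flip: single_add)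
  qed
  moreover have "affine_scale z h \<in> affine_cartan n" if "h \<in> affine_cartan n" for z h
  proof -
    from that obtain H u v where "h = (Poly_Mapping.single 0 H, u, v)" "H \<in> sl_cartan n"
      by (auto simp: affine_cartan_iff)
    moreover from this have "mat_scale z H \<in> sl_cartan n"
      by (auto simp: sl_cartan_def sl_scale) (simp add: mat_scale_def)
    moreover have "Poly_Mapping.map (mat_scale z) (Poly_Mapping.single 0 H) =
        Poly_Mapping.single (0::int) (mat_scale z H)"
      by (rule poly_mapping_eqI) (auto simp: lookup_single when_def)
    ultimately show ?thesis by (auto simp: affine_cartan_iff affine_scale_def)
  qed
  moreover have "coef (fst (affine_scale z h)) 0 i i = z * coef (fst h) 0 i i"
    "snd (snd (affine_scale z h)) = z * snd (snd h)" for z h i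
    by (simp_all add: affine_scale_def mat_scale_def split: prod.splits)
  ultimately show ?thesis
    unfolding cartan_dual_def mem_Collect_eq wt_def
    by (simp add: lookup_add algebra_simps)
qed

lemma root_space_wt:
  assumes ab: "a \<in> {1..n}" "b \<in> {1..n}" and nz: "k \<noteq> 0 \<or> a \<noteq> b"
  shows "root_space n (wt n k a b) = weight_space n k a b"
proof
  show "root_space n (wt n k a b) \<subseteq> weight_space n k a b"
  proof
    fix x assume x: "x \<in> root_space n (wt n k a b)"
    have "wt n k a b \<noteq> 0" using wt_eq_zeroD ab nz by blast
    from root_space_coef[OF x wt_cartan_dual this] obtain y where
      y: "x = (y, 0, 0)" "\<And>m. coef y m \<in> sl n"
      "\<And>m i j. coef y m i j \<noteq> 0 \<Longrightarrow> wt n k a b = wt n m i j" by blast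
    have "m = k \<and> rep i j = rep a b" if "coef y m i j \<noteq> 0" for m i j
    proof -
      have "i \<in> {1..n}" "j \<in> {1..n}" using that y(2)[of m] by (auto simp: sl_def matrices_def)
      then show ?thesis using wt_eqD[OF y(3)[OF that]] ab by auto
    qed
    then show "x \<in> weight_space n k a b"
      using y by (auto simp: weight_space_def in_supported_iff)
  qed
  show "weight_space n k a b \<subseteq> root_space n (wt n k a b)"
  proof
    fix x assume x: "x \<in> weight_space n k a b"
    then have "x \<in> affine_sl n"
      by (cases x) (auto simp: weight_space_def in_supported_iff affine_sl_def)
    with x show "x \<in> root_space n (wt n k a b)"
      using weight_space_eigen[OF x] ab by (auto simp: root_space_def)
  qed
qed

lemma single_in_weight_space:
  assumes "a \<in> {1..n}" "b \<in> {1..n}" "a \<noteq> b"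
  shows "(Poly_Mapping.single k (unit_mat a b), 0, 0) \<in> weight_space n k a b"
    "(Poly_Mapping.single k (unit_mat a a - unit_mat b b), 0, 0) \<in> weight_space n k a a"
  using assms unit_mat_sl[of a n b] sl_cartan_sl[OF unit_mat_diff_cartan[of a n b]]
  by (auto simp: weight_space_def in_supported_iff lookup_single when_def)
    (auto simp: unit_mat_def rep_def split: if_splits)

lemma single_unit_nonzero:
  "(Poly_Mapping.single k (unit_mat a b), 0, 0) \<noteq> (0::affine)"
  "a \<noteq> b \<Longrightarrow> (Poly_Mapping.single k (unit_mat a a - unit_mat b b), 0, 0) \<noteq> (0::affine)"
proof -
  have "Poly_Mapping.single k A \<noteq> 0" if "A i j \<noteq> 0" for A :: cmatrix and i j
    using that by (metis lookup_single_eq lookup_zero zero_fun_apply)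
  from this[of "unit_mat a b" a b] this[of "unit_mat a a - unit_mat b b" a a]
  show "(Poly_Mapping.single k (unit_mat a b), 0, 0) \<noteq> (0::affine)"
    "a \<noteq> b \<Longrightarrow> (Poly_Mapping.single k (unit_mat a a - unit_mat b b), 0, 0) \<noteq> (0::affine)"
    by (auto simp: zero_prod_def unit_mat_def)
qed

lemma wt_in_roots:
  assumes "n \<ge> 2" "a \<in> {1..n}" "b \<in> {1..n}" "k \<noteq> 0 \<or> a \<noteq> b"
  shows "wt n k a b \<in> roots n"
proof -
  have "\<exists>x\<in>weight_space n k a b. x \<noteq> 0"
  proof (cases "a = b")
    case True
    \<comment> \<open>An index other than \<open>a\<close>, available because
      \<open>n \<ge> 2\<close>: it makes \<open>e_aa - e_cc\<close> a nonzero traceless diagonal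
      matrix.\<close>
    define c where "c = (if a = 1 then 2 else 1 :: nat)"
    have "c \<in> {1..n}" "a \<noteq> c" using assms(1) by (auto simp: c_def)
    then show ?thesis
      using single_in_weight_space(2)[of a n c k] single_unit_nonzero(2)[of a c k] assms(2) True
      by blast
  next
    case False
    then show ?thesis
      using single_in_weight_space(1)[OF assms(2,3)] single_unit_nonzero(1) by blast
  qed
  then have "root_space n (wt n k a b) \<noteq> {0}"
    using root_space_wt[of a n b k] assms by auto
  then show ?thesis
    using wt_eq_zeroD[of n k a b] assms wt_cartan_dual unfolding roots_def by blast
qed

lemma rootsE:
  assumes "\<alpha> \<in> roots n"
  obtains k a b where "\<alpha> = wt n k a b" "a \<in> {1..n}" "b \<in> {1..n}" "k \<noteq> 0 \<or> a \<noteq> b"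
proof -
  have \<alpha>: "\<alpha> \<in> cartan_dual n" "\<alpha> \<noteq> 0" using assms by (auto simp: roots_def)
  \<comment> \<open>Without this, \<open>root_space n \<alpha> \<noteq> {0}\<close> could also mean
    that the set is empty.\<close>
  have "0 \<in> root_space n \<alpha>"
  proof -
    have "bracket n h 0 = 0" for h using bracket_add(2)[of n h 0 0] by simp
    then show ?thesis by (auto simp: root_space_def affine_sl_def zero_prod_def affine_scale_def intro!: poly_mapping_eqI)
  qed
  with assms obtain x where x: "x \<in> root_space n \<alpha>" "x \<noteq> 0" by (auto simp: roots_def)
  from root_space_coef[OF x(1) \<alpha>] obtain y where y: "x = (y, 0, 0)" "\<And>m. coef y m \<in> sl n"
    "\<And>m i j. coef y m i j \<noteq> 0 \<Longrightarrow> \<alpha> = wt n m i j" by blast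
  have "\<exists>m i j. coef y m i j \<noteq> 0"
  proof (rule ccontr)
    assume "\<not> ?thesis"
    then have "y = 0" by (intro poly_mapping_eqI) (simp add: fun_eq_iff)
    then show False using x y by (simp add: zero_prod_def)
  qed
  then obtain m i j where nz: "coef y m i j \<noteq> 0" by blast
  have "i \<in> {1..n}" "j \<in> {1..n}" using nz y(2)[of m] by (auto simp: sl_def matrices_def)
  moreover have "m \<noteq> 0 \<or> i \<noteq> j"
  proof (rule ccontr)
    assume "\<not> ?thesis"
    then have "\<alpha> = 0" using y(3)[OF nz] by (auto simp: wt_def fun_eq_iff)
    then show False using \<alpha> by simp
  qed
  ultimately show ?thesis using that y(3)[OF nz] by blast
qed

section \<open>Weight decomposition\<close>

text \<open>The component of weight \<open>wt n k a b\<close>. For \<open>a = b\<close> it keeps the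
  whole diagonal of the coefficient in degree \<open>k\<close>, so that it remains
  traceless.\<close>

definition piece :: "(int \<Rightarrow>\<^sub>0 cmatrix) \<Rightarrow> int \<times> nat \<times> nat \<Rightarrow> affine" where
  "piece x = (\<lambda>(k, a, b).
     (Poly_Mapping.single k (\<lambda>i j. if rep i j = rep a b then coef x k i j else 0), 0, 0))"

text \<open>One index pair for each weight within a degree; \<open>(1, 1)\<close> stands for the
  whole diagonal.\<close>

definition box_reps :: "nat \<Rightarrow> (nat \<times> nat) set" where
  "box_reps n = insert (1, 1) {(a, b). a \<noteq> b \<and> a \<in> {1..n} \<and> b \<in> {1..n}}"

lemma finite_box_reps: "finite (box_reps n)"
  by (rule finite_subset[of _ "insert (1, 1) ({1..n} \<times> {1..n})"]) (auto simp: box_reps_def)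

lemma box_repsE:
  assumes "i \<in> {1..n}" "j \<in> {1..n}"
  obtains a b where "(a, b) \<in> box_reps n" "rep i j = rep a b"
    "\<And>a' b'. (a', b') \<in> box_reps n \<Longrightarrow> rep i j = rep a' b' \<Longrightarrow> a' = a \<and> b' = b"
proof (cases "i = j")
  case True
  show ?thesis by (rule that[of 1 1]) (use True assms in \<open>auto simp: box_reps_def rep_def split: if_splits\<close>)
next
  case False
  show ?thesis by (rule that[of i j]) (use False assms in \<open>auto simp: box_reps_def rep_def split: if_splits\<close>)
qed

lemma piece_in_weight_space:
  assumes "coef x k \<in> sl n" "a \<in> {1..n}" "b \<in> {1..n}"
  shows "piece x (k, a, b) \<in> weight_space n k a b"
proof -
  let ?A = "\<lambda>i j. if rep i j = rep a b then coef x k i j else 0"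
  have "mat_trace n ?A = (if a = b then mat_trace n (coef x k) else 0)"
    using assms(2) by (auto simp: mat_trace_def rep_def intro!: sum.neutral)
  then have "?A \<in> sl n" using assms(1) by (auto simp: sl_def matrices_def)
  then show ?thesis
    by (auto simp: piece_def weight_space_def in_supported_iff lookup_single when_def)
qed

lemma piece_eq_zero:
  assumes "\<And>i j. rep i j = rep a b \<Longrightarrow> coef x k i j = 0"
  shows "piece x (k, a, b) = 0"
proof -
  have "(\<lambda>i j. if rep i j = rep a b then coef x k i j else 0) = 0"
    using assms by (auto simp: fun_eq_iff)
  then show ?thesis by (simp add: piece_def zero_prod_def)
qed

lemma sum_pieces:
  assumes x: "\<And>k. coef x k \<in> matrices n"
  shows "(x, 0, 0) = (\<Sum>i\<in>Poly_Mapping.keys x \<times> box_reps n. piece x i)"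
proof -
  let ?I = "Poly_Mapping.keys x \<times> box_reps n"
  have "coef (\<Sum>i\<in>?I. fst (piece x i)) m i j = coef x m i j" for m i j
  proof (cases "coef x m i j = 0")
    case True
    then show ?thesis
      by (auto simp: lookup_sum sum_fun_apply2 piece_def lookup_single when_def intro!: sum.neutral)
  next
    case False
    then have ij: "i \<in> {1..n}" "j \<in> {1..n}" and m: "m \<in> Poly_Mapping.keys x"
      using x[of m] by (auto simp: matrices_def in_keys_iff)
    obtain a b where ab: "(a, b) \<in> box_reps n" "rep i j = rep a b"
      "\<And>a' b'. (a', b') \<in> box_reps n \<Longrightarrow> rep i j = rep a' b' \<Longrightarrow> a' = a \<and> b' = b"
      using box_repsE[OF ij] by blast
    have "(\<Sum>r\<in>?I. coef (fst (piece x r)) m i j) =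
      (\<Sum>r\<in>?I. if r = (m, a, b) then coef x m i j else 0)"
    proof (intro sum.cong refl)
      fix r assume "r \<in> ?I"
      then obtain k c d where r: "r = (k, c, d)" "(c, d) \<in> box_reps n" by auto
      show "coef (fst (piece x r)) m i j = (if r = (m, a, b) then coef x m i j else 0)"
      proof (cases "rep i j = rep c d")
        case True
        from ab(3)[OF r(2) this] show ?thesis using True
          by (simp add: piece_def r lookup_single when_def)
      next
        case False
        then have "r \<noteq> (m, a, b)" using ab(2) r(1) by auto
        then show ?thesis using False ab(2) by (simp add: piece_def r lookup_single when_def)
      qed
    qed
    also have "\<dots> = coef x m i j"
      using m ab(1) by (simp add: finite_box_reps)
    finally show ?thesis by (simp add: lookup_sum sum_fun_apply2)
  qed
  then have "(\<Sum>i\<in>?I. fst (piece x i)) = x"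
    by (intro poly_mapping_eqI) (simp add: fun_eq_iff)
  moreover have "snd (piece x i) = 0" for i
    by (auto simp: piece_def zero_prod_def split: prod.splits)
  ultimately show ?thesis by (simp add: prod_eq_iff fst_sum snd_sum zero_prod_def)
qed

lemma supported_subset_subspace:
  assumes W: "affine.subspace W"
    and sub: "\<And>k a b. a \<in> {1..n} \<Longrightarrow> b \<in> {1..n} \<Longrightarrow> T k a b \<Longrightarrow> weight_space n k a b \<subseteq> W"
  shows "supported n T \<subseteq> W"
proof
  fix x assume "x \<in> supported n T"
  then obtain y where y: "x = (y, 0, 0)" "\<And>m. coef y m \<in> sl n"
    "\<And>m i j. coef y m i j \<noteq> 0 \<Longrightarrow> T m i j"
    by (cases x) (auto simp: in_supported_iff)
  have "piece y (k, r) \<in> W" if "r \<in> box_reps n" for k r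
  proof (cases "\<exists>i j. rep i j = rep (fst r) (snd r) \<and> coef y k i j \<noteq> 0")
    case False
    then have "piece y (k, r) = 0"
      using piece_eq_zero[of "fst r" "snd r" y k] by auto
    then show ?thesis using affine.subspace_0[OF W] by simp
  next
    case True
    then obtain i j where ij: "rep i j = rep (fst r) (snd r)" "coef y k i j \<noteq> 0" by blast
    then have rng: "i \<in> {1..n}" "j \<in> {1..n}" using y(2)[of k] by (auto simp: sl_def matrices_def)
    \<comment> \<open>The representative \<open>(1, 1)\<close> may point at a zero entry, about
      which \<open>T\<close> says nothing; hence the change to a pair where \<open>y\<close> has a
      nonzero entry.\<close>
    have "piece y (k, r) = piece y (k, i, j)"
      using ij by (auto simp: piece_def split: prod.splits)
    also have "\<dots> \<in> weight_space n k i j"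
      using piece_in_weight_space[OF y(2)] rng by blast
    finally show ?thesis using sub[OF rng y(3)[OF ij(2)]] by blast
  qed
  then have "(\<Sum>i\<in>Poly_Mapping.keys y \<times> box_reps n. piece y i) \<in> W"
    by (intro affine.subspace_sum[OF W]) auto
  then show "x \<in> W" using sum_pieces[of y n] y by (simp add: sl_matrices)
qed

lemma bracket_sum_right: "bracket n h (\<Sum>i\<in>F. f i) = (\<Sum>i\<in>F. bracket n h (f i))"
proof -
  have "bracket n h 0 = 0" using bracket_add(2)[of n h 0 0] by simp
  then show ?thesis
    by (induction F rule: infinite_finite_induct) (auto simp: bracket_add)
qed

text \<open>Applying \<open>h - \<omega> j h\<close> to the sum removes the component
  \<open>v j\<close> and rescales all others, which permits induction on the number of components.
  Choosing \<open>h\<close> to separate \<open>i\<close> from \<open>j\<close> makes the factor at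
  \<open>i\<close> invertible, so \<open>v i\<close> can be recovered at the end.\<close>

lemma weight_components:
  assumes W: "affine.subspace W" "\<And>h w. h \<in> H \<Longrightarrow> w \<in> W \<Longrightarrow> bracket n h w \<in> W"
    and V: "\<And>i. i \<in> F \<Longrightarrow> affine.subspace (V i)"
      "\<And>i h w. i \<in> F \<Longrightarrow> h \<in> H \<Longrightarrow> w \<in> V i \<Longrightarrow> bracket n h w = affine_scale (\<omega> i h) w"
    and sep: "\<And>i j. i \<in> F \<Longrightarrow> j \<in> F \<Longrightarrow> i \<noteq> j \<Longrightarrow> \<exists>h\<in>H. \<omega> i h \<noteq> \<omega> j h"
    and "finite F" and "\<And>i. i \<in> F \<Longrightarrow> v i \<in> V i" and "(\<Sum>i\<in>F. v i) \<in> W"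
  shows "i \<in> F \<Longrightarrow> v i \<in> W"
  using \<open>finite F\<close> V sep assms(7,8)
proof (induction "card F" arbitrary: F v i rule: less_induct)
  case less
  show ?case
  proof (cases "F = {i}")
    case True
    then show ?thesis using less.prems by simp
  next
    case False
    then obtain j where j: "j \<in> F" "j \<noteq> i" using less.prems(1) by auto
    then obtain h where h: "h \<in> H" "\<omega> i h \<noteq> \<omega> j h" using less.prems(1,5) by metis
    define v' where "v' l = affine_scale (\<omega> l h - \<omega> j h) (v l)" for l
    let ?s = "\<Sum>i\<in>F. v i"
    have "bracket n h ?s - affine_scale (\<omega> j h) ?s \<in> W"
      using less.prems(7) h W by (intro affine.subspace_diff affine.subspace_scale) auto
    also have "bracket n h ?s - affine_scale (\<omega> j h) ?s = (\<Sum>l\<in>F. v' l)"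
      using less.prems h
      by (simp add: bracket_sum_right affine.scale_sum_right v'_def affine.scale_left_diff_distrib
          flip: sum_subtractf)
    also have "\<dots> = (\<Sum>l\<in>F - {j}. v' l)"
      using sum.remove[OF less.prems(2) j(1), of v'] by (simp add: v'_def)
    finally have s': "(\<Sum>l\<in>F - {j}. v' l) \<in> W" .
    have "v' i \<in> W"
    proof (rule less.hyps[where F = "F - {j}"])
      show "card (F - {j}) < card F" using j less.prems(2) by (simp only: card_Diff1_less)
      show "v' l \<in> V l" if "l \<in> F - {j}" for l
        using less.prems that unfolding v'_def by (intro affine.subspace_scale) auto
    qed (use less.prems j s' in auto)
    then have "affine_scale (inverse (\<omega> i h - \<omega> j h)) (v' i) \<in> W"
      by (intro affine.subspace_scale W)
    then show ?thesis using h by (simp add: v'_def)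
  qed
qed

lemma piece_in_invariant_subspace:
  assumes W: "affine.subspace W" "\<And>h w. h \<in> affine_cartan n \<Longrightarrow> w \<in> W \<Longrightarrow> bracket n h w \<in> W"
    and x: "(x, 0, 0) \<in> W" "\<And>k. coef x k \<in> sl n"
    and ab: "a \<in> {1..n}" "b \<in> {1..n}"
  shows "piece x (k, a, b) \<in> W"
proof (cases "k \<in> Poly_Mapping.keys x")
  case False
  then have "piece x (k, a, b) = 0"
    by (intro piece_eq_zero) (simp add: in_keys_iff)
  then show ?thesis using affine.subspace_0[OF W(1)] by simp
next
  case True
  let ?F = "Poly_Mapping.keys x \<times> box_reps n"
  have rng: "a \<in> {1..n} \<and> b \<in> {1..n}" if "(a, b) \<in> box_reps n" for a b
    using that ab by (auto simp: box_reps_def)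
  obtain a' b' where ab': "(a', b') \<in> box_reps n" "rep a b = rep a' b'"
    by (rule box_repsE[OF ab]) (rule that)
  have "piece x (k, a', b') \<in> W"
  proof (rule weight_components[where F = ?F and H = "affine_cartan n" and
      V = "\<lambda>(k, a, b). weight_space n k a b" and \<omega> = "\<lambda>(k, a, b). wt n k a b"])
    show "\<exists>h\<in>affine_cartan n. (case i of (k, a, b) \<Rightarrow> wt n k a b) h \<noteq>
        (case j of (k, a, b) \<Rightarrow> wt n k a b) h"
      if ij: "i \<in> ?F" "j \<in> ?F" "i \<noteq> j" for i j
    proof (rule ccontr)
      assume neg: "\<not> ?thesis"
      obtain k1 a1 b1 k2 a2 b2 where eq: "i = (k1, a1, b1)" "j = (k2, a2, b2)"
        by (cases i; cases j) auto
      have "wt n k1 a1 b1 = wt n k2 a2 b2"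
      proof
        fix h show "wt n k1 a1 b1 h = wt n k2 a2 b2 h"
          using neg by (cases "h \<in> affine_cartan n") (auto simp: eq wt_def)
      qed
      then have "k1 = k2 \<and> rep a1 b1 = rep a2 b2"
        using ij rng by (intro wt_eqD[of n]) (auto simp: eq)
      then show False using ij by (auto simp: eq box_reps_def rep_def split: if_splits)
    qed
    show "finite ?F" by (simp add: finite_box_reps)
    show "(\<Sum>i\<in>?F. piece x i) \<in> W" using sum_pieces[of x n] x by (simp add: sl_matrices)
    show "(k, a', b') \<in> ?F" using True ab'(1) by simp
    show "piece x i \<in> (\<lambda>(k, a, b). weight_space n k a b) i" if "i \<in> ?F" for i
      using that rng x(2) by (auto intro!: piece_in_weight_space)
    show "bracket n h w = affine_scale ((case i of (k, a, b) \<Rightarrow> wt n k a b) h) w"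
      if "i \<in> ?F" "h \<in> affine_cartan n" "w \<in> (case i of (k, a, b) \<Rightarrow> weight_space n k a b)" for i h w
    proof -
      obtain k a b where i: "i = (k, a, b)" "(a, b) \<in> box_reps n" using \<open>i \<in> ?F\<close> by auto
      then have "a \<noteq> 0" "b \<noteq> 0" using rng[of a b] by auto
      then show ?thesis using that i weight_space_eigen by simp
    qed
  qed (use W in \<open>auto simp: subspace_weight_space\<close>)
  then show ?thesis using ab' by (simp add: piece_def)
qed

section \<open>The subalgebras as sums of root spaces\<close>

definition nplus_supp :: "int \<Rightarrow> nat \<Rightarrow> nat \<Rightarrow> bool" where
  "nplus_supp k a b \<longleftrightarrow> k > 0 \<or> k = 0 \<and> a < b"

definition borel_supp :: "int \<Rightarrow> nat \<Rightarrow> nat \<Rightarrow> bool" where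
  "borel_supp k a b \<longleftrightarrow> k > 0 \<or> k = 0 \<and> a \<le> b"

text \<open>The weights in \<open>D'\<close>: after adding at least one \<open>\<delta>\<close> to
  \<open>D\<close>, positive roots begin in degree 1, while \<open>\<delta>\<close> and the negative
  roots begin in degree 2.\<close>

definition a_supp :: "int \<Rightarrow> nat \<Rightarrow> nat \<Rightarrow> bool" where
  "a_supp k a b \<longleftrightarrow> k \<ge> 2 \<or> k = 1 \<and> a < b"

lemma weight_spaceE:
  assumes "x \<in> weight_space n k a b"
  obtains A where "x = (Poly_Mapping.single k A, 0, 0)" "A \<in> sl n"
    "\<And>i j. A i j \<noteq> 0 \<Longrightarrow> rep i j = rep a b"
proof -
  from assms obtain y where y: "x = (y, 0, 0)" "\<And>m. coef y m \<in> sl n"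
    "\<And>m i j. coef y m i j \<noteq> 0 \<Longrightarrow> m = k \<and> rep i j = rep a b"
    unfolding weight_space_def by (cases x) (auto simp: in_supported_iff)
  have "y = Poly_Mapping.single k (coef y k)"
    using y(3) by (intro poly_mapping_eqI) (auto simp: lookup_single when_def fun_eq_iff)
  then show ?thesis using that[of "coef y k"] y by metis
qed

lemma weight_space_subset_supported:
  assumes "\<And>i j. i \<in> {1..n} \<Longrightarrow> j \<in> {1..n} \<Longrightarrow> rep i j = rep a b \<Longrightarrow> T k i j"
  shows "weight_space n k a b \<subseteq> supported n T"
  unfolding weight_space_def by (rule supported_mono) (use assms in auto)

lemma affine_nplus_eq: "affine_nplus n = supported n nplus_supp"
proof
  show "affine_nplus n \<subseteq> supported n nplus_supp"
    unfolding affine_nplus_def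
    by (intro affine.span_minimal subspace_supported)
      (auto simp: in_supported_iff sl_nplus_def nplus_supp_def lookup_single when_def not_le[symmetric])
  show "supported n nplus_supp \<subseteq> affine_nplus n"
  proof (rule supported_subset_subspace)
    show "affine.subspace (affine_nplus n)" by (simp add: affine_nplus_def)
    fix k a b assume T: "nplus_supp k a b" "a \<in> {1..n}" "b \<in> {1..n}"
    show "weight_space n k a b \<subseteq> affine_nplus n"
    proof
      fix x assume "x \<in> weight_space n k a b"
      then obtain A where A: "x = (Poly_Mapping.single k A, 0, 0)" "A \<in> sl n"
        "\<And>i j. A i j \<noteq> 0 \<Longrightarrow> rep i j = rep a b" by (rule weight_spaceE) (rule that)
      have "A \<in> sl_nplus n" if "k \<le> 0"
      proof -
        have "a < b" using that T by (auto simp: nplus_supp_def)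
        then have "A i j = 0" if "j \<le> i" for i j
          using A(3)[of i j] that T by (cases "A i j = 0") (auto simp: rep_def split: if_splits)
        then show ?thesis using A(2) by (simp add: sl_nplus_def)
      qed
      moreover have "k \<le> 0 \<Longrightarrow> k = 0" using T by (auto simp: nplus_supp_def)
      ultimately show "x \<in> affine_nplus n"
        unfolding affine_nplus_def A(1) using A(2)
        by (intro affine.span_base) (cases "k > 0", auto)
    qed
  qed
qed

lemma affine_borelE:
  assumes "x \<in> affine_borel n"
  obtains y u v where "x = (y, u, v)" "\<And>k. coef y k \<in> sl n"
    "\<And>k a b. coef y k a b \<noteq> 0 \<Longrightarrow> borel_supp k a b"
proof -
  from assms obtain H u v z where x: "x = (Poly_Mapping.single 0 H + z, u, v)"
    and H: "H \<in> sl_cartan n" and z: "(z, 0, 0) \<in> supported n nplus_supp"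
    unfolding affine_borel_def affine_nplus_eq by (auto simp: affine_cartan_iff supported_def)
  have "coef (Poly_Mapping.single 0 H) k \<in> sl n" for k
    using H by (auto simp: lookup_single when_def sl_cartan_def)
  then have 1: "coef (Poly_Mapping.single 0 H + z) k \<in> sl n" for k
    using z by (auto simp: lookup_add in_supported_iff intro!: sl_add)
  have 2: "borel_supp k a b" if nz: "coef (Poly_Mapping.single 0 H + z) k a b \<noteq> 0" for k a b
  proof (cases "coef z k a b = 0")
    case True
    then have "coef (Poly_Mapping.single 0 H) k a b \<noteq> 0" using nz by (simp add: lookup_add)
    then have "k = 0" "H a b \<noteq> 0" by (auto simp: lookup_single when_def split: if_splits)
    then show ?thesis using H by (cases "a = b") (auto simp: borel_supp_def sl_cartan_def)
  next
    case False
    then have "nplus_supp k a b" using z by (simp add: in_supported_iff)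
    then show ?thesis by (auto simp: nplus_supp_def borel_supp_def)
  qed
  show ?thesis by (rule that[OF x 1 2])
qed

lemma affine_cartan_zero: "0 \<in> affine_cartan n"
  by (auto simp: affine_cartan_iff zero_prod_def intro!: exI[of _ 0])

lemma affine_nplus_subset_borel: "affine_nplus n \<subseteq> affine_borel n"
  unfolding affine_borel_def by (intro subsetI CollectI) (metis add_0 affine_cartan_zero)

lemma affine_cartan_subset_borel: "affine_cartan n \<subseteq> affine_borel n"
proof -
  have "0 \<in> affine_nplus n" by (simp add: affine_nplus_def affine.span_zero)
  then show ?thesis
    unfolding affine_borel_def by (intro subsetI CollectI) (metis add_0_right)
qed

section \<open>The simple roots, \<open>\<delta>\<close>, and the sets \<open>D\<close> and
  \<open>D'\<close> as weights\<close>

lemma simple_root_eq: "simple_root n i = wt n 0 i (Suc i)"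
  by (simp add: simple_root_def wt_def fun_eq_iff)

lemma sum_simple_root: "a \<le> b \<Longrightarrow> (\<Sum>i = a..<b. simple_root n i) = wt n 0 a b"
proof (induction b rule: dec_induct)
  case base
  then show ?case by (simp add: wt_def fun_eq_iff)
next
  case (step b)
  then show ?case by (simp add: simple_root_eq) (simp add: wt_def fun_eq_iff)
qed

lemma box_root_eq: "box_root n a b = wt n 0 a b"
proof -
  have "- wt n 0 b a = wt n 0 a b" by (simp add: wt_def fun_eq_iff)
  then show ?thesis by (simp add: box_root_def sum_simple_root)
qed

lemma delta_eq: "delta n = wt n 1 a a"
  by (simp add: delta_def wt_def fun_eq_iff)

lemma wt_plus_delta:
  "wt n k a b + delta n = wt n (k + 1) a b"
  "wt n k a b + (\<lambda>h. of_nat m * delta n h) = wt n (k + int m) a b"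
  by (auto simp: delta_def wt_def fun_eq_iff algebra_simps)

lemma D_roots_iff: "\<alpha> \<in> D_roots n \<longleftrightarrow> \<alpha> = delta n \<or>
    (\<exists>a\<in>{1..n}. \<exists>b\<in>{1..n}. \<alpha> = wt n 0 a b \<and> a < b \<or> \<alpha> = wt n 1 a b \<and> b < a)"
proof -
  have "\<beta> \<in> neg_roots n \<longleftrightarrow> (\<exists>a\<in>{1..n}. \<exists>b\<in>{1..n}. \<beta> = wt n 0 a b \<and> b < a)" for \<beta>
    unfolding neg_roots_def box_root_eq by blast
  moreover have "wt n 1 a b = wt n 0 a b + delta n" for a b
    by (simp add: wt_plus_delta)
  ultimately have "{\<beta> + delta n |\<beta>. \<beta> \<in> neg_roots n} =
      {\<beta>. \<exists>a\<in>{1..n}. \<exists>b\<in>{1..n}. \<beta> = wt n 1 a b \<and> b < a}"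
    by (intro set_eqI) (simp only: mem_Collect_eq, blast)
  then show ?thesis unfolding D_roots_def pos_roots_def box_root_eq by blast
qed

text \<open>Multiples of \<open>\<delta>\<close> have to be written as \<open>wt n k a a\<close> for
  some index \<open>a\<close> in the range, which is where \<open>n \<ge> 1\<close> enters.\<close>

lemma D'_roots_iff:
  assumes "n \<ge> 1"
  shows "\<alpha> \<in> D'_roots n \<longleftrightarrow> (\<exists>k. \<exists>a\<in>{1..n}. \<exists>b\<in>{1..n}. a_supp k a b \<and> \<alpha> = wt n k a b)"
proof
  assume "\<alpha> \<in> D'_roots n"
  then obtain \<beta> m where \<beta>: "\<alpha> = \<beta> + (\<lambda>h. of_nat m * delta n h)" "\<beta> \<in> D_roots n" "m > 0"
    by (auto simp: D'_roots_def)
  from \<beta>(2) consider "\<beta> = wt n 1 1 1"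
    | a b where "a \<in> {1..n}" "b \<in> {1..n}" "\<beta> = wt n 0 a b" "a < b"
    | a b where "a \<in> {1..n}" "b \<in> {1..n}" "\<beta> = wt n 1 a b" "b < a"
    by (auto simp: D_roots_iff delta_eq[of n 1])
  then show "\<exists>k. \<exists>a\<in>{1..n}. \<exists>b\<in>{1..n}. a_supp k a b \<and> \<alpha> = wt n k a b"
  proof cases
    case 1
    have "a_supp (1 + int m) 1 1 \<and> \<alpha> = wt n (1 + int m) 1 1"
      using \<beta> 1 by (simp add: a_supp_def wt_plus_delta)
    moreover have "1 \<in> {1..n}" using assms by simp
    ultimately show ?thesis by blast
  next
    case (2 a b)
    have "a_supp (0 + int m) a b \<and> \<alpha> = wt n (0 + int m) a b"
      using \<beta> 2 by (auto simp: a_supp_def wt_plus_delta)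
    then show ?thesis using 2 by blast
  next
    case (3 a b)
    have "a_supp (1 + int m) a b \<and> \<alpha> = wt n (1 + int m) a b"
      using \<beta> 3 by (auto simp: a_supp_def wt_plus_delta)
    then show ?thesis using 3 by blast
  qed
next
  assume "\<exists>k. \<exists>a\<in>{1..n}. \<exists>b\<in>{1..n}. a_supp k a b \<and> \<alpha> = wt n k a b"
  then obtain k a b where ab: "a \<in> {1..n}" "b \<in> {1..n}" "a_supp k a b" "\<alpha> = wt n k a b" by blast
  have "\<exists>\<beta>\<in>D_roots n. \<exists>m>0. \<alpha> = \<beta> + (\<lambda>h. of_nat m * delta n h)"
  proof (cases "a < b")
    case True
    then have "wt n 0 a b \<in> D_roots n" using ab unfolding D_roots_iff by blast
    moreover have "k \<ge> 1" using ab by (auto simp: a_supp_def)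
    moreover from this have "\<alpha> = wt n 0 a b + (\<lambda>h. of_nat (nat k) * delta n h)" "nat k > 0"
      unfolding wt_plus_delta using ab by simp_all
    ultimately show ?thesis by blast
  next
    case False
    then have "k \<ge> 2" using ab by (auto simp: a_supp_def)
    moreover have "wt n 1 a b \<in> D_roots n"
      using False ab unfolding D_roots_iff delta_eq[of n b]
      by (cases "a = b") (blast, use not_less_iff_gr_or_eq in blast)
    moreover from \<open>k \<ge> 2\<close>
    have "\<alpha> = wt n 1 a b + (\<lambda>h. of_nat (nat (k - 1)) * delta n h)" "nat (k - 1) > 0"
      unfolding wt_plus_delta using ab by simp_all
    ultimately show ?thesis by blast
  qed
  then show "\<alpha> \<in> D'_roots n" by (auto simp: D'_roots_def)
qed

lemma a_supp_rep:
  "a_supp k a b \<Longrightarrow> rep i j = rep a b \<Longrightarrow> {a, b, i, j} \<subseteq> {1..n} \<Longrightarrow> a_supp k i j"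
  by (auto simp: rep_def a_supp_def split: if_splits)

lemma ideal_a_eq:
  assumes n: "n \<ge> 1"
  shows "ideal_a n = supported n a_supp"
proof
  have rs: "root_space n (wt n k a b) = weight_space n k a b"
    if "a_supp k a b" "a \<in> {1..n}" "b \<in> {1..n}" for k a b
    using that by (intro root_space_wt) (auto simp: a_supp_def)
  show "ideal_a n \<subseteq> supported n a_supp"
    unfolding ideal_a_def
  proof (intro affine.span_minimal subspace_supported UN_least)
    fix \<alpha> assume "\<alpha> \<in> D'_roots n"
    then obtain k a b where ab: "a \<in> {1..n}" "b \<in> {1..n}" "a_supp k a b" "\<alpha> = wt n k a b"
      unfolding D'_roots_iff[OF n] by blast
    show "root_space n \<alpha> \<subseteq> supported n a_supp"
      unfolding ab(4) rs[OF ab(3,1,2)]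
      using ab a_supp_rep by (intro weight_space_subset_supported) blast
  qed
  show "supported n a_supp \<subseteq> ideal_a n"
  proof (rule supported_subset_subspace)
    show "affine.subspace (ideal_a n)" by (simp add: ideal_a_def)
    fix k a b assume ab: "a_supp k a b" "a \<in> {1..n}" "b \<in> {1..n}"
    then have "wt n k a b \<in> D'_roots n" unfolding D'_roots_iff[OF n] by blast
    then show "weight_space n k a b \<subseteq> ideal_a n"
      unfolding ideal_a_def rs[OF ab, symmetric] by (intro subsetI affine.span_base) blast
  qed
qed

lemma wt_in_supp_iff:
  assumes "n \<ge> 2" "a \<in> {1..n}" "b \<in> {1..n}" "k \<noteq> 0 \<or> a \<noteq> b"
  shows "wt n k a b \<in> supp n I \<longleftrightarrow> weight_space n k a b \<subseteq> I"
  using wt_in_roots[OF assms] root_space_wt[OF assms(2-)] by (simp add: supp_def)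

lemma mat_mul_unit:
  "c \<in> {1..n} \<Longrightarrow> mat_mul n (unit_mat a c) (unit_mat d b) = (if c = d then unit_mat a b else 0)"
proof -
  assume c: "c \<in> {1..n}"
  have "(\<Sum>l = 1..n. unit_mat a c i l * unit_mat d b l j) =
      (\<Sum>l = 1..n. if l = c then (if c = d then unit_mat a b i j else 0) else 0)" for i j
    by (intro sum.cong) (auto simp: unit_mat_def)
  then show ?thesis using c by (auto simp: mat_mul_def fun_eq_iff)
qed

lemma bracket_single:
  assumes "k \<ge> 0" "m \<ge> 0"
  shows "bracket n (Poly_Mapping.single k A, 0, 0) (Poly_Mapping.single m B, 0, 0) =
    (Poly_Mapping.single (k + m) (mat_bracket n A B), 0, 0)"
proof -
  have "loop_bracket n (Poly_Mapping.single k A) (Poly_Mapping.single m B) =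
      Poly_Mapping.single (k + m) (mat_bracket n A B)"
    by (rule poly_mapping_eqI) (auto simp: lookup_loop_bracket_single lookup_single when_def)
  moreover have "loop_cocycle n (Poly_Mapping.single k A) (Poly_Mapping.single m B) = 0"
    using assms by (auto simp: loop_cocycle_superset[of "{k}"] lookup_single when_def)
  ultimately show ?thesis by (simp add: bracket_def)
qed

section \<open>Ideals from sets of boxes\<close>

definition ideal_supp :: "(nat \<times> nat) set \<Rightarrow> (nat \<times> nat) set \<Rightarrow> int \<Rightarrow> nat \<Rightarrow> nat \<Rightarrow> bool" where
  "ideal_supp P M k a b \<longleftrightarrow>
     k \<ge> 2 \<or> k = 1 \<and> (a \<le> b \<or> (a, b) \<in> M) \<or> k = 0 \<and> (a, b) \<in> P"

definition box_ideal :: "nat \<Rightarrow> (nat \<times> nat) set \<Rightarrow> (nat \<times> nat) set \<Rightarrow> affine set" where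
  "box_ideal n P M = supported n (ideal_supp P M)"

text \<open>The closure of \<open>M\<close> only mentions indices strictly between \<open>b\<close>
  and \<open>a\<close>, since degree 1 on and above the diagonal belongs to the ideal anyway. The
  forcing clause comes from \<open>[e_ab, e_bd \<otimes> t] = e_ad \<otimes> t\<close> and
  \<open>[e_ca \<otimes> t, e_ab] = e_cb \<otimes> t\<close>. The last clause is commutativity in
  the quotient: \<open>[e_ab, e_ba \<otimes> t]\<close> is a nonzero element of
  \<open>h \<otimes> t\<close>, which \<open>ideal_a\<close> does not contain.\<close>

definition admissible :: "nat \<Rightarrow> (nat \<times> nat) set \<Rightarrow> (nat \<times> nat) set \<Rightarrow> bool" where
  "admissible n P M \<longleftrightarrow>
     P \<subseteq> {(a, b). a \<in> {1..n} \<and> b \<in> {1..n} \<and> a < b} \<and>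
     M \<subseteq> {(a, b). a \<in> {1..n} \<and> b \<in> {1..n} \<and> b < a} \<and>
     (\<forall>a b. (a, b) \<in> P \<longrightarrow> (\<forall>a'\<in>{1..<a}. (a', b) \<in> P) \<and> (\<forall>b'\<in>{b<..n}. (a, b') \<in> P)) \<and>
     (\<forall>a b. (a, b) \<in> M \<longrightarrow> (\<forall>c\<in>{b<..<a}. (c, b) \<in> M \<and> (a, c) \<in> M)) \<and>
     (\<forall>a b. (a, b) \<in> P \<longrightarrow> (\<forall>d\<in>{1..<a}. (a, d) \<in> M) \<and> (\<forall>c\<in>{b<..n}. (c, b) \<in> M)) \<and>
     (\<forall>a b. (a, b) \<in> P \<longrightarrow> (b, a) \<notin> M)"

lemma admissibleD:
  assumes "admissible n P M"
  shows "(a, b) \<in> P \<Longrightarrow> 1 \<le> a \<and> a < b \<and> b \<le> n"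
    and "(a, b) \<in> M \<Longrightarrow> 1 \<le> b \<and> b < a \<and> a \<le> n"
    and "(a, b) \<in> P \<Longrightarrow> 1 \<le> c \<Longrightarrow> c \<le> a \<Longrightarrow> (c, b) \<in> P"
    and "(a, b) \<in> P \<Longrightarrow> b \<le> c \<Longrightarrow> c \<le> n \<Longrightarrow> (a, c) \<in> P"
    and "(a, b) \<in> M \<Longrightarrow> b < c \<Longrightarrow> c \<le> a \<Longrightarrow> (c, b) \<in> M"
    and "(a, b) \<in> M \<Longrightarrow> b \<le> c \<Longrightarrow> c < a \<Longrightarrow> (a, c) \<in> M"
    and "(a, b) \<in> P \<Longrightarrow> 1 \<le> c \<Longrightarrow> c < a \<Longrightarrow> (a, c) \<in> M"
    and "(a, b) \<in> P \<Longrightarrow> b < c \<Longrightarrow> c \<le> n \<Longrightarrow> (c, b) \<in> M"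
    and "(a, b) \<in> P \<Longrightarrow> (b, a) \<notin> M"
proof -
  note * = assms[unfolded admissible_def]
  have 1: "P \<subseteq> {(a, b). a \<in> {1..n} \<and> b \<in> {1..n} \<and> a < b}" using * by (elim conjE)
  have 2: "M \<subseteq> {(a, b). a \<in> {1..n} \<and> b \<in> {1..n} \<and> b < a}" using * by (elim conjE)
  have 3: "(a', b) \<in> P" if "(a, b) \<in> P" "a' \<in> {1..<a}" for a b a' using * that by blast
  have 4: "(a, b') \<in> P" if "(a, b) \<in> P" "b' \<in> {b<..n}" for a b b' using * that by blast
  have 5: "(c, b) \<in> M \<and> (a, c) \<in> M" if "(a, b) \<in> M" "c \<in> {b<..<a}" for a b c using * that by blast
  have 6: "(a, d) \<in> M" if "(a, b) \<in> P" "d \<in> {1..<a}" for a b d using * that by blast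
  have 7: "(c, b) \<in> M" if "(a, b) \<in> P" "c \<in> {b<..n}" for a b c using * that by blast
  show "(a, b) \<in> P \<Longrightarrow> 1 \<le> a \<and> a < b \<and> b \<le> n" using 1 by auto
  show "(a, b) \<in> M \<Longrightarrow> 1 \<le> b \<and> b < a \<and> a \<le> n" using 2 by auto
  show "(a, b) \<in> P \<Longrightarrow> 1 \<le> c \<Longrightarrow> c \<le> a \<Longrightarrow> (c, b) \<in> P"
    using 3[of a b c] by (cases "c = a") auto
  show "(a, b) \<in> P \<Longrightarrow> b \<le> c \<Longrightarrow> c \<le> n \<Longrightarrow> (a, c) \<in> P"
    using 4[of a b c] by (cases "c = b") auto
  show "(a, b) \<in> M \<Longrightarrow> b < c \<Longrightarrow> c \<le> a \<Longrightarrow> (c, b) \<in> M"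
    using 5[of a b c] by (cases "c = a") auto
  show "(a, b) \<in> M \<Longrightarrow> b \<le> c \<Longrightarrow> c < a \<Longrightarrow> (a, c) \<in> M"
    using 5[of a b c] by (cases "c = b") auto
  show "(a, b) \<in> P \<Longrightarrow> 1 \<le> c \<Longrightarrow> c < a \<Longrightarrow> (a, c) \<in> M" using 6[of a b c] by simp
  show "(a, b) \<in> P \<Longrightarrow> b < c \<Longrightarrow> c \<le> n \<Longrightarrow> (c, b) \<in> M" using 7[of a b c] by simp
  show "(a, b) \<in> P \<Longrightarrow> (b, a) \<notin> M" using * by blast
qed

lemma ideal_supp_nonneg: "ideal_supp P M k a b \<Longrightarrow> k \<ge> 0"
  by (auto simp: ideal_supp_def)

lemma borel_supp_nonneg: "borel_supp k a b \<Longrightarrow> k \<ge> 0"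
  by (auto simp: borel_supp_def)

text \<open>From degree 2 on, \<open>ideal_supp\<close> and \<open>a_supp\<close> contain
  everything, so that products need attention only in the three remaining cases.\<close>

lemma sum_cases_le_1:
  assumes "(k::int) \<ge> 0" "m \<ge> 0"
  obtains "k + m \<ge> 2" | "k = 0" "m = 0" | "k = 0" "m = 1" | "k = 1" "m = 0"
proof (cases "k + m \<ge> 2")
  case False
  then have "k = 0 \<and> m = 0 \<or> k = 0 \<and> m = 1 \<or> k = 1 \<and> m = 0" using assms by presburger
  then show ?thesis using that by blast
qed (rule that)

text \<open>Each case uses one clause of \<open>admissible\<close>: degrees 0 and 0 the closure of
  \<open>P\<close>, a Borel element of degree 0 acting on degree 1 the closure of \<open>M\<close>,
  and a Borel element of degree 1 acting on \<open>P\<close> the forcing clause.\<close>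

lemma ideal_supp_closed:
  assumes adm: "admissible n P M" and rng: "{a, b, c} \<subseteq> {1..n}"
  shows "borel_supp k a c \<Longrightarrow> ideal_supp P M m c b \<Longrightarrow> ideal_supp P M (k + m) a b"
    and "ideal_supp P M k a c \<Longrightarrow> borel_supp m c b \<Longrightarrow> ideal_supp P M (k + m) a b"
proof -
  note D = admissibleD[OF adm]
  {
    assume 1: "borel_supp k a c" and 2: "ideal_supp P M m c b"
    from borel_supp_nonneg[OF 1] ideal_supp_nonneg[OF 2] show "ideal_supp P M (k + m) a b"
    proof (cases rule: sum_cases_le_1)
      case 2
      then have "a \<le> c" "(c, b) \<in> P" using 1 \<open>ideal_supp P M m c b\<close>
        by (auto simp: borel_supp_def ideal_supp_def)
      then show ?thesis using 2 D(3) rng by (auto simp: ideal_supp_def)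
    next
      case 3
      then have "a \<le> c" "c \<le> b \<or> (c, b) \<in> M" using 1 \<open>ideal_supp P M m c b\<close>
        by (auto simp: borel_supp_def ideal_supp_def)
      then show ?thesis using 3 D(5)[of c b a] rng by (cases "a \<le> b") (auto simp: ideal_supp_def)
    next
      case 4
      then have "(c, b) \<in> P" using \<open>ideal_supp P M m c b\<close> by (auto simp: ideal_supp_def)
      then show ?thesis using 4 D(8)[of c b a] rng by (cases "a \<le> b") (auto simp: ideal_supp_def)
    qed (simp add: ideal_supp_def)
  }
  {
    assume 1: "ideal_supp P M k a c" and 2: "borel_supp m c b"
    from ideal_supp_nonneg[OF 1] borel_supp_nonneg[OF 2] show "ideal_supp P M (k + m) a b"
    proof (cases rule: sum_cases_le_1)
      case 2
      then have "c \<le> b" "(a, c) \<in> P" using 1 \<open>borel_supp m c b\<close>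
        by (auto simp: borel_supp_def ideal_supp_def)
      then show ?thesis using 2 D(4) rng by (auto simp: ideal_supp_def)
    next
      case 4
      then have "c \<le> b" "a \<le> c \<or> (a, c) \<in> M" using 1 \<open>borel_supp m c b\<close>
        by (auto simp: borel_supp_def ideal_supp_def)
      then show ?thesis using 4 D(6)[of a c b] rng by (cases "a \<le> b") (auto simp: ideal_supp_def)
    next
      case 3
      then have "(a, c) \<in> P" using 1 by (auto simp: ideal_supp_def)
      then show ?thesis using 3 D(7)[of a c b] rng by (cases "a \<le> b") (auto simp: ideal_supp_def)
    qed (simp add: ideal_supp_def)
  }
qed

text \<open>In total degree 0, \<open>(a, c)\<close> and \<open>(c, b)\<close> in \<open>P\<close>
  are incompatible, because the second forces \<open>(c, a)\<close> into \<open>M\<close>. In total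
  degree 1, a product on or below the diagonal would combine a box of \<open>P\<close> with one of
  \<open>M\<close>, and closure of \<open>M\<close> would move the latter to the transpose of the
  former.\<close>

lemma ideal_supp_products:
  assumes adm: "admissible n P M" and rng: "{a, b, c} \<subseteq> {1..n}"
    and 1: "ideal_supp P M k a c" and 2: "ideal_supp P M m c b"
  shows "a_supp (k + m) a b"
  using ideal_supp_nonneg[OF 1] ideal_supp_nonneg[OF 2]
proof (cases rule: sum_cases_le_1)
  case 2
  note D = admissibleD[OF adm]
  have "(a, c) \<in> P" "(c, b) \<in> P" using 1 assms(4) 2 by (auto simp: ideal_supp_def)
  then have "(c, a) \<in> M" "(c, a) \<notin> M" using D(7)[of c b a] D(1)[of a c] D(9) by auto
  then show ?thesis by simp
next
  case 3
  note D = admissibleD[OF adm]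
  have P: "(a, c) \<in> P" and cb: "c \<le> b \<or> (c, b) \<in> M" using 1 assms(4) 3 by (auto simp: ideal_supp_def)
  have "(c, b) \<notin> M" if "b \<le> a"
    using D(6)[of c b a] D(1)[OF P] D(9)[OF P] that by auto
  then show ?thesis using 3 cb D(1)[OF P] by (cases "a < b") (auto simp: a_supp_def)
next
  case 4
  note D = admissibleD[OF adm]
  have P: "(c, b) \<in> P" and ac: "a \<le> c \<or> (a, c) \<in> M" using 1 assms(4) 4 by (auto simp: ideal_supp_def)
  have "(a, c) \<notin> M" if "b \<le> a"
    using D(5)[of a c b] D(1)[OF P] D(9)[OF P] that by auto
  then show ?thesis using 4 ac D(1)[OF P] by (cases "a < b") (auto simp: a_supp_def)
qed (simp add: a_supp_def)

lemma weight_space_subset_iff: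
  assumes "a \<in> {1..n}" "b \<in> {1..n}" "a \<noteq> b"
  shows "weight_space n k a b \<subseteq> supported n T \<longleftrightarrow> T k a b"
proof
  assume "weight_space n k a b \<subseteq> supported n T"
  then have "(Poly_Mapping.single k (unit_mat a b), 0, 0) \<in> supported n T"
    using single_in_weight_space(1)[OF assms] by blast
  then have "\<forall>i j. unit_mat a b i j \<noteq> 0 \<longrightarrow> T k i j"
    unfolding in_supported_iff by (metis lookup_single_eq)
  then show "T k a b" by (simp add: unit_mat_def)
next
  assume "T k a b"
  then show "weight_space n k a b \<subseteq> supported n T"
    using assms by (intro weight_space_subset_supported) (auto simp: rep_def split: if_splits)
qed

lemma weight_space_diag_subset: "(\<And>i. T k i i) \<Longrightarrow> weight_space n k a a \<subseteq> supported n T"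
  by (rule weight_space_subset_supported) (auto simp: rep_def split: if_splits)

section \<open>Cosets and the induced operations\<close>

lemma coset_absorb:
  assumes K: "affine.subspace K" and "x - y \<in> K"
  shows "coset K x = coset K y"
proof -
  have "y - x \<in> K" using affine.subspace_neg[OF K assms(2)] by simp
  have sub: "coset K x \<subseteq> coset K y" if "x - y \<in> K" for x y
  proof
    fix u assume "u \<in> coset K x"
    then obtain z where z: "z \<in> K" "u = x + z" by (auto simp: coset_def)
    then have "u = y + ((x - y) + z)" by simp
    moreover have "(x - y) + z \<in> K" using affine.subspace_add[OF K that z(1)] .
    ultimately show "u \<in> coset K y" unfolding coset_def by blast
  qed
  show ?thesis using sub[OF assms(2)] sub[OF \<open>y - x \<in> K\<close>] by (rule subset_antisym)
qed

lemma coset_refl: "affine.subspace K \<Longrightarrow> x \<in> coset K x"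
  unfolding coset_def using affine.subspace_0 by force

lemma quot_add_coset:
  assumes K: "affine.subspace K"
  shows "quot_add K (coset K x) (coset K y) = coset K (x + y)"
proof -
  have "coset K (u + v) = coset K (x + y)" if uv: "u \<in> coset K x" "v \<in> coset K y" for u v
  proof (rule coset_absorb[OF K])
    obtain z z' where z: "u = x + z" "v = y + z'" "z \<in> K" "z' \<in> K" using uv unfolding coset_def by blast
    then have "u + v - (x + y) = z + z'" by (simp add: algebra_simps)
    then show "u + v - (x + y) \<in> K" using affine.subspace_add[OF K z(3,4)] by simp
  qed
  then show ?thesis unfolding quot_add_def using coset_refl[OF K] by blast
qed

lemma quot_scale_coset:
  assumes K: "affine.subspace K"
  shows "quot_scale K c (coset K x) = coset K (affine_scale c x)"
proof -
  have "coset K (affine_scale c u) = coset K (affine_scale c x)" if u: "u \<in> coset K x" for u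
  proof (rule coset_absorb[OF K])
    obtain z where z: "u = x + z" "z \<in> K" using u unfolding coset_def by blast
    then have "affine_scale c u - affine_scale c x = affine_scale c z"
      by (simp add: affine.scale_right_distrib)
    then show "affine_scale c u - affine_scale c x \<in> K" using affine.subspace_scale[OF K z(2)] by simp
  qed
  then show ?thesis unfolding quot_scale_def using coset_refl[OF K] by blast
qed

text \<open>Changing both representatives alters the bracket by three terms, each having an argument
  in \<open>K\<close>; the two-sided assumption absorbs them, so all cosets in the union
  coincide.\<close>

lemma quot_bracket_coset:
  assumes K: "affine.subspace K" "K \<subseteq> L"
    and br: "\<And>x y. x \<in> L \<Longrightarrow> y \<in> K \<Longrightarrow> bracket n x y \<in> K \<and> bracket n y x \<in> K"
    and xy: "x \<in> L" "y \<in> L"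
  shows "quot_bracket n K (coset K x) (coset K y) = coset K (bracket n x y)"
proof -
  have "coset K (bracket n u v) = coset K (bracket n x y)" if uv: "u \<in> coset K x" "v \<in> coset K y" for u v
  proof (rule coset_absorb[OF K(1)])
    obtain z z' where z: "u = x + z" "v = y + z'" "z \<in> K" "z' \<in> K" using uv unfolding coset_def by blast
    have "bracket n u v - bracket n x y = bracket n x z' + (bracket n z y + bracket n z z')"
      by (simp add: z bracket_add algebra_simps)
    also have "\<dots> \<in> K"
      using br[of x z'] br[of y z] br[of z z'] xy z K by (intro affine.subspace_add) auto
    finally show "bracket n u v - bracket n x y \<in> K" .
  qed
  then show ?thesis unfolding quot_bracket_def using coset_refl[OF K(1)] by blast
qed

lemma supportedE:
  assumes "x \<in> supported n T"
  obtains y where "x = (y, 0, 0)" "\<And>k. coef y k \<in> sl n" "\<And>k a b. coef y k a b \<noteq> 0 \<Longrightarrow> T k a b"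
  using assms by (cases x) (auto simp: in_supported_iff)

lemma bracket_supported_supported:
  assumes x: "x \<in> supported n T1" and y: "y \<in> supported n T2"
    and nonneg: "\<And>k a b. T1 k a b \<Longrightarrow> k \<ge> 0" "\<And>k a b. T2 k a b \<Longrightarrow> k \<ge> 0"
    and T12: "\<And>k m a b c. {a, b, c} \<subseteq> {1..n} \<Longrightarrow> T1 k a c \<Longrightarrow> T2 m c b \<Longrightarrow> T3 (k + m) a b"
    and T21: "\<And>k m a b c. {a, b, c} \<subseteq> {1..n} \<Longrightarrow> T2 k a c \<Longrightarrow> T1 m c b \<Longrightarrow> T3 (k + m) a b"
  shows "bracket n x y \<in> supported n T3"
proof -
  obtain x' where x': "x = (x', 0, 0)" "\<And>k. coef x' k \<in> sl n"
    "\<And>k a b. coef x' k a b \<noteq> 0 \<Longrightarrow> T1 k a b" using x by (rule supportedE) (rule that)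
  obtain y' where y': "y = (y', 0, 0)" using y by (rule supportedE) (rule that)
  show ?thesis unfolding x'(1) y'
    by (rule bracket_supported[where ?T1.0 = T1 and ?T2.0 = T2])
      (use assms x' y' in auto)
qed

lemma weight_space_nonzeroE:
  assumes "x \<in> weight_space n k a b" "x \<noteq> 0"
  obtains A i j where "x = (Poly_Mapping.single k A, 0, 0)" "A i j \<noteq> 0" "rep i j = rep a b"
    "i \<in> {1..n}" "j \<in> {1..n}"
proof -
  obtain A where A: "x = (Poly_Mapping.single k A, 0, 0)" "A \<in> sl n"
    "\<And>i j. A i j \<noteq> 0 \<Longrightarrow> rep i j = rep a b" using assms(1) by (rule weight_spaceE) (rule that)
  have "A \<noteq> 0" using A(1) assms(2) by (auto simp: zero_prod_def)
  then obtain i j where ij: "A i j \<noteq> 0" by (auto simp: fun_eq_iff)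
  then have "i \<in> {1..n}" "j \<in> {1..n}" using A(2) by (auto simp: sl_def matrices_def)
  then show ?thesis using that A ij by blast
qed

section \<open>Box ideals are basic ideals\<close>

lemma box_ideal_subset_nplus:
  assumes "admissible n P M"
  shows "box_ideal n P M \<subseteq> affine_nplus n"
  unfolding box_ideal_def affine_nplus_eq
  using admissibleD(1)[OF assms] by (intro supported_mono) (auto simp: ideal_supp_def nplus_supp_def)

lemma single_unit_in_supported:
  assumes "a \<in> {1..n}" "b \<in> {1..n}" "a \<noteq> b" "T k a b"
  shows "(Poly_Mapping.single k (unit_mat a b), 0, 0) \<in> supported n T"
  using single_in_weight_space(1)[OF assms(1-3)] weight_space_subset_iff[OF assms(1-3)] assms(4)
  by blast

lemma affine_scale_single:
  "affine_scale c (Poly_Mapping.single k A, 0, 0) = (Poly_Mapping.single k (mat_scale c A), 0, 0)"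
proof -
  have "Poly_Mapping.map (mat_scale c) (Poly_Mapping.single k A) = Poly_Mapping.single k (mat_scale c A)"
    by (rule poly_mapping_eqI) (auto simp: lookup_single when_def)
  then show ?thesis by (simp add: affine_scale_def)
qed

text \<open>Whatever \<open>P\<close> and \<open>M\<close> are, a box ideal contains degree 1 on and
  above the diagonal and all of the degrees from 2 on. The rest of the Borel subalgebra is spanned
  by matrix units above the diagonal in degree 0, those below it in degree 1, the traceless diagonal
  matrices, \<open>c\<close> and \<open>d\<close>.\<close>

lemma borel_subset_span:
  assumes "n \<ge> 1"
  shows "\<exists>S. finite S \<and> S \<subseteq> affine_borel n \<and> affine_borel n \<subseteq> affine.span (box_ideal n P M \<union> S)"
proof -
  define S1 where "S1 = (\<lambda>(a, b). (Poly_Mapping.single 0 (unit_mat a b), 0, 0) :: affine) `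
    {(a, b). a \<in> {1..n} \<and> b \<in> {1..n} \<and> a < b}"
  define S2 where "S2 = (\<lambda>(a, b). (Poly_Mapping.single 1 (unit_mat a b), 0, 0) :: affine) `
    {(a, b). a \<in> {1..n} \<and> b \<in> {1..n} \<and> b < a}"
  define S3 where "S3 = (\<lambda>a. (Poly_Mapping.single 0 (unit_mat a a - unit_mat 1 1), 0, 0) :: affine) ` {1..n}"
  define S where "S = S1 \<union> S2 \<union> S3 \<union> {(0, 1, 0), (0, 0, 1)}"
  let ?W = "affine.span (box_ideal n P M \<union> S)"
  have W: "affine.subspace ?W" by simp
  have fin: "finite {(a, b). a \<in> {1..n} \<and> b \<in> {1..n} \<and> Q a b}" for Q
    by (rule finite_subset[of _ "{1..n} \<times> {1..n}"]) auto
  have "finite S" unfolding S_def S1_def S2_def S3_def using fin by auto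
  moreover have "S \<subseteq> affine_borel n"
  proof -
    have "S1 \<subseteq> affine_nplus n"
      unfolding S1_def affine_nplus_eq
      by (auto intro!: single_unit_in_supported simp: nplus_supp_def)
    moreover have "S2 \<subseteq> affine_nplus n"
      unfolding S2_def affine_nplus_eq
      by (auto intro!: single_unit_in_supported simp: nplus_supp_def)
    moreover have "S3 \<subseteq> affine_cartan n"
      unfolding S3_def affine_cartan_def using assms by (auto intro!: unit_mat_diff_cartan)
    moreover have "{(0, 1, 0), (0, 0, 1)} \<subseteq> affine_cartan n"
      by (auto simp: affine_cartan_iff intro!: exI[of _ 0])
    ultimately show ?thesis unfolding S_def
      using affine_nplus_subset_borel affine_cartan_subset_borel by blast
  qed
  moreover have "affine_borel n \<subseteq> ?W"
  proof
    have base: "z \<in> ?W" if "z \<in> S" for z using that by (intro affine.span_base) simp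
    have offdiag: "weight_space n k a b \<subseteq> ?W"
      if gen: "(Poly_Mapping.single k (unit_mat a b), 0, 0) \<in> S" and ab: "a \<noteq> b" "a \<noteq> 0" for k a b
    proof
      fix x assume "x \<in> weight_space n k a b"
      then obtain A where A: "x = (Poly_Mapping.single k A, 0, 0)"
        "\<And>i j. A i j \<noteq> 0 \<Longrightarrow> rep i j = rep a b" by (rule weight_spaceE) (rule that)
      define c where "c = A a b"
      have "A i j = mat_scale c (unit_mat a b) i j" for i j
        using A(2)[of i j] ab unfolding mat_scale_def c_def
        by (cases "A i j = 0") (auto simp: unit_mat_def rep_def split: if_splits)
      then have "A = mat_scale c (unit_mat a b)" by (intro ext)
      then have "x = affine_scale c (Poly_Mapping.single k (unit_mat a b), 0, 0)"
        unfolding A(1) affine_scale_single by simp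
      then show "x \<in> ?W" using affine.span_scale[OF base[OF gen]] by metis
    qed
    have diag: "weight_space n 0 a a \<subseteq> ?W" for a
    proof
      fix x assume "x \<in> weight_space n 0 a a"
      then obtain A where A: "x = (Poly_Mapping.single 0 A, 0, 0)" "A \<in> sl n"
        "\<And>i j. A i j \<noteq> 0 \<Longrightarrow> rep i j = rep a a" by (rule weight_spaceE) (rule that)
      define g :: "nat \<Rightarrow> affine" where
        "g i = affine_scale (A i i) (Poly_Mapping.single 0 (unit_mat i i - unit_mat 1 1), 0, 0)" for i
      have "g i \<in> ?W" if "i \<in> {1..n}" for i
        unfolding g_def using that by (intro affine.span_scale base) (auto simp: S_def S3_def)
      then have "(\<Sum>i\<in>{1..n}. g i) \<in> ?W" by (intro affine.subspace_sum[OF W])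
      moreover have "(\<Sum>i\<in>{1..n}. g i) = x"
      proof -
        \<comment> \<open>The total coefficient of \<open>e_11\<close> coming from the subtracted
          terms is the trace, so these terms cancel.\<close>
        have tr: "(\<Sum>i = 1..n. A i i) = 0" using A(2) by (simp add: sl_def mat_trace_def)
        have "(\<Sum>i = 1..n. A i i * (unit_mat i i p q - unit_mat 1 1 p q)) = A p q" for p q
        proof -
          have "(\<Sum>i = 1..n. A i i * (unit_mat i i p q - unit_mat 1 1 p q)) =
              (\<Sum>i = 1..n. A i i * unit_mat i i p q) - (\<Sum>i = 1..n. A i i) * unit_mat 1 1 p q"
            by (simp add: right_diff_distrib sum_subtractf sum_distrib_right)
          also have "\<dots> = (\<Sum>i = 1..n. if i = p then (if p = q then A p p else 0) else 0)"
            unfolding tr mult_zero_left diff_0_right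
            by (intro sum.cong refl) (auto simp: unit_mat_def)
          also have "\<dots> = A p q"
            using A(2) A(3)[of p q] by (cases "A p q = 0") (auto simp: rep_def sl_def matrices_def)
          finally show ?thesis .
        qed
        then have "coef (\<Sum>i = 1..n. fst (g i)) m p q = coef (Poly_Mapping.single 0 A) m p q" for m p q
          by (auto simp: lookup_sum sum_fun_apply2 g_def affine_scale_def mat_scale_def
              lookup_single when_def intro!: sum.neutral)
        then have "(\<Sum>i = 1..n. fst (g i)) = Poly_Mapping.single 0 A"
          by (intro poly_mapping_eqI) (simp add: fun_eq_iff)
        moreover have "snd (g i) = 0" for i by (simp add: g_def affine_scale_def zero_prod_def)
        ultimately show ?thesis
          by (simp add: A(1) prod_eq_iff fst_sum snd_sum zero_prod_def)
      qed
      ultimately show "x \<in> ?W" by simp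
    qed
    have "supported n borel_supp \<subseteq> ?W"
    proof (rule supported_subset_subspace[OF W])
      fix k a b assume ab: "a \<in> {1..n}" "b \<in> {1..n}" "borel_supp k a b"
      consider "k = 0" "a = b" | "k = 0" "a < b" | "k = 1" "b < a" | "k = 1" "a < b" | "k = 1" "a = b" | "k \<ge> 2"
        using ab(3) unfolding borel_supp_def by fastforce
      then show "weight_space n k a b \<subseteq> ?W"
      proof cases
        case 1
        then show ?thesis using diag by simp
      next
        case 2
        then show ?thesis using ab by (intro offdiag) (auto simp: S_def S1_def)
      next
        case 3
        then show ?thesis using ab by (intro offdiag) (auto simp: S_def S2_def)
      next
        case 4
        then have "weight_space n k a b \<subseteq> box_ideal n P M"
          unfolding box_ideal_def using ab by (subst weight_space_subset_iff) (auto simp: ideal_supp_def)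
        then show ?thesis using affine.span_superset by blast
      next
        case 5
        then have "weight_space n k a b \<subseteq> box_ideal n P M"
          unfolding box_ideal_def by (auto intro!: weight_space_diag_subset simp: ideal_supp_def)
        then show ?thesis using affine.span_superset by blast
      next
        case 6
        then have "weight_space n k a b \<subseteq> box_ideal n P M"
          unfolding box_ideal_def by (intro weight_space_subset_supported) (simp add: ideal_supp_def)
        then show ?thesis using affine.span_superset by blast
      qed
    qed
    then have main: "(y, 0, 0) \<in> ?W" if "\<And>k. coef y k \<in> sl n"
      "\<And>k a b. coef y k a b \<noteq> 0 \<Longrightarrow> borel_supp k a b" for y
      using that by (auto simp: in_supported_iff)
    fix x assume "x \<in> affine_borel n"
    then obtain y u v where y: "x = (y, u, v)" "\<And>k. coef y k \<in> sl n"
      "\<And>k a b. coef y k a b \<noteq> 0 \<Longrightarrow> borel_supp k a b" by (rule affine_borelE) (rule that)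
    have "Poly_Mapping.map (mat_scale w) (0 :: int \<Rightarrow>\<^sub>0 cmatrix) = 0" for w
      by (rule poly_mapping_eqI) simp
    then have "x = (y, 0, 0) + (affine_scale u (0, 1, 0) + affine_scale v (0, 0, 1))"
      using y(1) by (simp add: affine_scale_def)
    moreover have "\<dots> \<in> ?W"
      by (intro affine.span_add affine.span_scale base main y) (auto simp: S_def)
    ultimately show "x \<in> ?W" by simp
  qed
  ultimately show ?thesis by blast
qed

lemma box_ideal_is_ideal:
  assumes adm: "admissible n P M"
  shows "is_ideal n (affine_borel n) (box_ideal n P M)"
  unfolding is_ideal_def
proof (intro conjI ballI)
  show "box_ideal n P M \<subseteq> affine_borel n"
    using box_ideal_subset_nplus[OF adm] affine_nplus_subset_borel by blast
  show "affine.subspace (box_ideal n P M)" unfolding box_ideal_def by (rule subspace_supported)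
  fix x y assume x: "x \<in> affine_borel n" and y: "y \<in> box_ideal n P M"
  from x obtain x' u v where x': "x = (x', u, v)" "\<And>k. coef x' k \<in> sl n"
    "\<And>k a b. coef x' k a b \<noteq> 0 \<Longrightarrow> borel_supp k a b" by (rule affine_borelE) (rule that)
  from y obtain y' where y': "y = (y', 0, 0)" unfolding box_ideal_def by (rule supportedE) (rule that)
  show "bracket n x y \<in> box_ideal n P M"
    unfolding box_ideal_def x'(1) y'
  proof (rule bracket_supported[where ?T1.0 = borel_supp and ?T2.0 = "ideal_supp P M"])
    show "(y', 0, 0) \<in> supported n (ideal_supp P M)" using y y' by (simp add: box_ideal_def)
  qed (use x' ideal_supp_closed[OF adm] borel_supp_nonneg ideal_supp_nonneg in auto)
qed

lemma box_ideal_combinatorial: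
  assumes n: "n \<ge> 2" and adm: "admissible n P M"
  shows "combinatorial_ideal n (box_ideal n P M)"
  unfolding combinatorial_ideal_def
proof (intro conjI ballI impI box_ideal_is_ideal[OF adm] box_ideal_subset_nplus[OF adm])
  show "finite_codim (affine_borel n) (box_ideal n P M)"
    using borel_subset_span n by (auto simp: finite_codim_def)
  fix \<alpha> assume "\<alpha> \<in> roots n" and ne: "box_ideal n P M \<inter> root_space n \<alpha> \<noteq> {0}"
  then obtain k a b where ab: "\<alpha> = wt n k a b" "a \<in> {1..n}" "b \<in> {1..n}" "k \<noteq> 0 \<or> a \<noteq> b"
    by (elim rootsE)
  have rs: "root_space n \<alpha> = weight_space n k a b" using ab root_space_wt by simp
  have "0 \<in> box_ideal n P M \<inter> root_space n \<alpha>"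
    unfolding rs box_ideal_def using affine.subspace_0 subspace_supported subspace_weight_space by blast
  with ne obtain x where x: "x \<in> box_ideal n P M" "x \<in> weight_space n k a b" "x \<noteq> 0"
    unfolding rs by blast
  from x(2,3) obtain A i j where A: "x = (Poly_Mapping.single k A, 0, 0)" "A i j \<noteq> 0"
    "rep i j = rep a b" "i \<in> {1..n}" "j \<in> {1..n}" by (rule weight_space_nonzeroE) (rule that)
  have "ideal_supp P M k i j"
    using x(1) A(2) unfolding box_ideal_def A(1) in_supported_iff by (metis lookup_single_eq)
  \<comment> \<open>For a diagonal weight the nonzero entry cannot have degree 0, since
    \<open>P\<close> has no diagonal boxes; in degree at least 1 the support contains the entire
    diagonal.\<close>
  then have "ideal_supp P M k i' j'" if "i' \<in> {1..n}" "j' \<in> {1..n}" "rep i' j' = rep a b" for i' j'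
    using that A(3-5) admissibleD(1)[OF adm, of i i]
    by (auto simp: rep_def ideal_supp_def split: if_splits)
  then show "root_space n \<alpha> \<subseteq> box_ideal n P M"
    unfolding rs box_ideal_def by (intro weight_space_subset_supported) blast
qed

text \<open>The element of \<open>D\<close> in the support is always \<open>\<delta>\<close>, so
  even empty \<open>P\<close> and \<open>M\<close> give a basic ideal.\<close>

lemma box_ideal_basic:
  assumes n: "n \<ge> 2" and adm: "admissible n P M"
  shows "basic_ideal n (box_ideal n P M)"
proof -
  have "weight_space n 1 1 1 \<subseteq> box_ideal n P M"
    unfolding box_ideal_def by (rule weight_space_diag_subset) (simp add: ideal_supp_def)
  then have "delta n \<in> supp n (box_ideal n P M)"
    using n by (simp add: delta_eq[of n 1] wt_in_supp_iff)
  then show ?thesis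
    using box_ideal_combinatorial[OF assms] by (auto simp: basic_ideal_def D_roots_def)
qed

section \<open>The image in the quotient by \<open>ideal_a\<close>\<close>

lemma ideal_a_bracket:
  assumes "n \<ge> 1" "x \<in> affine_nplus n" "y \<in> ideal_a n"
  shows "bracket n x y \<in> ideal_a n \<and> bracket n y x \<in> ideal_a n"
proof -
  have nn: "nplus_supp k a b \<Longrightarrow> 0 \<le> k" "a_supp k a b \<Longrightarrow> 0 \<le> k" for k a b
    by (auto simp: nplus_supp_def a_supp_def)
  have c1: "nplus_supp k a c \<Longrightarrow> a_supp m c b \<Longrightarrow> a_supp (k + m) a b"
    and c2: "a_supp k a c \<Longrightarrow> nplus_supp m c b \<Longrightarrow> a_supp (k + m) a b" for k m a b c
    by (auto simp: nplus_supp_def a_supp_def)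
  have x: "x \<in> supported n nplus_supp" and y: "y \<in> supported n a_supp"
    using assms by (auto simp: affine_nplus_eq ideal_a_eq)
  show ?thesis
    unfolding ideal_a_eq[OF assms(1)]
    by (intro conjI bracket_supported_supported[OF x y] bracket_supported_supported[OF y x])
      (rule nn c1 c2; assumption)+
qed

lemma ideal_a_subset_nplus: "n \<ge> 1 \<Longrightarrow> ideal_a n \<subseteq> affine_nplus n"
  by (simp add: ideal_a_eq affine_nplus_eq) (rule supported_mono, auto simp: a_supp_def nplus_supp_def)

lemma subspace_ideal_a: "affine.subspace (ideal_a n)"
  by (simp add: ideal_a_def)

lemma quot_bracket_ideal_a:
  assumes "n \<ge> 1" "x \<in> affine_nplus n" "y \<in> affine_nplus n"
  shows "quot_bracket n (ideal_a n) (coset (ideal_a n) x) (coset (ideal_a n) y) =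
    coset (ideal_a n) (bracket n x y)"
  using assms ideal_a_bracket
  by (intro quot_bracket_coset[OF subspace_ideal_a ideal_a_subset_nplus]) auto

lemma box_ideal_quasi_abelian:
  assumes n: "n \<ge> 2" and adm: "admissible n P M"
  shows "quasi_abelian n (box_ideal n P M)"
proof -
  have n1: "n \<ge> 1" using n by simp
  let ?K = "ideal_a n" and ?I = "box_ideal n P M" and ?L = "affine_nplus n"
  note IL = box_ideal_subset_nplus[OF adm]
  have I: "affine.subspace ?I" unfolding box_ideal_def by (rule subspace_supported)
  have LI: "bracket n x y \<in> ?I" if "x \<in> ?L" "y \<in> ?I" for x y
    using that box_ideal_is_ideal[OF adm] affine_nplus_subset_borel unfolding is_ideal_def by blast
  have II: "coset ?K (bracket n x y) = coset ?K 0" if xy: "x \<in> ?I" "y \<in> ?I" for x y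
  proof -
    have "bracket n x y \<in> ?K"
      unfolding ideal_a_eq[OF n1]
      by (rule bracket_supported_supported[OF xy[unfolded box_ideal_def]])
        (rule ideal_supp_nonneg ideal_supp_products[OF adm]; assumption)+
    then show ?thesis by (intro coset_absorb[OF subspace_ideal_a]) simp
  qed
  have "is_abelian_ideal_quot n ?L ?K (coset ?K ` ?I)"
    unfolding is_abelian_ideal_quot_def
  proof (intro conjI ballI allI)
    show "coset ?K ` ?I \<subseteq> coset ?K ` ?L" using IL by blast
    show "coset ?K 0 \<in> coset ?K ` ?I" using affine.subspace_0[OF I] by blast
    fix U V assume "U \<in> coset ?K ` ?I" "V \<in> coset ?K ` ?I"
    then obtain x y where xy: "U = coset ?K x" "V = coset ?K y" "x \<in> ?I" "y \<in> ?I" by blast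
    show "quot_add ?K U V \<in> coset ?K ` ?I"
      unfolding xy quot_add_coset[OF subspace_ideal_a] using affine.subspace_add[OF I] xy by blast
    show "quot_scale ?K z U \<in> coset ?K ` ?I" for z
      unfolding xy quot_scale_coset[OF subspace_ideal_a] using affine.subspace_scale[OF I] xy by blast
    have "x \<in> ?L" "y \<in> ?L" using xy IL by auto
    then show "quot_bracket n ?K U V = coset ?K 0"
      unfolding xy quot_bracket_ideal_a[OF n1 \<open>x \<in> ?L\<close> \<open>y \<in> ?L\<close>] using II xy by blast
  next
    fix U V assume "U \<in> coset ?K ` ?L" "V \<in> coset ?K ` ?I"
    then obtain x y where xy: "U = coset ?K x" "V = coset ?K y" "x \<in> ?L" "y \<in> ?I" by blast
    then have "y \<in> ?L" using IL by blast
    then show "quot_bracket n ?K U V \<in> coset ?K ` ?I"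
      unfolding xy quot_bracket_ideal_a[OF n1 \<open>x \<in> ?L\<close> \<open>y \<in> ?L\<close>] using LI xy by blast
  qed
  then show ?thesis using box_ideal_basic[OF assms] by (simp add: quasi_abelian_def)
qed

lemma boxes_box_ideal:
  assumes n: "n \<ge> 2" and adm: "admissible n P M"
  shows "boxes n (s_plus n (box_ideal n P M)) = P" "boxes n (s_minus n (box_ideal n P M)) = M"
proof -
  have pos: "box_root n a b \<in> pos_roots n \<longleftrightarrow> a < b" and neg: "box_root n a b \<in> neg_roots n \<longleftrightarrow> b < a"
    if "a \<in> {1..n}" "b \<in> {1..n}" "a \<noteq> b" for a b
  proof -
    have *: "c = a \<and> d = b" if "wt n 0 a b = wt n 0 c d" "c \<in> {1..n}" "d \<in> {1..n}" for c d
      using wt_eqD[OF that(1)] that \<open>a \<in> _\<close> \<open>b \<in> _\<close> \<open>a \<noteq> b\<close> by (auto simp: rep_def split: if_splits)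
    show "box_root n a b \<in> pos_roots n \<longleftrightarrow> a < b"
      unfolding pos_roots_def box_root_eq using * that by blast
    show "box_root n a b \<in> neg_roots n \<longleftrightarrow> b < a"
      unfolding neg_roots_def box_root_eq using * that by blast
  qed
  have sup: "wt n k a b \<in> supp n (box_ideal n P M) \<longleftrightarrow> ideal_supp P M k a b"
    if "a \<in> {1..n}" "b \<in> {1..n}" "a \<noteq> b" for k a b
    using that n by (simp add: wt_in_supp_iff box_ideal_def weight_space_subset_iff)
  show "boxes n (s_plus n (box_ideal n P M)) = P"
  proof (intro set_eqI, clarify)
    fix a b
    show "(a, b) \<in> boxes n (s_plus n (box_ideal n P M)) \<longleftrightarrow> (a, b) \<in> P"
      using pos[of a b] sup[of a b 0] admissibleD(1)[OF adm, of a b]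
      by (auto simp: boxes_def s_plus_def box_root_eq ideal_supp_def)
  qed
  show "boxes n (s_minus n (box_ideal n P M)) = M"
  proof (intro set_eqI, clarify)
    fix a b
    show "(a, b) \<in> boxes n (s_minus n (box_ideal n P M)) \<longleftrightarrow> (a, b) \<in> M"
      using neg[of a b] sup[of a b 1] admissibleD(2)[OF adm, of a b]
      by (auto simp: boxes_def s_minus_def box_root_eq wt_plus_delta ideal_supp_def)
  qed
qed

section \<open>Quasi-abelian ideals come from boxes\<close>

lemma mat_bracket_unit:
  assumes "c \<in> {1..n}" "b \<in> {1..n}"
  shows "mat_bracket n (unit_mat a c) (unit_mat c b) =
    unit_mat a b - (if a = b then unit_mat c c else 0)"
  using assms by (auto simp: mat_bracket_def mat_mul_unit)

text \<open>The ideal is stable under the Cartan subalgebra, hence contains the weight component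
  through the given entry. That component is a nonzero vector of a root space, so the ideal, being
  combinatorial, contains the whole root space.\<close>

lemma combinatorial_entry:
  assumes n: "n \<ge> 2" and comb: "combinatorial_ideal n I"
    and x: "(x, 0, 0) \<in> I" and nz: "coef x k a b \<noteq> 0"
  shows "nplus_supp k a b" "weight_space n k a b \<subseteq> I"
proof -
  have IN: "I \<subseteq> supported n nplus_supp" and I: "affine.subspace I"
    and inv: "\<And>h w. h \<in> affine_cartan n \<Longrightarrow> w \<in> I \<Longrightarrow> bracket n h w \<in> I"
    using comb affine_cartan_subset_borel[of n]
    unfolding combinatorial_ideal_def is_ideal_def affine_nplus_eq by auto
  have xs: "(x, 0, 0) \<in> supported n nplus_supp" using x IN by blast
  then have sl: "coef x m \<in> sl n" for m by (simp add: in_supported_iff)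
  show T: "nplus_supp k a b" using xs nz by (simp add: in_supported_iff)
  have ab: "a \<in> {1..n}" "b \<in> {1..n}" using nz sl[of k] by (auto simp: sl_def matrices_def)
  have knz: "k \<noteq> 0 \<or> a \<noteq> b" using T by (auto simp: nplus_supp_def)
  have rs: "root_space n (wt n k a b) = weight_space n k a b" by (rule root_space_wt[OF ab knz])
  have "piece x (k, a, b) \<in> I \<inter> root_space n (wt n k a b)"
    unfolding rs using piece_in_invariant_subspace[OF I inv x sl ab] piece_in_weight_space[OF sl ab]
    by blast
  moreover have "piece x (k, a, b) \<noteq> 0"
  proof
    assume "piece x (k, a, b) = 0"
    then have "coef (fst (piece x (k, a, b))) k a b = 0" by simp
    then show False using nz by (simp add: piece_def)
  qed
  ultimately have "I \<inter> root_space n (wt n k a b) \<noteq> {0}" by blast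
  then show "weight_space n k a b \<subseteq> I"
    using comb wt_in_roots[OF n ab knz] unfolding combinatorial_ideal_def rs[symmetric] by blast
qed

lemma combinatorial_eq_supported:
  assumes n: "n \<ge> 2" and comb: "combinatorial_ideal n I"
  shows "I = supported n (\<lambda>k a b. weight_space n k a b \<subseteq> I)"
proof
  have I: "affine.subspace I" and IN: "I \<subseteq> supported n nplus_supp"
    using comb unfolding combinatorial_ideal_def is_ideal_def affine_nplus_eq by auto
  show "supported n (\<lambda>k a b. weight_space n k a b \<subseteq> I) \<subseteq> I"
    by (rule supported_subset_subspace[OF I])
  show "I \<subseteq> supported n (\<lambda>k a b. weight_space n k a b \<subseteq> I)"
  proof
    fix x assume x: "x \<in> I"
    then have "x \<in> supported n nplus_supp" using IN by blast
    then obtain y where y: "x = (y, 0, 0)" "\<And>k. coef y k \<in> sl n" by (rule supportedE) (rule that)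
    have "(y, 0, 0) \<in> I" using x y by simp
    from combinatorial_entry(2)[OF n comb this] y
    show "x \<in> supported n (\<lambda>k a b. weight_space n k a b \<subseteq> I)"
      by (simp add: in_supported_iff)
  qed
qed

lemma combinatorial_single:
  assumes "n \<ge> 2" "combinatorial_ideal n I" "(Poly_Mapping.single k A, 0, 0) \<in> I" "A a b \<noteq> 0"
  shows "nplus_supp k a b" "weight_space n k a b \<subseteq> I"
  using combinatorial_entry[OF assms(1-3), of k a b] assms(4) by simp_all

text \<open>One nonzero entry in one bracket suffices to put a whole weight space into
  \<open>I\<close>; all later closure properties are obtained by exhibiting such an entry.\<close>

lemma combinatorial_bracket:
  assumes n: "n \<ge> 2" and comb: "combinatorial_ideal n I"
    and T: "nplus_supp k a b" "a \<in> {1..n}" "b \<in> {1..n}" "a \<noteq> b"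
    and B: "(Poly_Mapping.single m B, 0, 0) \<in> I" "m \<ge> 0"
    and nz: "mat_bracket n (unit_mat a b) B i j \<noteq> 0"
  shows "weight_space n (k + m) i j \<subseteq> I"
proof -
  have "(Poly_Mapping.single k (unit_mat a b), 0, 0) \<in> affine_borel n"
    using single_unit_in_supported[OF T(2-4), of nplus_supp] T(1) affine_nplus_subset_borel
    by (auto simp: affine_nplus_eq)
  then have "bracket n (Poly_Mapping.single k (unit_mat a b), 0, 0) (Poly_Mapping.single m B, 0, 0) \<in> I"
    using comb B unfolding combinatorial_ideal_def is_ideal_def by blast
  then have "(Poly_Mapping.single (k + m) (mat_bracket n (unit_mat a b) B), 0, 0) \<in> I"
    using T(1) B(2) by (subst (asm) bracket_single) (auto simp: nplus_supp_def)
  then show ?thesis using combinatorial_single(2)[OF n comb] nz by blast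
qed

lemma weight_space_nplus_supp:
  assumes n: "n \<ge> 2" and comb: "combinatorial_ideal n I"
    and ab: "a \<in> {1..n}" "b \<in> {1..n}" and W: "weight_space n k a b \<subseteq> I"
  shows "nplus_supp k a b"
proof (cases "a = b")
  case False
  have "(Poly_Mapping.single k (unit_mat a b), 0, 0) \<in> I"
    using single_in_weight_space(1)[OF ab False] W by blast
  from combinatorial_single(1)[OF n comb this, of a b] show ?thesis by (simp add: unit_mat_def)
next
  case True
  define c where "c = (if a = 1 then 2 else 1 :: nat)"
  have c: "c \<in> {1..n}" "a \<noteq> c" using n by (auto simp: c_def)
  have "(Poly_Mapping.single k (unit_mat a a - unit_mat c c), 0, 0) \<in> I"
    using single_in_weight_space(2)[OF ab(1) c] W True by blast
  from combinatorial_single(1)[OF n comb this, of a a] show ?thesis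
    using c True by (simp add: unit_mat_def)
qed

lemma combinatorial_steps:
  assumes n: "n \<ge> 2" and comb: "combinatorial_ideal n I"
    and rng: "a \<in> {1..n}" "b \<in> {1..n}" "c \<in> {1..n}" and ne: "a \<noteq> b" "c \<noteq> b" "a \<noteq> c"
  shows "nplus_supp k a c \<Longrightarrow> weight_space n m c b \<subseteq> I \<Longrightarrow> weight_space n (k + m) a b \<subseteq> I"
    and "nplus_supp k c b \<Longrightarrow> weight_space n m a c \<subseteq> I \<Longrightarrow> weight_space n (k + m) a b \<subseteq> I"
proof -
  have unit: "(Poly_Mapping.single m (unit_mat a b), 0, 0) \<in> I"
    if "weight_space n m a b \<subseteq> I" "a \<in> {1..n}" "b \<in> {1..n}" "a \<noteq> b" for m a b
    using that single_in_weight_space(1) by blast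
  have nonneg: "m \<ge> 0" if "weight_space n m a b \<subseteq> I" "a \<in> {1..n}" "b \<in> {1..n}" for m a b
    using weight_space_nplus_supp[OF n comb that(2,3,1)] by (auto simp: nplus_supp_def)
  show "weight_space n (k + m) a b \<subseteq> I" if T: "nplus_supp k a c" and W: "weight_space n m c b \<subseteq> I"
  proof (rule combinatorial_bracket[OF n comb T rng(1,3) ne(3) unit[OF W rng(3,2) ne(2)] nonneg[OF W rng(3,2)]])
    show "mat_bracket n (unit_mat a c) (unit_mat c b) a b \<noteq> 0"
      using rng ne by (simp add: mat_bracket_unit) (simp add: unit_mat_def)
  qed
  show "weight_space n (k + m) a b \<subseteq> I" if T: "nplus_supp k c b" and W: "weight_space n m a c \<subseteq> I"
  proof (rule combinatorial_bracket[OF n comb T rng(3,2) ne(2) unit[OF W rng(1,3) ne(3)] nonneg[OF W rng(1,3)]])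
    show "mat_bracket n (unit_mat c b) (unit_mat a c) a b \<noteq> 0"
      using rng ne by (simp add: mat_bracket_def mat_mul_unit) (simp add: unit_mat_def)
  qed
qed

text \<open>Passage through the diagonal and back: \<open>[e_ab, e_ba] = e_aa - e_bb\<close> and
  \<open>[e_ab, e_aa - e_bb] = - 2 e_ab\<close>. The index \<open>c\<close> is free because all
  diagonal pairs of one degree share a weight space.\<close>

lemma combinatorial_diag_steps:
  assumes n: "n \<ge> 2" and comb: "combinatorial_ideal n I"
    and rng: "a \<in> {1..n}" "b \<in> {1..n}" and ne: "a \<noteq> b" and T: "nplus_supp k a b"
  shows "weight_space n m b a \<subseteq> I \<Longrightarrow> weight_space n (k + m) c c \<subseteq> I"
    and "weight_space n m c c \<subseteq> I \<Longrightarrow> weight_space n (k + m) a b \<subseteq> I"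
proof -
  have dg: "weight_space n m c c = weight_space n m d d" for m c d
    by (simp add: weight_space_def rep_def)
  {
    assume W: "weight_space n m b a \<subseteq> I"
    have "weight_space n (k + m) a a \<subseteq> I"
    proof (rule combinatorial_bracket[OF n comb T rng ne])
      show "(Poly_Mapping.single m (unit_mat b a), 0, 0) \<in> I"
        using single_in_weight_space(1)[OF rng(2,1)] ne W by blast
      show "m \<ge> 0" using weight_space_nplus_supp[OF n comb rng(2,1) W] by (auto simp: nplus_supp_def)
      show "mat_bracket n (unit_mat a b) (unit_mat b a) a a \<noteq> 0"
        using rng ne by (simp add: mat_bracket_unit) (simp add: unit_mat_def)
    qed
    then show "weight_space n (k + m) c c \<subseteq> I" using dg[of "k + m" c a] by simp
  next
    assume "weight_space n m c c \<subseteq> I"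
    then have W: "weight_space n m a a \<subseteq> I" using dg[of m c a] by simp
    show "weight_space n (k + m) a b \<subseteq> I"
    proof (rule combinatorial_bracket[OF n comb T rng ne])
      show "(Poly_Mapping.single m (unit_mat a a - unit_mat b b), 0, 0) \<in> I"
        using single_in_weight_space(2)[OF rng ne] W by blast
      show "m \<ge> 0" using weight_space_nplus_supp[OF n comb rng(1,1) W] by (auto simp: nplus_supp_def)
      have D: "unit_mat a a - unit_mat b b \<in> matrices n"
        using unit_mat_diff_cartan[OF rng] by (intro sl_matrices sl_cartan_sl)
      have "mat_mul n (unit_mat a b) (unit_mat a a - unit_mat b b) a b = -1"
        "mat_mul n (unit_mat a a - unit_mat b b) (unit_mat a b) a b = 1"
        using mat_mul_diag[of "unit_mat a a - unit_mat b b" "unit_mat a b" n a b]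
          sl_matrices[OF unit_mat_sl[OF rng ne]] ne
        by (auto simp: unit_mat_def)
      then show "mat_bracket n (unit_mat a b) (unit_mat a a - unit_mat b b) a b \<noteq> 0"
        by (simp add: mat_bracket_def)
    qed
  }
qed

text \<open>For a root of \<open>D\<close> other than \<open>\<delta>\<close>, the opposite root
  vector in the complementary degree (0 or 1) lies in \<open>affine_nplus\<close>. Their bracket is
  a nonzero element of \<open>h \<otimes> t\<close>.\<close>

lemma basic_delta:
  assumes n: "n \<ge> 2" and basic: "basic_ideal n I"
  shows "weight_space n 1 c c \<subseteq> I"
proof -
  have comb: "combinatorial_ideal n I" using basic by (simp add: basic_ideal_def)
  have dg: "weight_space n 1 c c = weight_space n 1 1 1"
    by (simp add: weight_space_def rep_def)
  from basic obtain \<alpha> where \<alpha>: "\<alpha> \<in> supp n I" "\<alpha> \<in> D_roots n" by (auto simp: basic_ideal_def)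
  from \<alpha>(2) consider "\<alpha> = wt n 1 1 1"
    | a b where "a \<in> {1..n}" "b \<in> {1..n}" "\<alpha> = wt n 0 a b" "a < b"
    | a b where "a \<in> {1..n}" "b \<in> {1..n}" "\<alpha> = wt n 1 a b" "b < a"
    unfolding D_roots_iff delta_eq[of n 1] by blast
  then show ?thesis
  proof cases
    case 1
    then show ?thesis using \<alpha>(1) n dg by (simp add: wt_in_supp_iff)
  next
    case (2 a b)
    then have W: "weight_space n 0 a b \<subseteq> I" using \<alpha>(1) n by (simp add: wt_in_supp_iff)
    have "nplus_supp 1 b a" by (simp add: nplus_supp_def)
    from combinatorial_diag_steps(1)[OF n comb 2(2,1) _ this W] 2(4) show ?thesis by simp
  next
    case (3 a b)
    then have W: "weight_space n 1 a b \<subseteq> I" using \<alpha>(1) n by (simp add: wt_in_supp_iff)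
    have "nplus_supp 0 b a" using 3 by (simp add: nplus_supp_def)
    from combinatorial_diag_steps(1)[OF n comb 3(2,1) _ this W] 3(4) show ?thesis by simp
  qed
qed

text \<open>Off the diagonal, bracket \<open>h \<otimes> t\<close> with \<open>e_ab\<close> in
  degree \<open>k - 1\<close>; this is in \<open>affine_nplus\<close> precisely under the stated
  condition on \<open>k\<close>, \<open>a\<close>, \<open>b\<close>. On the diagonal in degree at
  least 2 one needs a pair of opposite root vectors instead.\<close>

lemma basic_degree_ge_1:
  assumes n: "n \<ge> 2" and basic: "basic_ideal n I" and rng: "a \<in> {1..n}" "b \<in> {1..n}"
  shows "k \<ge> 2 \<or> k = 1 \<and> a \<le> b \<Longrightarrow> weight_space n k a b \<subseteq> I"
proof -
  have comb: "combinatorial_ideal n I" using basic by (simp add: basic_ideal_def)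
  have off: "weight_space n k a b \<subseteq> I" if "k \<ge> 2 \<or> k = 1 \<and> a < b" "a \<noteq> b" "a \<in> {1..n}" "b \<in> {1..n}" for k a b
  proof -
    have "nplus_supp (k - 1) a b" using that by (auto simp: nplus_supp_def)
    from combinatorial_diag_steps(2)[OF n comb that(3,4,2) this basic_delta[OF n basic]]
    show ?thesis by simp
  qed
  assume k: "k \<ge> 2 \<or> k = 1 \<and> a \<le> b"
  show "weight_space n k a b \<subseteq> I"
  proof (cases "a = b")
    case False
    then have "k \<ge> 2 \<or> k = 1 \<and> a < b" using k by auto
    then show ?thesis by (rule off[OF _ False rng])
  next
    case True
    show ?thesis
    proof (cases "k = 1")
      case True
      then show ?thesis using basic_delta[OF n basic] \<open>a = b\<close> by simp
    next
      case False
      then have "k \<ge> 2" using k by auto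
      \<comment> \<open>\<open>e_12\<close> in degree 1 was just shown to be available; its partner
        \<open>e_21\<close> has degree \<open>k - 1 \<ge> 1\<close> and hence lies in
        \<open>affine_nplus\<close>.\<close>
      have W: "weight_space n 1 1 2 \<subseteq> I" using off[of 1 1 2] n by auto
      have "nplus_supp (k - 1) 2 1" using \<open>k \<ge> 2\<close> by (simp add: nplus_supp_def)
      from combinatorial_diag_steps(1)[OF n comb _ _ _ this W, of a] n
      show ?thesis using \<open>a = b\<close> by simp
    qed
  qed
qed

lemma quasi_abelian_imp_box_ideal:
  assumes n: "n \<ge> 2" and qa: "quasi_abelian n I"
  shows "\<exists>P M. admissible n P M \<and> I = box_ideal n P M"
proof -
  have basic: "basic_ideal n I" using qa by (simp add: quasi_abelian_def)
  then have comb: "combinatorial_ideal n I" by (simp add: basic_ideal_def)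
  let ?W = "\<lambda>k a b. weight_space n k a b \<subseteq> I"
  define P where "P = {(a, b). a \<in> {1..n} \<and> b \<in> {1..n} \<and> a < b \<and> ?W 0 a b}"
  define M where "M = {(a, b). a \<in> {1..n} \<and> b \<in> {1..n} \<and> b < a \<and> ?W 1 a b}"
  have P: "?W 0 a b" "a \<in> {1..n}" "b \<in> {1..n}" "a < b" if "(a, b) \<in> P" for a b
    using that by (auto simp: P_def)
  have M: "?W 1 a b" "a \<in> {1..n}" "b \<in> {1..n}" "b < a" if "(a, b) \<in> M" for a b
    using that by (auto simp: M_def)
  note step = combinatorial_steps[OF n comb]
  have T0: "nplus_supp 0 a b" if "a < b" for a b using that by (simp add: nplus_supp_def)
  have T1: "nplus_supp 1 a b" for a b by (simp add: nplus_supp_def)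
  \<comment> \<open>A transposed pair would have bracket \<open>(e_aa - e_bb) \<otimes> t\<close>.
    Commutativity in the quotient places it in \<open>ideal_a\<close>, which has no diagonal entries
    in degree 1.\<close>
  have disj: "(b, a) \<notin> M" if ab: "(a, b) \<in> P" for a b
  proof
    assume ba: "(b, a) \<in> M"
    have rng: "a \<in> {1..n}" "b \<in> {1..n}" "a < b" using P[OF ab] by auto
    define x y :: affine where "x = (Poly_Mapping.single 0 (unit_mat a b), 0, 0)"
      and "y = (Poly_Mapping.single 1 (unit_mat b a), 0, 0)"
    have xI: "x \<in> I" "y \<in> I"
      using P(1)[OF ab] M(1)[OF ba] single_in_weight_space(1)[of _ n] rng unfolding x_def y_def by blast+
    have IL: "I \<subseteq> affine_nplus n" using comb by (simp add: combinatorial_ideal_def)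
    let ?K = "ideal_a n"
    have "quot_bracket n ?K (coset ?K x) (coset ?K y) = coset ?K 0"
      using qa xI unfolding quasi_abelian_def is_abelian_ideal_quot_def by blast
    moreover have "quot_bracket n ?K (coset ?K x) (coset ?K y) = coset ?K (bracket n x y)"
      using n xI IL by (intro quot_bracket_ideal_a) auto
    ultimately have "bracket n x y \<in> coset ?K 0" using coset_refl[OF subspace_ideal_a] by blast
    then have "bracket n x y \<in> supported n a_supp" using n by (simp add: coset_def ideal_a_eq)
    moreover have "bracket n x y = (Poly_Mapping.single 1 (unit_mat a a - unit_mat b b), 0, 0)"
      unfolding x_def y_def using rng by (simp add: bracket_single mat_bracket_unit)
    ultimately have "\<forall>i j. (unit_mat a a - unit_mat b b) i j \<noteq> 0 \<longrightarrow> a_supp 1 i j"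
      by (metis in_supported_iff lookup_single_eq)
    then have "a_supp 1 a a" using rng by (auto simp: unit_mat_def dest!: spec[of _ a])
    then show False by (simp add: a_supp_def)
  qed
  have "admissible n P M"
    unfolding admissible_def
  proof (intro conjI allI impI ballI)
    show "P \<subseteq> {(a, b). a \<in> {1..n} \<and> b \<in> {1..n} \<and> a < b}" by (auto simp: P_def)
    show "M \<subseteq> {(a, b). a \<in> {1..n} \<and> b \<in> {1..n} \<and> b < a}" by (auto simp: M_def)
  next
    fix a b c assume ab: "(a, b) \<in> P" and c: "c \<in> {1..<a}"
    have "?W (0 + 0) c b"
      by (rule step(1)[where c = a]) (use P[OF ab] c T0 in auto)
    then show "(c, b) \<in> P" using P[OF ab] c by (auto simp: P_def)
    \<comment> \<open>Degree 1 of \<open>affine_nplus\<close> is unrestricted, so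
      \<open>e_bc \<otimes> t\<close> may be used although \<open>c < b\<close>; the product drops
      below the diagonal in the same row.\<close>
    have "?W (1 + 0) a c"
      by (rule step(2)[where c = b]) (use P[OF ab] c T1 in auto)
    then show "(a, c) \<in> M" using P[OF ab] c by (auto simp: M_def)
  next
    fix a b c assume ab: "(a, b) \<in> P" and c: "c \<in> {b<..n}"
    have "?W (0 + 0) a c"
      by (rule step(2)[where c = b]) (use P[OF ab] c T0 in auto)
    then show "(a, c) \<in> P" using P[OF ab] c by (auto simp: P_def)
    have "?W (1 + 0) c b"
      by (rule step(1)[where c = a]) (use P[OF ab] c T1 in auto)
    then show "(c, b) \<in> M" using P[OF ab] c by (auto simp: M_def)
  next
    fix a b c assume ab: "(a, b) \<in> M" and c: "c \<in> {b<..<a}"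
    have "?W (0 + 1) c b"
      by (rule step(1)[where c = a]) (use M[OF ab] c T0 in auto)
    then show "(c, b) \<in> M" using M[OF ab] c by (auto simp: M_def)
    have "?W (0 + 1) a c"
      by (rule step(2)[where c = b]) (use M[OF ab] c T0 in auto)
    then show "(a, c) \<in> M" using M[OF ab] c by (auto simp: M_def)
  qed (use disj in blast)
  moreover have "I = box_ideal n P M"
  proof -
    have "?W k a b \<longleftrightarrow> ideal_supp P M k a b" if rng: "a \<in> {1..n}" "b \<in> {1..n}" for k a b
    proof
      assume W: "?W k a b"
      have "nplus_supp k a b" by (rule weight_space_nplus_supp[OF n comb rng W])
      then consider "k \<ge> 2" | "k = 1" | "k = 0" "a < b" unfolding nplus_supp_def by fastforce
      then show "ideal_supp P M k a b"
        by cases (use W rng in \<open>auto simp: ideal_supp_def P_def M_def\<close>)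
    next
      assume "ideal_supp P M k a b"
      then show "?W k a b"
        using basic_degree_ge_1[OF n basic rng, of k] P(1)[of a b] M(1)[of a b]
        unfolding ideal_supp_def by blast
    qed
    then have "supported n ?W = box_ideal n P M"
      unfolding box_ideal_def by (rule supported_cong)
    then show ?thesis using combinatorial_eq_supported[OF n comb] by simp
  qed
  ultimately show ?thesis by blast
qed

section \<open>Lattice paths and boxes\<close>

lemma count_list_take_Suc:
  "k < length w \<Longrightarrow> count_list (take (Suc k) w) x = count_list (take k w) x + (if w ! k = x then 1 else 0)"
  by (simp add: take_Suc_conv_app_nth)

lemma count_list_take_mono: "j \<le> k \<Longrightarrow> count_list (take j w) x \<le> count_list (take k w) x"
  by (metis count_list_append le_add1 le_add_diff_inverse take_add)

lemma count_East_South: "count_list w East + count_list w South = length w"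
proof (induction w)
  case (Cons s w)
  then show ?case by (cases s) auto
qed simp

lemma lattice_paths_length: "w \<in> lattice_paths n \<Longrightarrow> length w = 2 * n"
  using count_East_South[of w] by (simp add: lattice_paths_def)

lemma count_East_take:
  "k \<le> length w \<Longrightarrow> count_list (take k w) East + count_list (take k w) South = k"
  using count_East_South[of "take k w"] by simp

text \<open>The box is north-east exactly if the \<open>a\<close>-th south step comes after fewer
  than \<open>b\<close> east steps, that is, among the first \<open>a + b - 1\<close> steps. Thus
  one prefix decides, the one ending on the antidiagonal of the box.\<close>

lemma ne_boxes_iff:
  assumes w: "w \<in> lattice_paths n" and rng: "a \<in> {1..n}" "b \<in> {1..n}"
  shows "(a, b) \<in> ne_boxes n w \<longleftrightarrow> a \<le> count_list (take (a + b - 1) w) South"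
proof
  let ?S = "\<lambda>k. count_list (take k w) South"
  have len: "length w = 2 * n" by (rule lattice_paths_length[OF w])
  {
    assume "(a, b) \<in> ne_boxes n w"
    then obtain k where k: "k < length w" "w ! k = South" "Suc (?S k) = a"
      "count_list (take k w) East < b" by (auto simp: ne_boxes_def)
    have "Suc k \<le> a + b - 1" using k count_East_take[of k w] by simp
    then have "?S (Suc k) \<le> ?S (a + b - 1)" by (rule count_list_take_mono)
    then show "a \<le> ?S (a + b - 1)" using k by (simp add: count_list_take_Suc)
  next
    assume a: "a \<le> ?S (a + b - 1)"
    define j where "j = (LEAST j. a \<le> ?S j)"
    have j: "a \<le> ?S j" "j \<le> a + b - 1" unfolding j_def using a by (auto intro: LeastI Least_le)
    have "j \<noteq> 0" using j(1) rng by (intro notI) simp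
    then obtain k where k: "j = Suc k" by (cases j) auto
    have nk: "?S k < a" using not_less_Least[of k "\<lambda>j. a \<le> ?S j"] k by (simp add: j_def)
    have kl: "k < length w" using k j(2) rng len unfolding atLeastAtMost_iff by linarith
    then have 1: "w ! k = South" "Suc (?S k) = a"
      using j(1) nk k by (auto simp: count_list_take_Suc split: if_splits)
    moreover have "count_list (take k w) East < b"
      using count_East_take[of k w] kl 1 j(2) k rng by simp
    ultimately show "(a, b) \<in> ne_boxes n w" using rng kl by (auto simp: ne_boxes_def)
  }
qed

text \<open>If the prefix of length \<open>k\<close> has \<open>a > 0\<close> south steps, the box
  \<open>(a, k + 1 - a)\<close> tests exactly this prefix. Its membership carries the bound over to
  the other path, and by symmetry all prefix counts agree.\<close>

lemma ne_boxes_inj: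
  assumes w: "w \<in> lattice_paths n" "w' \<in> lattice_paths n" and eq: "ne_boxes n w = ne_boxes n w'"
  shows "w = w'"
proof -
  have len: "length w = 2 * n" "length w' = 2 * n" using w lattice_paths_length by auto
  have le: "count_list (take k v') South \<ge> a"
    if v: "v \<in> lattice_paths n" "v' \<in> lattice_paths n" "ne_boxes n v = ne_boxes n v'" "k \<le> 2 * n"
      "a = count_list (take k v) South" for v v' k a
  proof (cases "a = 0")
    case False
    have lv: "length v = 2 * n" "length v' = 2 * n" using v lattice_paths_length by auto
    have "a \<le> count_list v South" using count_list_take_mono[of k "2 * n" v South] v lv by simp
    then have an: "a \<le> n" using v by (simp add: lattice_paths_def)
    have ak: "a \<le> k" using count_East_take[of k v] v lv by simp
    show ?thesis
    proof (cases "k + 1 - a \<le> n")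
      case True
      then have "(a, k + 1 - a) \<in> ne_boxes n v"
        using v False an ak by (subst ne_boxes_iff) auto
      then show ?thesis
        using v False an ak True ne_boxes_iff[OF v(2), of a "k + 1 - a"] by auto
    next
      \<comment> \<open>The test box would lie beyond column \<open>n\<close>, but then even
        \<open>n\<close> east steps leave room for at least \<open>a\<close> south steps in the
        prefix.\<close>
      case out: False
      have "count_list (take k v') East \<le> count_list v' East"
        using count_list_take_mono[of k "2 * n" v' East] v lv by simp
      then have "count_list (take k v') East \<le> n" using v by (simp add: lattice_paths_def)
      then show ?thesis using out count_East_take[of k v'] v lv by simp
    qed
  qed simp
  have S: "count_list (take k w) South = count_list (take k w') South" if "k \<le> 2 * n" for k
    using le[OF w eq that refl] le[OF w(2,1) eq[symmetric] that refl] by simp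
  show ?thesis
  proof (rule nth_equalityI)
    fix k assume k: "k < length w"
    have "(w ! k = South) = (w' ! k = South)"
      using S[of k] S[of "Suc k"] k len by (auto simp: count_list_take_Suc split: if_splits)
    then show "w ! k = w' ! k" by (cases "w ! k"; cases "w' ! k") auto
  qed (simp add: len)
qed

text \<open>\<open>f a\<close> prescribes the number of east steps before the \<open>a\<close>-th
  south step. The width \<open>N\<close> is independent of \<open>m\<close> because the induction
  cuts off the last row together with the columns beyond \<open>f (Suc m)\<close>.\<close>

lemma path_with_rows:
  assumes "\<And>a b. 1 \<le> a \<Longrightarrow> a \<le> b \<Longrightarrow> b \<le> m \<Longrightarrow> f a \<le> f b" "\<And>a. a \<in> {1..m} \<Longrightarrow> f a \<le> N"
  shows "\<exists>w. count_list w East = N \<and> count_list w South = m \<and>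
    (\<forall>a\<in>{1..m}. \<exists>k<length w. w ! k = South \<and> Suc (count_list (take k w) South) = a \<and>
      count_list (take k w) East = f a)"
  using assms
proof (induction m arbitrary: N)
  case 0
  have "count_list (replicate N East) x = (if x = East then N else 0)" for x
    by (induction N) auto
  then show ?case by (intro exI[of _ "replicate N East"]) auto
next
  case (Suc m)
  obtain w where w: "count_list w East = f (Suc m)" "count_list w South = m"
    "\<And>a. a \<in> {1..m} \<Longrightarrow> \<exists>k<length w. w ! k = South \<and> Suc (count_list (take k w) South) = a \<and>
      count_list (take k w) East = f a"
    using Suc.IH[of "f (Suc m)"] Suc.prems by auto
  have rep: "count_list (replicate K East) x = (if x = East then K else 0)" for K x
    by (induction K) auto
  let ?v = "w @ South # replicate (N - f (Suc m)) East"
  have "\<exists>k<length ?v. ?v ! k = South \<and> Suc (count_list (take k ?v) South) = a \<and>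
      count_list (take k ?v) East = f a" if a: "a \<in> {1..Suc m}" for a
  proof (cases "a = Suc m")
    case True
    then show ?thesis using w by (intro exI[of _ "length w"]) simp
  next
    case False
    then obtain k where "k < length w" "w ! k = South" "Suc (count_list (take k w) South) = a"
      "count_list (take k w) East = f a" using w(3)[of a] a by auto
    then show ?thesis by (intro exI[of _ k]) (simp add: nth_append)
  qed
  moreover have "count_list ?v East = N" "count_list ?v South = Suc m"
    using w Suc.prems(2)[of "Suc m"] by (auto simp: rep)
  ultimately show ?case by blast
qed

lemma ne_boxes_surj:
  assumes B: "B \<subseteq> {1..n} \<times> {1..n}"
    and up: "\<And>a b c. (a, b) \<in> B \<Longrightarrow> 1 \<le> c \<Longrightarrow> c \<le> a \<Longrightarrow> (c, b) \<in> B"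
    and right: "\<And>a b c. (a, b) \<in> B \<Longrightarrow> b \<le> c \<Longrightarrow> c \<le> n \<Longrightarrow> (a, c) \<in> B"
  shows "\<exists>w\<in>lattice_paths n. ne_boxes n w = B"
proof -
  \<comment> \<open>For a row of the array, the number of its boxes outside \<open>B\<close>: by
    closure to the east these come first, so this many east steps precede the crossing of the
    row.\<close>
  define f where "f a = (LEAST j. \<forall>b\<in>{j<..n}. (a, b) \<in> B)" for a
  have f: "\<forall>b\<in>{f a<..n}. (a, b) \<in> B" for a
    unfolding f_def by (rule LeastI[of _ n]) simp
  have fle: "f a \<le> j" if "\<forall>b\<in>{j<..n}. (a, b) \<in> B" for a j
    unfolding f_def using that by (rule Least_le)
  have fB: "(a, b) \<in> B \<longleftrightarrow> f a < b" if ab: "a \<in> {1..n}" "b \<in> {1..n}" for a b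
  proof
    assume "(a, b) \<in> B"
    then have "f a \<le> b - 1" using right ab by (intro fle) auto
    then show "f a < b" using ab unfolding atLeastAtMost_iff by linarith
  qed (use f[of a] ab in auto)
  obtain w where w: "count_list w East = n" "count_list w South = n"
    "\<And>a. a \<in> {1..n} \<Longrightarrow> \<exists>k<length w. w ! k = South \<and> Suc (count_list (take k w) South) = a \<and>
      count_list (take k w) East = f a"
  proof -
    have "f a \<le> f b" if "1 \<le> a" "a \<le> b" for a b
      using f[of b] up that by (intro fle) blast
    moreover have "f a \<le> n" for a by (rule fle) simp
    ultimately show ?thesis using path_with_rows[of n f n] that by blast
  qed
  have "(a, b) \<in> ne_boxes n w \<longleftrightarrow> f a < b" if ab: "a \<in> {1..n}" "b \<in> {1..n}" for a b
  proof -
    let ?S = "\<lambda>k. count_list (take k w) South"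
    obtain k where k: "k < length w" "w ! k = South" "Suc (?S k) = a"
      "count_list (take k w) East = f a" using w(3)[OF ab(1)] by blast
    have uniq: "j = k" if j: "j < length w" "w ! j = South" "Suc (?S j) = a" for j
    proof (rule ccontr)
      assume "j \<noteq> k"
      then consider "Suc j \<le> k" | "Suc k \<le> j" by linarith
      then show False
        by cases (use j k count_list_take_mono[of "Suc j" k w South]
          count_list_take_mono[of "Suc k" j w South] in \<open>auto simp: count_list_take_Suc\<close>)
    qed
    show ?thesis
    proof
      assume "(a, b) \<in> ne_boxes n w"
      then obtain j where "j < length w" "w ! j = South" "Suc (?S j) = a"
        "count_list (take j w) East < b" by (auto simp: ne_boxes_def)
      then show "f a < b" using uniq[of j] k(4) by simp
    next
      assume "f a < b"
      then have "\<exists>k<length w. w ! k = South \<and> Suc (?S k) = a \<and> count_list (take k w) East < b"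
        using k by (intro exI[of _ k]) simp
      then show "(a, b) \<in> ne_boxes n w"
        using ab by (simp add: ne_boxes_def)
    qed
  qed
  then have "(a, b) \<in> ne_boxes n w \<longleftrightarrow> (a, b) \<in> B" if "a \<in> {1..n}" "b \<in> {1..n}" for a b
    using fB that by simp
  moreover have "ne_boxes n w \<subseteq> {1..n} \<times> {1..n}" by (auto simp: ne_boxes_def)
  ultimately have "ne_boxes n w = B" using B by blast
  moreover have "w \<in> lattice_paths n" using w by (simp add: lattice_paths_def)
  ultimately show ?thesis by blast
qed

lemma boundary_path_eq: "w \<in> lattice_paths n \<Longrightarrow> boundary_path n (ne_boxes n w) = w"
  unfolding boundary_path_def by (rule the_equality) (auto intro: ne_boxes_inj)

section \<open>Dyck paths and their outer peaks\<close>

lemma height_0 [simp]: "height p 0 = 0"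
  by (simp add: height_def)

lemma height_Suc:
  "k < length p \<Longrightarrow> height p (Suc k) = height p k + (if p ! k = Rise then 1 else - 1)"
  by (cases "p ! k") (simp_all add: height_def count_list_take_Suc)

lemma height_lipschitz:
  assumes "s \<le> t" "t \<le> length p"
  shows "height p t \<le> height p s + int (t - s)" "height p s \<le> height p t + int (t - s)"
proof -
  have "height p t \<le> height p s + int (t - s) \<and> height p s \<le> height p t + int (t - s)"
    using assms
  proof (induction t rule: dec_induct)
    case (step t)
    then show ?case using height_Suc[of t p] by auto
  qed simp
  then show "height p t \<le> height p s + int (t - s)" "height p s \<le> height p t + int (t - s)" by auto
qed

lemma height_parity: "k \<le> length p \<Longrightarrow> even (height p k + int k)"
proof (induction k)
  case (Suc k)
  then show ?case using height_Suc[of k p] by auto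
qed simp

lemma path_eqI:
  assumes "length p = length q" "\<And>k. k \<le> length p \<Longrightarrow> height p k = height q k"
  shows "p = q"
proof (rule nth_equalityI[OF assms(1)])
  fix k assume k: "k < length p"
  have "(p ! k = Rise) = (q ! k = Rise)"
    using assms(2)[of k] assms(2)[of "Suc k"] height_Suc[of k p] height_Suc[of k q] k assms(1)
    by (auto split: if_splits)
  then show "p ! k = q ! k" by (cases "p ! k"; cases "q ! k") auto
qed

lemma path_with_height:
  fixes H :: "nat \<Rightarrow> int"
  assumes "H 0 = 0" "\<And>k. k < N \<Longrightarrow> \<bar>H (Suc k) - H k\<bar> = 1"
  shows "\<exists>p. length p = N \<and> (\<forall>k\<le>N. height p k = H k)"
proof -
  define p where "p = map (\<lambda>k. if H (Suc k) > H k then Rise else Fall) [0..<N]"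
  have "height p k = H k" if "k \<le> N" for k
    using that
  proof (induction k)
    case (Suc k)
    have "p ! k = (if H (Suc k) > H k then Rise else Fall)" using Suc.prems by (simp add: p_def)
    then show ?case using Suc height_Suc[of k p] assms(2)[of k] by (auto simp: p_def)
  qed (simp add: assms)
  then show ?thesis by (intro exI[of _ p]) (simp add: p_def)
qed

lemma path_le_antisym:
  assumes "path_le p q" "path_le q p"
  shows "p = q"
  using assms by (intro path_eqI) (auto simp: path_le_def intro!: antisym)

context
  fixes n :: nat and p :: "dyck_step list"
  assumes p: "p \<in> dyck_paths n"
begin

lemma dyck_length: "length p = 2 * n"
  using p by (simp add: dyck_paths_def)

lemma dyck_height_nonneg: "k \<le> 2 * n \<Longrightarrow> height p k \<ge> 0"
  using p by (simp add: dyck_paths_def)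

lemma dyck_height_end: "height p (2 * n) = 0"
  using p by (simp add: dyck_paths_def)

lemma dyck_height_le: "k \<le> 2 * n \<Longrightarrow> height p k \<le> int k"
  using height_lipschitz(1)[of 0 k p] dyck_length by simp

lemma dyck_height_le': "k \<le> 2 * n \<Longrightarrow> height p k \<le> 2 * int n - int k"
  using height_lipschitz(2)[of k "2 * n" p] dyck_length dyck_height_end by (simp add: of_nat_diff)

lemma dyck_height_initial:
  assumes "height p i = int i" "i \<le> 2 * n" "k \<le> i"
  shows "height p k = int k"
  using height_lipschitz(1)[of k i p] dyck_height_le[of k] dyck_length assms
  by (simp add: of_nat_diff)

lemma dyck_height_final:
  assumes "height p (2 * n - j) = int j" "j \<le> 2 * n" "2 * n - j \<le> k" "k \<le> 2 * n"
  shows "height p k = 2 * int n - int k"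
  using height_lipschitz(2)[of "2 * n - j" k p] dyck_height_le'[of k] dyck_length assms
  by (simp add: of_nat_diff)

lemma peaks_iff:
  "k \<in> peaks p \<longleftrightarrow> 0 < k \<and> k < 2 * n \<and>
     height p k = height p (k - 1) + 1 \<and> height p (Suc k) = height p k - 1"
proof (cases "0 < k \<and> k < 2 * n")
  case True
  then have "k - 1 < length p" "k < length p" "Suc (k - 1) = k" using dyck_length by auto
  moreover have "p ! k = Fall \<longleftrightarrow> p ! k \<noteq> Rise" by (cases "p ! k") auto
  ultimately show ?thesis
    using True height_Suc[of k p] height_Suc[of "k - 1" p] by (simp add: peaks_def dyck_length)
qed (auto simp: peaks_def dyck_length)

lemma finite_peaks: "finite (peaks p)"
  by (rule finite_subset[of _ "{..<length p}"]) (auto simp: peaks_def)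

lemma Min_peaks:
  assumes "1 \<le> i" "i < 2 * n" "height p i = int i" "height p (Suc i) = int i - 1"
  shows "Min (peaks p) = i"
proof (rule Min_eqI[OF finite_peaks])
  have "height p (i - 1) = int (i - 1)" by (rule dyck_height_initial[of i]) (use assms in auto)
  then show "i \<in> peaks p" using assms by (simp add: peaks_iff)
  fix k assume k: "k \<in> peaks p"
  show "i \<le> k"
  proof (rule ccontr)
    assume "\<not> i \<le> k"
    then have "height p k = int k" "height p (Suc k) = int (Suc k)"
      using assms dyck_height_initial[of i k] dyck_height_initial[of i "Suc k"] by simp_all
    then show False using k by (simp add: peaks_iff)
  qed
qed

lemma Max_peaks:
  assumes "1 \<le> j" "j < 2 * n" "height p (2 * n - j) = int j" "height p (2 * n - j - 1) = int j - 1"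
  shows "Max (peaks p) = 2 * n - j"
proof (rule Max_eqI[OF finite_peaks])
  have "height p (Suc (2 * n - j)) = 2 * int n - int (Suc (2 * n - j))"
    by (rule dyck_height_final[of j]) (use assms in auto)
  then show "2 * n - j \<in> peaks p" using assms by (simp add: peaks_iff of_nat_diff)
  fix k assume k: "k \<in> peaks p"
  show "k \<le> 2 * n - j"
  proof (rule ccontr)
    assume "\<not> k \<le> 2 * n - j"
    then have "2 * n - j \<le> k - 1" "k - 1 \<le> 2 * n" "2 * n - j \<le> k" "k \<le> 2 * n"
      using k unfolding peaks_iff by linarith+
    then have "height p k = 2 * int n - int k" "height p (k - 1) = 2 * int n - int (k - 1)"
      using assms k dyck_height_final[of j k] dyck_height_final[of j "k - 1"]
      by (simp_all add: peaks_iff)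
    then show False using k unfolding peaks_iff by linarith
  qed
qed

end

text \<open>Expresses through two heights that \<open>p\<close> begins with exactly \<open>i\<close>
  rises. This replaces the minimum over the set of peaks and fits the later comparisons, which are
  all made between heights.\<close>

definition first_peak :: "nat \<Rightarrow> dyck_step list \<Rightarrow> nat \<Rightarrow> bool" where
  "first_peak n p i \<longleftrightarrow> 1 \<le> i \<and> i \<le> n \<and> height p i = int i \<and> height p (Suc i) = int i - 1"

definition last_peak :: "nat \<Rightarrow> dyck_step list \<Rightarrow> nat \<Rightarrow> bool" where
  "last_peak n p j \<longleftrightarrow> 1 \<le> j \<and> j \<le> n \<and> height p (2 * n - j) = int j \<and>
     height p (2 * n - j - 1) = int j - 1"

lemma height_step: "k < length p \<Longrightarrow> height p (Suc k) = height p k + 1 \<or> height p (Suc k) = height p k - 1"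
  using height_Suc[of k p] by auto

lemma ex_first_peak:
  assumes p: "p \<in> dyck_paths n" and n: "n \<ge> 1"
  shows "\<exists>i. first_peak n p i"
proof -
  let ?Q = "\<lambda>i. i \<le> 2 * n \<and> height p i = int i"
  \<comment> \<open>The last time at which the path has not yet fallen; maximality makes the next
    step a fall.\<close>
  define i where "i = (GREATEST i. ?Q i)"
  have "height p 1 = 1"
    using height_step[of 0 p] dyck_length[OF p] dyck_height_nonneg[OF p, of 1] n by auto
  then have Q1: "?Q 1" using n by simp
  have i: "?Q i" unfolding i_def by (rule GreatestI_nat[where P = ?Q and k = 1 and b = "2 * n"]) (use Q1 in auto)
  have max: "k \<le> i" if "?Q k" for k
    unfolding i_def by (rule Greatest_le_nat[where b = "2 * n"]) (use that in auto)
  have "1 \<le> i" using max Q1 by blast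
  moreover have "i \<le> n" using i dyck_height_le'[OF p, of i] by simp
  moreover have "height p (Suc i) \<noteq> int (Suc i)" using max[of "Suc i"] \<open>i \<le> n\<close> n by auto
  then have "height p (Suc i) = int i - 1"
    using height_step[of i p] i \<open>i \<le> n\<close> n dyck_length[OF p] by auto
  ultimately show ?thesis using i by (auto simp: first_peak_def)
qed

lemma ex_last_peak:
  assumes p: "p \<in> dyck_paths n" and n: "n \<ge> 1"
  shows "\<exists>j. last_peak n p j"
proof -
  let ?Q = "\<lambda>j. j \<le> 2 * n \<and> height p (2 * n - j) = int j"
  define j where "j = (GREATEST j. ?Q j)"
  have "height p (2 * n - 1) = 1"
    using height_step[of "2 * n - 1" p] dyck_length[OF p] dyck_height_end[OF p]
      dyck_height_nonneg[OF p, of "2 * n - 1"] n by auto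
  then have Q1: "?Q 1" using n by simp
  have j: "?Q j" unfolding j_def by (rule GreatestI_nat[where P = ?Q and k = 1 and b = "2 * n"]) (use Q1 in auto)
  have max: "k \<le> j" if "?Q k" for k
    unfolding j_def by (rule Greatest_le_nat[where b = "2 * n"]) (use that in auto)
  have "1 \<le> j" using max Q1 by blast
  moreover have "j \<le> n" using j dyck_height_le[OF p, of "2 * n - j"] by simp
  moreover have "height p (2 * n - j - 1) \<noteq> int j + 1" using max[of "Suc j"] \<open>j \<le> n\<close> n by auto
  moreover have "Suc (2 * n - j - 1) = 2 * n - j" using \<open>j \<le> n\<close> n by simp
  ultimately show ?thesis
    using j height_step[of "2 * n - j - 1" p] n dyck_length[OF p] by (auto simp: last_peak_def)
qed

text \<open>The step from the height of the extreme peak to \<open>first_peak\<close> goes through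
  existence: some \<open>i'\<close> satisfies \<open>first_peak\<close>, its peak has height
  \<open>i'\<close>, and so \<open>i' = i\<close>. The same works at the other end.\<close>

lemma dyck_peaks_iff:
  assumes n: "n \<ge> 1"
  shows "p \<in> dyck_peaks n i j \<longleftrightarrow> p \<in> dyck_paths n \<and> first_peak n p i \<and> last_peak n p j"
proof (cases "p \<in> dyck_paths n")
  case p: True
  obtain i' where i': "first_peak n p i'" using ex_first_peak[OF p n] by blast
  obtain j' where j': "last_peak n p j'" using ex_last_peak[OF p n] by blast
  have Min: "height p (Min (peaks p)) = int i" if "first_peak n p i" for i
    using that n Min_peaks[OF p, of i] by (simp add: first_peak_def)
  have Max: "height p (Max (peaks p)) = int j" if "last_peak n p j" for j
    using that n Max_peaks[OF p, of j] by (simp add: last_peak_def)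
  have "height p (Min (peaks p)) = int i \<longleftrightarrow> first_peak n p i"
    using Min[of i] Min[OF i'] i' by auto
  moreover have "height p (Max (peaks p)) = int j \<longleftrightarrow> last_peak n p j"
    using Max[of j] Max[OF j'] j' by auto
  ultimately show ?thesis using p by (simp add: dyck_peaks_def)
qed (simp add: dyck_peaks_def)

text \<open>
  The minimal path rises to height \<open>k\<close>, falls and zigzags at the bottom (unless the two flanks meet
  before), and ends with \<open>l\<close> falls; its height is the maximum of three tent and sawtooth functions.
\<close>

lemma least_dyck_path:
  assumes n: "n \<ge> 1" and k: "1 \<le> k" "k < n" and l: "1 \<le> l" "l < n"
  obtains m where "m \<in> dyck_peaks n k l"
    "\<And>q. q \<in> dyck_paths n \<Longrightarrow> height q k = int k \<Longrightarrow> height q (2 * n - l) = int l \<Longrightarrow> path_le m q"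
proof -
  \<comment> \<open>Three lower bounds valid for every competitor: \<open>H1\<close> and
    \<open>H2\<close> because heights change by at most one per step away from the prescribed
    points, \<open>H3\<close> because heights are nonnegative and have the parity of the time. Their
    maximum is the least candidate.\<close>
  define H1 H2 H3 :: "nat \<Rightarrow> int" where "H1 t = int k - \<bar>int t - int k\<bar>"
    and "H2 t = int l - \<bar>int t - (2 * int n - int l)\<bar>" and "H3 t = int t mod 2" for t
  define H where "H t = max (H3 t) (max (H1 t) (H2 t))" for t
  have par: "even (H1 t + int t)" "even (H2 t + int t)" "even (H3 t + int t)" for t
    unfolding H1_def H2_def H3_def by presburger+
  have st: "\<bar>H1 (Suc t) - H1 t\<bar> = 1" "\<bar>H2 (Suc t) - H2 t\<bar> = 1" "\<bar>H3 (Suc t) - H3 t\<bar> = 1" for t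
    unfolding H1_def H2_def H3_def by presburger+
  \<comment> \<open>Two functions with unit steps and equal parity differ by an even number, so one
    cannot overtake the other without first meeting it; hence the maximum again has unit
    steps.\<close>
  have maxstep: "\<bar>max x' y' - max x y\<bar> = 1 \<and> even (max x y + t)"
    if "\<bar>x' - x\<bar> = 1" "\<bar>y' - y\<bar> = 1" "even (x + t)" "even (y + t)" for x y x' y' t :: int
    using that by presburger
  have step: "\<bar>H (Suc t) - H t\<bar> = 1" for t
  proof -
    have "\<bar>max (H1 (Suc t)) (H2 (Suc t)) - max (H1 t) (H2 t)\<bar> = 1 \<and> even (max (H1 t) (H2 t) + int t)"
      using st par by (intro maxstep) auto
    then show ?thesis unfolding H_def
      using st par maxstep[of "H3 (Suc t)" "H3 t" "max (H1 (Suc t)) (H2 (Suc t))" "max (H1 t) (H2 t)" "int t"]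
      by auto
  qed
  have H0: "H 0 = 0" using k l by (auto simp: H_def H1_def H2_def H3_def)
  obtain m where m: "length m = 2 * n" "\<And>t. t \<le> 2 * n \<Longrightarrow> height m t = H t"
    using path_with_height[OF H0 step] by blast
  have "H t \<ge> 0" for t by (auto simp: H_def H3_def max_def)
  moreover have "H (2 * n) = 0" using k l by (auto simp: H_def H1_def H2_def H3_def)
  ultimately have md: "m \<in> dyck_paths n" using m by (simp add: dyck_paths_def)
  have "H1 k = int k" "H1 (Suc k) = int k - 1" by (simp_all add: H1_def)
  moreover have "H2 k \<le> int k" "H2 (Suc k) \<le> int k - 1" using l by (simp_all add: H2_def)
  moreover have "H3 k \<le> int k" "H3 (Suc k) \<le> int k - 1" using k(1) unfolding H3_def by presburger+
  ultimately have "H k = int k" "H (Suc k) = int k - 1" by (simp_all add: H_def)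
  then have fp: "first_peak n m k" using k m(2) by (simp add: first_peak_def)
  have t: "int (2 * n - l) = 2 * int n - int l" "int (2 * n - l - 1) = 2 * int n - int l - 1"
    using l by (simp_all add: of_nat_diff)
  have "H2 (2 * n - l) = int l" "H2 (2 * n - l - 1) = int l - 1" unfolding H2_def t by simp_all
  moreover have "H1 (2 * n - l) \<le> int l" "H1 (2 * n - l - 1) \<le> int l - 1"
    using k unfolding H1_def t by simp_all
  moreover have "H3 (2 * n - l) \<le> int l" "H3 (2 * n - l - 1) \<le> int l - 1"
    using l(1) unfolding H3_def t by presburger+
  ultimately have "H (2 * n - l) = int l" "H (2 * n - l - 1) = int l - 1" by (simp_all add: H_def)
  then have lp: "last_peak n m l" using l m(2) by (simp add: last_peak_def)
  have least: "path_le m q"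
    if q: "q \<in> dyck_paths n" "height q k = int k" "height q (2 * n - l) = int l" for q
    unfolding path_le_def
  proof (intro conjI allI impI)
    show "length m = length q" using m dyck_length[OF q(1)] by simp
    fix t assume "t \<le> length m"
    then have t: "t \<le> 2 * n" by (simp add: m)
    have lq: "length q = 2 * n" by (rule dyck_length[OF q(1)])
    have "H1 t \<le> height q t"
      using height_lipschitz[of t k q] height_lipschitz[of k t q] t lq k q(2)
      by (cases "t \<le> k") (auto simp: H1_def of_nat_diff)
    moreover have "H2 t \<le> height q t"
      using height_lipschitz[of t "2 * n - l" q] height_lipschitz[of "2 * n - l" t q] t lq l q(3)
      by (cases "t \<le> 2 * n - l") (auto simp: H2_def of_nat_diff)
    moreover have "H3 t \<le> height q t"
      using height_parity[of t q] dyck_height_nonneg[OF q(1) t] t lq unfolding H3_def by presburger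
    ultimately show "height m t \<le> height q t" using t m(2) by (simp add: H_def)
  qed
  show ?thesis by (rule that[OF _ least]) (simp_all add: dyck_peaks_iff[OF n] md fp lp)
qed

text \<open>Height \<open>n\<close> at time \<open>n\<close> leaves only the path with
  \<open>n\<close> rises followed by \<open>n\<close> falls. Hence \<open>n - i\<close> and
  \<open>n - j\<close> can vanish only together, which is the case covered by the convention in
  \<open>dyck_peaks'\<close>.\<close>

lemma first_peak_iff_last_peak_n:
  assumes p: "p \<in> dyck_paths n" and "n \<ge> 1" "first_peak n p i" "last_peak n p j"
  shows "i = n \<longleftrightarrow> j = n"
proof
  assume "i = n"
  show "j = n"
  proof (rule ccontr)
    assume "j \<noteq> n"
    then have "j < n" using assms by (simp add: last_peak_def)
    have "height p (2 * n - j - 1) = 2 * int n - int (2 * n - j - 1)"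
      by (rule dyck_height_final[OF p, of n])
        (use assms \<open>i = n\<close> \<open>j < n\<close> in \<open>auto simp: first_peak_def\<close>)
    then show False using assms \<open>j < n\<close> by (simp add: last_peak_def of_nat_diff)
  qed
next
  assume "j = n"
  show "i = n"
  proof (rule ccontr)
    assume "i \<noteq> n"
    then have "i < n" using assms by (simp add: first_peak_def)
    have "height p (Suc i) = int (Suc i)"
      by (rule dyck_height_initial[OF p, of n])
        (use assms \<open>j = n\<close> \<open>i < n\<close> in \<open>auto simp: last_peak_def\<close>)
    then show False using assms by (simp add: first_peak_def)
  qed
qed

text \<open>At times \<open>k\<close> and \<open>2 * n - l\<close> the minimal path attains the
  greatest height possible for a Dyck path, so a path above it must agree with it there; the
  converse is its minimality. The \<open>max 1\<close> encodes the replacement of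
  \<open>(0, 0)\<close> by \<open>(1, 1)\<close>.\<close>

lemma dyck_bar_le_iff:
  assumes n: "n \<ge> 2" and p: "p \<in> dyck_paths n" and q: "q \<in> dyck_paths n"
    and i: "first_peak n p i" and j: "last_peak n p j"
  defines "k \<equiv> max 1 (n - j)" and "l \<equiv> max 1 (n - i)"
  shows "path_le (dyck_bar n p) q \<longleftrightarrow> height q k = int k \<and> height q (2 * n - l) = int l"
proof -
  have n1: "n \<ge> 1" using n by simp
  have ij: "1 \<le> i" "1 \<le> j" using i j by (auto simp: first_peak_def last_peak_def)
  have kl: "1 \<le> k" "k < n" "1 \<le> l" "l < n" using n ij by (auto simp: k_def l_def)
  obtain m where m: "m \<in> dyck_peaks n k l"
    "\<And>q. q \<in> dyck_paths n \<Longrightarrow> height q k = int k \<Longrightarrow> height q (2 * n - l) = int l \<Longrightarrow> path_le m q"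
    by (rule least_dyck_path[OF n1 kl]) (rule that)
  have "n - j = 0 \<longleftrightarrow> n - i = 0"
    using first_peak_iff_last_peak_n[OF p n1 i j] i j by (auto simp: first_peak_def last_peak_def)
  then have set: "dyck_peaks' n (n - j) (n - i) = dyck_peaks n k l"
    by (auto simp: dyck_peaks'_def k_def l_def max_def)
  \<comment> \<open>The two peak heights are determined by \<open>p\<close>, so the existential
    quantifier in \<open>dyck_bar\<close> collapses.\<close>
  have pij: "p \<in> dyck_peaks n i' j' \<longleftrightarrow> i' = i \<and> j' = j" for i' j'
  proof -
    have "p \<in> dyck_peaks n i j" using p i j by (simp add: dyck_peaks_iff[OF n1])
    then show ?thesis by (auto simp: dyck_peaks_def)
  qed
  have mle: "path_le m q" if "q \<in> dyck_peaks n k l" for q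
    using that m(2)[of q] by (auto simp: dyck_peaks_iff[OF n1] first_peak_def last_peak_def)
  have bar: "dyck_bar n p = m"
    unfolding dyck_bar_def pij
  proof (rule the_equality)
    show "\<exists>i' j'. (i' = i \<and> j' = j) \<and> m \<in> dyck_peaks' n (n - j') (n - i') \<and>
        (\<forall>q\<in>dyck_peaks' n (n - j') (n - i'). path_le q m \<longrightarrow> q = m)"
      using m mle path_le_antisym by (auto simp: set)
    fix m' assume "\<exists>i' j'. (i' = i \<and> j' = j) \<and> m' \<in> dyck_peaks' n (n - j') (n - i') \<and>
        (\<forall>q\<in>dyck_peaks' n (n - j') (n - i'). path_le q m' \<longrightarrow> q = m')"
    then have "m' \<in> dyck_peaks n k l" "\<forall>q\<in>dyck_peaks n k l. path_le q m' \<longrightarrow> q = m'"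
      by (auto simp: set)
    then show "m' = m" using mle m by auto
  qed
  show ?thesis
  proof
    assume "path_le (dyck_bar n p) q"
    then have le: "height m t \<le> height q t" if "t \<le> 2 * n" for t
      using that m(1) dyck_length[of m n] by (auto simp: bar path_le_def dyck_peaks_def)
    have "height m k = int k" "height m (2 * n - l) = int l"
      using m(1) by (auto simp: dyck_peaks_iff[OF n1] first_peak_def last_peak_def)
    then show "height q k = int k \<and> height q (2 * n - l) = int l"
      using le[of k] le[of "2 * n - l"] dyck_height_le[OF q, of k] dyck_height_le'[OF q, of "2 * n - l"] kl
      by (simp add: of_nat_diff)
  next
    assume "height q k = int k \<and> height q (2 * n - l) = int l"
    then show "path_le (dyck_bar n p) q" using m(2)[OF q] by (simp add: bar)
  qed
qed

section \<open>Dyck paths and admissible sets of boxes\<close>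

abbreviation east_rise :: "lattice_step \<Rightarrow> dyck_step" where
  "east_rise \<equiv> \<lambda>s. case s of East \<Rightarrow> Rise | South \<Rightarrow> Fall"

abbreviation south_rise :: "lattice_step \<Rightarrow> dyck_step" where
  "south_rise \<equiv> \<lambda>s. case s of South \<Rightarrow> Rise | East \<Rightarrow> Fall"

lemma count_list_steps:
  "count_list (map east_rise w) Rise = count_list w East"
  "count_list (map east_rise w) Fall = count_list w South"
  "count_list (map south_rise w) Rise = count_list w South"
  "count_list (map south_rise w) Fall = count_list w East"
  by (induction w) (auto split: lattice_step.splits)

lemma height_steps:
  assumes "k \<le> length w"
  shows "height (map east_rise w) k = int k - 2 * int (count_list (take k w) South)"
    "height (map south_rise w) k = 2 * int (count_list (take k w) South) - int k"
  using count_East_take[OF assms] by (simp_all add: height_def take_map count_list_steps)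

text \<open>
  Box \<open>(a, b)\<close> lies on the antidiagonal crossed by the path at time \<open>a + b - 1\<close>, so membership can be
  read off from a single height.
\<close>

definition plus_boxes :: "nat \<Rightarrow> dyck_step list \<Rightarrow> (nat \<times> nat) set" where
  "plus_boxes n p = {(a, b). a \<in> {1..n} \<and> b \<in> {1..n} \<and> height p (a + b - 1) < int b - int a}"

text \<open>The inequality is opposite to the one in \<open>plus_boxes\<close> because south steps
  are the rises of \<open>q\<close>. Boxes on or above the diagonal are left out, as they lie
  north-east of the boundary for every Dyck path \<open>q\<close>.\<close>

definition minus_boxes :: "nat \<Rightarrow> dyck_step list \<Rightarrow> (nat \<times> nat) set" where
  "minus_boxes n q =
     {(a, b). a \<in> {1..n} \<and> b \<in> {1..n} \<and> b < a \<and> int a - int b < height q (a + b - 1)}"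

lemma ne_boxes_east_rise:
  assumes w: "w \<in> lattice_paths n"
  shows "ne_boxes n w = plus_boxes n (map east_rise w)"
proof -
  have "(a, b) \<in> ne_boxes n w \<longleftrightarrow> (a, b) \<in> plus_boxes n (map east_rise w)"
    if ab: "a \<in> {1..n}" "b \<in> {1..n}" for a b
  proof -
    have "a + b - 1 \<le> length w" "int (a + b - 1) = int a + int b - 1"
      using ab lattice_paths_length[OF w] by auto
    then have "height (map east_rise w) (a + b - 1) < int b - int a \<longleftrightarrow>
        a \<le> count_list (take (a + b - 1) w) South"
      using height_steps(1)[of "a + b - 1" w] by linarith
    then show ?thesis using ab ne_boxes_iff[OF w ab] by (simp add: plus_boxes_def)
  qed
  moreover have "ne_boxes n w \<subseteq> {1..n} \<times> {1..n}" "plus_boxes n (map east_rise w) \<subseteq> {1..n} \<times> {1..n}"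
    by (auto simp: ne_boxes_def plus_boxes_def)
  ultimately show ?thesis by blast
qed

lemma ne_boxes_south_rise_iff:
  assumes w: "w \<in> lattice_paths n" and ab: "a \<in> {1..n}" "b \<in> {1..n}"
  shows "(a, b) \<in> ne_boxes n w \<longleftrightarrow> int a - int b < height (map south_rise w) (a + b - 1)"
proof -
  have "a + b - 1 \<le> length w" "int (a + b - 1) = int a + int b - 1"
    using ab lattice_paths_length[OF w] by auto
  then have "int a - int b < height (map south_rise w) (a + b - 1) \<longleftrightarrow>
      a \<le> count_list (take (a + b - 1) w) South"
    using height_steps(2)[of "a + b - 1" w] by linarith
  then show ?thesis using ne_boxes_iff[OF w ab] by simp
qed

text \<open>Parity excludes height 0. The time \<open>2 * a - 1\<close> is that of the diagonal box
  \<open>(a, a)\<close>, which is thereby north-east of the boundary attached to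
  \<open>q\<close>.\<close>

lemma dyck_height_odd_pos:
  assumes q: "q \<in> dyck_paths n" and "a \<in> {1..n}"
  shows "height q (2 * a - 1) > 0"
proof -
  have "odd (2 * a - 1)" "2 * a - 1 \<le> 2 * n" using assms by auto
  then have "odd (height q (2 * a - 1))"
    using height_parity[of "2 * a - 1" q] dyck_length[OF q] by simp
  then show ?thesis using dyck_height_nonneg[OF q \<open>2 * a - 1 \<le> 2 * n\<close>] by presburger
qed

lemma ne_boxes_south_rise:
  assumes w: "w \<in> lattice_paths n" and q: "map south_rise w \<in> dyck_paths n"
  shows "ne_boxes n w = upper_boxes n \<union> minus_boxes n (map south_rise w)"
proof -
  have "(a, b) \<in> ne_boxes n w \<longleftrightarrow> (a, b) \<in> upper_boxes n \<union> minus_boxes n (map south_rise w)"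
    if ab: "a \<in> {1..n}" "b \<in> {1..n}" for a b
  proof (cases "a \<le> b")
    case True
    have "int a - int b < height (map south_rise w) (a + b - 1)"
    proof (cases "a = b")
      case True
      then show ?thesis using dyck_height_odd_pos[OF q ab(1)] by (simp add: mult_2)
    next
      case False
      have "a + b - 1 \<le> 2 * n" using ab by auto
      then show ?thesis using False True dyck_height_nonneg[OF q, of "a + b - 1"] by linarith
    qed
    then show ?thesis using True ne_boxes_south_rise_iff[OF w ab] ab by (simp add: upper_boxes_def)
  next
    case False
    then show ?thesis using ne_boxes_south_rise_iff[OF w ab] ab
      by (simp add: upper_boxes_def minus_boxes_def)
  qed
  moreover have "ne_boxes n w \<subseteq> {1..n} \<times> {1..n}"
    "upper_boxes n \<union> minus_boxes n (map south_rise w) \<subseteq> {1..n} \<times> {1..n}"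
    by (auto simp: ne_boxes_def minus_boxes_def upper_boxes_def)
  ultimately show ?thesis by blast
qed

section \<open>Dyck paths attached to admissible pairs\<close>

lemma dyck_paths_lattice:
  assumes p: "p \<in> dyck_paths n"
  shows "\<exists>w\<in>lattice_paths n. p = map east_rise w" "\<exists>w\<in>lattice_paths n. p = map south_rise w"
proof -
  have fall: "count_list p Rise = count_list p Fall"
    using p dyck_length[OF p] by (auto simp: dyck_paths_def height_def)
  define u v where "u = map (\<lambda>s. case s of Rise \<Rightarrow> East | Fall \<Rightarrow> South) p"
    and "v = map (\<lambda>s. case s of Rise \<Rightarrow> South | Fall \<Rightarrow> East) p"
  have u: "map east_rise u = p" and v: "map south_rise v = p"
    unfolding u_def v_def by (induction p) (auto split: dyck_step.splits)
  have "count_list u East = count_list u South" "count_list v East = count_list v South"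
    using fall count_list_steps[of u] count_list_steps[of v] by (auto simp: u v)
  moreover have "length u = 2 * n" "length v = 2 * n" using dyck_length[OF p] by (auto simp: u_def v_def)
  ultimately have uv: "u \<in> lattice_paths n" "v \<in> lattice_paths n"
    using count_East_South[of u] count_East_South[of v] by (auto simp: lattice_paths_def)
  show "\<exists>w\<in>lattice_paths n. p = map east_rise w"
    by (rule bexI[where x = u]) (simp_all only: u uv)
  show "\<exists>w\<in>lattice_paths n. p = map south_rise w"
    by (rule bexI[where x = v]) (simp_all only: v uv)
qed

text \<open>At an even time the height is even and at least one less than at the preceding odd time,
  so it cannot be negative. Odd times are those of the diagonal boxes, which makes the Dyck
  condition a statement about the diagonal.\<close>

lemma dyck_pathI:
  assumes "length p = 2 * n" "height p (2 * n) = 0" "\<And>a. a \<in> {1..n} \<Longrightarrow> height p (2 * a - 1) \<ge> 0"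
  shows "p \<in> dyck_paths n"
proof -
  have "height p k \<ge> 0" if k: "k \<le> 2 * n" for k
  proof (cases "odd k")
    case True
    then obtain m where "k = 2 * m + 1" by (elim oddE)
    then show ?thesis using assms(3)[of "m + 1"] k by simp
  next
    case False
    then obtain m where m: "k = 2 * m" by (auto elim: evenE)
    show ?thesis
    proof (cases "m = 0")
      case False
      have ks: "k = Suc (2 * m - 1)" using m False by simp
      have "height p (2 * m - 1) \<ge> 0" using assms(3)[of m] m k False by simp
      then have "height p k \<ge> -1" using height_step[of "2 * m - 1" p] ks k assms(1) by auto
      moreover have "even (height p k)" using height_parity[of k p] k assms(1) m by simp
      ultimately show ?thesis by presburger
    qed (simp add: m)
  qed
  then show ?thesis using assms by (simp add: dyck_paths_def)
qed

lemma lattice_path_heights_end: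
  assumes "w \<in> lattice_paths n"
  shows "height (map east_rise w) (2 * n) = 0" "height (map south_rise w) (2 * n) = 0"
  using assms lattice_paths_length[OF assms] height_steps[of "2 * n" w] by (auto simp: lattice_paths_def)

lemma ex_plus_path:
  assumes adm: "admissible n P M"
  shows "\<exists>p\<in>dyck_paths n. P = plus_boxes n p"
proof -
  note D = admissibleD[OF adm]
  have "\<exists>w\<in>lattice_paths n. ne_boxes n w = P"
  proof (rule ne_boxes_surj)
    show "P \<subseteq> {1..n} \<times> {1..n}"
    proof
      fix x assume "x \<in> P"
      then show "x \<in> {1..n} \<times> {1..n}" using D(1)[of "fst x" "snd x"] by (cases x) auto
    qed
  qed (fact D(3), fact D(4))
  then obtain w where w: "w \<in> lattice_paths n" "ne_boxes n w = P" by blast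
  have eq: "P = plus_boxes n (map east_rise w)" using ne_boxes_east_rise[OF w(1)] w(2) by simp
  have "height (map east_rise w) (2 * a - 1) \<ge> 0" if "a \<in> {1..n}" for a
  proof -
    have "(a, a) \<notin> plus_boxes n (map east_rise w)" using D(1)[of a a] eq by blast
    then show ?thesis using that by (auto simp: plus_boxes_def mult_2)
  qed
  then have "map east_rise w \<in> dyck_paths n"
    using lattice_path_heights_end[OF w(1)] lattice_paths_length[OF w(1)] by (intro dyck_pathI) auto
  then show ?thesis using eq by blast
qed

text \<open>\<open>M\<close> is closed to the north and east only as long as one stays below the
  diagonal; adding \<open>upper_boxes\<close> turns it into a region with a boundary path.\<close>

lemma ex_minus_path:
  assumes adm: "admissible n P M"
  shows "\<exists>q\<in>dyck_paths n. M = minus_boxes n q"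
proof -
  note D = admissibleD[OF adm]
  have "\<exists>w\<in>lattice_paths n. ne_boxes n w = upper_boxes n \<union> M"
  proof (rule ne_boxes_surj)
    show "upper_boxes n \<union> M \<subseteq> {1..n} \<times> {1..n}"
    proof
      fix x assume "x \<in> upper_boxes n \<union> M"
      then show "x \<in> {1..n} \<times> {1..n}"
        using D(2)[of "fst x" "snd x"] by (cases x) (auto simp: upper_boxes_def)
    qed
    fix a b c assume ab: "(a, b) \<in> upper_boxes n \<union> M"
    then have rng: "a \<in> {1..n}" "b \<in> {1..n}" using D(2)[of a b] by (auto simp: upper_boxes_def)
    show "(c, b) \<in> upper_boxes n \<union> M" if "1 \<le> c" "c \<le> a"
      using ab that rng D(5)[of a b c] by (cases "c \<le> b") (auto simp: upper_boxes_def)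
    show "(a, c) \<in> upper_boxes n \<union> M" if "b \<le> c" "c \<le> n"
      using ab that rng D(6)[of a b c] by (cases "a \<le> c") (auto simp: upper_boxes_def)
  qed
  then obtain w where w: "w \<in> lattice_paths n" "ne_boxes n w = upper_boxes n \<union> M" by blast
  have "height (map south_rise w) (2 * a - 1) \<ge> 0" if a: "a \<in> {1..n}" for a
  proof -
    have "(a, a) \<in> ne_boxes n w" using w(2) a by (simp add: upper_boxes_def)
    then show ?thesis using ne_boxes_south_rise_iff[OF w(1) a a] by (simp add: mult_2)
  qed
  then have q: "map south_rise w \<in> dyck_paths n"
    using lattice_path_heights_end[OF w(1)] lattice_paths_length[OF w(1)] by (intro dyck_pathI) auto
  \<comment> \<open>Both sets are disjoint from \<open>upper_boxes\<close>, which can therefore be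
    cancelled from the equality of the two unions.\<close>
  have "(a, b) \<notin> M" "(a, b) \<notin> minus_boxes n (map south_rise w)" if "(a, b) \<in> upper_boxes n" for a b
    using that D(2)[of a b] by (auto simp: upper_boxes_def minus_boxes_def)
  then have "M = minus_boxes n (map south_rise w)"
    using ne_boxes_south_rise[OF w(1) q] w(2) by (intro set_eqI) (metis UnE UnI2 prod.exhaust)
  then show ?thesis using q by blast
qed

text \<open>A box of \<open>plus_boxes\<close> whose transpose is in \<open>minus_boxes\<close>
  means \<open>height p k < b - a < height q k\<close> at the common time
  \<open>k = a + b - 1\<close>. If \<open>q\<close> exceeds \<open>p\<close> somewhere, parity makes
  the gap at least 2, which leaves room for such a value.\<close>

lemma path_le_iff_disjoint:
  assumes p: "p \<in> dyck_paths n" and q: "q \<in> dyck_paths n"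
  shows "path_le q p \<longleftrightarrow> (\<forall>a b. (a, b) \<in> plus_boxes n p \<longrightarrow> (b, a) \<notin> minus_boxes n q)"
proof
  assume le: "path_le q p"
  show "\<forall>a b. (a, b) \<in> plus_boxes n p \<longrightarrow> (b, a) \<notin> minus_boxes n q"
  proof (intro allI impI notI)
    fix a b assume 1: "(a, b) \<in> plus_boxes n p" and 2: "(b, a) \<in> minus_boxes n q"
    have "height q (a + b - 1) \<le> height p (a + b - 1)"
      using le 1 dyck_length[OF q] by (auto simp: path_le_def plus_boxes_def)
    then show False using 1 2 by (simp add: plus_boxes_def minus_boxes_def add.commute)
  qed
next
  assume disj: "\<forall>a b. (a, b) \<in> plus_boxes n p \<longrightarrow> (b, a) \<notin> minus_boxes n q"
  have "height q k \<le> height p k" if k: "k \<le> 2 * n" for k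
  proof (rule ccontr)
    assume "\<not> height q k \<le> height p k"
    moreover have "even (height q k + int k)" "even (height p k + int k)"
      using height_parity[of k] dyck_length[OF p] dyck_length[OF q] k by auto
    ultimately have gt: "height p k + 2 \<le> height q k" by presburger
    \<comment> \<open>The desired difference \<open>b - a\<close>, strictly between the two heights;
      together with \<open>a + b - 1 = k\<close> it determines the box.\<close>
    define c where "c = nat (height p k + 1)"
    have c: "int c = height p k + 1" "c \<ge> 1" using dyck_height_nonneg[OF p k] by (auto simp: c_def)
    have ck: "c + 1 \<le> k" "k + c + 1 \<le> 2 * n"
      using gt c dyck_height_le[OF q k] dyck_height_le'[OF q k] by linarith+
    have "even (k + 1 + c)" using \<open>even (height p k + int k)\<close> c(1) by presburger
    then obtain b where b: "k + 1 + c = 2 * b" by (elim evenE)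
    define a where "a = b - c"
    have ab: "a + b - 1 = k" "b = a + c" "1 \<le> a" "b \<le> n" using b ck by (auto simp: a_def)
    have "(a, b) \<in> plus_boxes n p" "(b, a) \<in> minus_boxes n q"
      using ab c gt by (auto simp: plus_boxes_def minus_boxes_def add.commute)
    then show False using disj by blast
  qed
  then show "path_le q p" using dyck_length[OF p] dyck_length[OF q] by (simp add: path_le_def)
qed

text \<open>Moving a box by one row or column to the north or east raises \<open>b - a\<close> by
  one and shifts its time by one, while the height changes by at most one; so the strict inequality
  persists.\<close>

lemma plus_boxes_props:
  assumes p: "p \<in> dyck_paths n" and ab: "(a, b) \<in> plus_boxes n p"
  shows "1 \<le> a" "a < b" "b \<le> n"
    and "1 \<le> c \<Longrightarrow> c \<le> a \<Longrightarrow> (c, b) \<in> plus_boxes n p"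
    and "b \<le> c \<Longrightarrow> c \<le> n \<Longrightarrow> (a, c) \<in> plus_boxes n p"
proof -
  have h: "a \<in> {1..n}" "b \<in> {1..n}" "height p (a + b - 1) < int b - int a"
    using ab by (auto simp: plus_boxes_def)
  show "1 \<le> a" "b \<le> n" using h by auto
  have "a + b - 1 \<le> 2 * n" using h by auto
  then show "a < b" using dyck_height_nonneg[OF p, of "a + b - 1"] h by linarith
  show "(c, b) \<in> plus_boxes n p" if c: "1 \<le> c" "c \<le> a"
  proof -
    have "height p (c + b - 1) \<le> height p (a + b - 1) + int (a + b - 1 - (c + b - 1))"
      using h c dyck_length[OF p] by (intro height_lipschitz) auto
    then show ?thesis using h c by (auto simp: plus_boxes_def of_nat_diff)
  qed
  show "(a, c) \<in> plus_boxes n p" if c: "b \<le> c" "c \<le> n"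
  proof -
    have "height p (a + c - 1) \<le> height p (a + b - 1) + int (a + c - 1 - (a + b - 1))"
      using h c dyck_length[OF p] by (intro height_lipschitz) auto
    then show ?thesis using h c by (auto simp: plus_boxes_def of_nat_diff)
  qed
qed

lemma minus_boxes_props:
  assumes q: "q \<in> dyck_paths n" and ab: "(a, b) \<in> minus_boxes n q" and c: "b < c" "c < a"
  shows "(c, b) \<in> minus_boxes n q" "(a, c) \<in> minus_boxes n q"
proof -
  have h: "a \<in> {1..n}" "b \<in> {1..n}" "int a - int b < height q (a + b - 1)"
    using ab by (auto simp: minus_boxes_def)
  have "height q (a + b - 1) \<le> height q (c + b - 1) + int (a + b - 1 - (c + b - 1))"
    using h c dyck_length[OF q] by (intro height_lipschitz) auto
  then show "(c, b) \<in> minus_boxes n q" using h c by (auto simp: minus_boxes_def of_nat_diff)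
  have "height q (a + b - 1) \<le> height q (a + c - 1) + int (a + c - 1 - (a + b - 1))"
    using h c dyck_length[OF q] by (intro height_lipschitz) auto
  then show "(a, c) \<in> minus_boxes n q" using h c by (auto simp: minus_boxes_def of_nat_diff)
qed

lemma dyck_bar_le_iff_boxes:
  assumes n: "n \<ge> 2" and p: "p \<in> dyck_paths n" and q: "q \<in> dyck_paths n"
  shows "path_le (dyck_bar n p) q \<longleftrightarrow> (\<forall>a b. (a, b) \<in> plus_boxes n p \<longrightarrow>
    (\<forall>d\<in>{1..<a}. (a, d) \<in> minus_boxes n q) \<and> (\<forall>c\<in>{b<..n}. (c, b) \<in> minus_boxes n q))"
    (is "_ \<longleftrightarrow> ?compat")
proof -
  have n1: "n \<ge> 1" using n by simp
  obtain i where i: "first_peak n p i" using ex_first_peak[OF p n1] by blast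
  obtain j where j: "last_peak n p j" using ex_last_peak[OF p n1] by blast
  define k l where "k = max 1 (n - j)" and "l = max 1 (n - i)"
  have ij: "1 \<le> i" "i \<le> n" "height p i = int i" "height p (Suc i) = int i - 1"
    "1 \<le> j" "j \<le> n" "height p (2 * n - j) = int j" "height p (2 * n - j - 1) = int j - 1"
    using i j by (auto simp: first_peak_def last_peak_def)
  have kl: "1 \<le> k" "k < n" "1 \<le> l" "l < n" using n ij by (auto simp: k_def l_def)
  have lq: "length q = 2 * n" by (rule dyck_length[OF q])
  have bar: "path_le (dyck_bar n p) q \<longleftrightarrow> height q k = int k \<and> height q (2 * n - l) = int l"
    unfolding k_def l_def by (rule dyck_bar_le_iff[OF n p q i j])
  show ?thesis
    unfolding bar
  proof
    assume compat: ?compat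
    \<comment> \<open>These settle \<open>k = 1\<close> and \<open>l = 1\<close>, including the
      values supplied by \<open>max 1\<close>: every Dyck path starts with a rise and ends with a
      fall.\<close>
    have ends: "height q 1 = 1" "height q (2 * n - 1) = 1"
      using dyck_height_odd_pos[OF q, of 1] dyck_height_odd_pos[OF q, of n]
        dyck_height_le[OF q, of 1] dyck_height_le'[OF q, of "2 * n - 1"] n by (auto simp: of_nat_diff)
    have "height q k = int k"
    proof (cases "k = 1")
      case False
      then have k: "k = n - j" "k \<ge> 2" by (auto simp: k_def)
      then have "k + n - 1 = 2 * n - j - 1" by simp
      \<comment> \<open>A box in the last nonempty row. It forces \<open>(k, 1)\<close> into
        \<open>minus_boxes\<close>, a box tested at time \<open>k\<close>, which gives
        \<open>height q k > k - 1\<close>.\<close>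
      then have "(k, n) \<in> plus_boxes n p" using ij k kl by (auto simp: plus_boxes_def of_nat_diff)
      then have "(k, 1) \<in> minus_boxes n q" using compat k by auto
      then show ?thesis using dyck_height_le[OF q, of k] kl by (simp add: minus_boxes_def)
    qed (use ends in simp)
    moreover have "height q (2 * n - l) = int l"
    proof (cases "l = 1")
      case False
      then have l: "l = n - i" "l \<ge> 2" by (auto simp: l_def)
      \<comment> \<open>The leftmost box of row 1, in the first nonempty column. It forces the
        bottom box \<open>(n, Suc i)\<close> of that column, which is tested at time
        \<open>2 * n - l\<close>.\<close>
      have "(1, Suc i) \<in> plus_boxes n p" using ij l by (auto simp: plus_boxes_def)
      then have m: "(n, Suc i) \<in> minus_boxes n q" using compat l by auto
      have "n + Suc i - 1 = 2 * n - l" using l ij by simp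
      then have "int l - 1 < height q (2 * n - l)" using m l ij by (auto simp: minus_boxes_def of_nat_diff)
      then show ?thesis using dyck_height_le'[OF q, of "2 * n - l"] kl by (simp add: of_nat_diff)
    qed (use ends in simp)
    ultimately show "height q k = int k \<and> height q (2 * n - l) = int l" by simp
  next
    assume h: "height q k = int k \<and> height q (2 * n - l) = int l"
    show ?compat
    proof (intro allI impI conjI ballI)
      fix a b d assume ab: "(a, b) \<in> plus_boxes n p" and d: "d \<in> {1..<a}"
      note pp = plus_boxes_props[OF p ab]
      have "(a, n) \<in> plus_boxes n p" using pp by auto
      then have an: "height p (a + n - 1) < int n - int a" by (simp add: plus_boxes_def)
      \<comment> \<open>Otherwise the box \<open>(a, n)\<close> would be tested during the final
        falls of \<open>p\<close>, where the height is \<open>n - a + 1\<close>, too large for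
        membership.\<close>
      have "a \<le> n - j"
      proof (rule ccontr)
        assume "\<not> a \<le> n - j"
        then have "height p (a + n - 1) = 2 * int n - int (a + n - 1)"
          by - (rule dyck_height_final[OF p ij(7)]; use pp ij in auto)
        then show False using an pp by (simp add: of_nat_diff)
      qed
      then have "a \<le> k" by (simp add: k_def)
      then have "height q a = int a"
        by - (rule dyck_height_initial[OF q, of k]; use h kl in auto)
      moreover have "height q a \<le> height q (a + d - 1) + int (a + d - 1 - a)"
        using d pp lq by (intro height_lipschitz) auto
      ultimately show "(a, d) \<in> minus_boxes n q"
        using d pp by (auto simp: minus_boxes_def of_nat_diff)
    next
      fix a b c assume ab: "(a, b) \<in> plus_boxes n p" and c: "c \<in> {b<..n}"
      note pp = plus_boxes_props[OF p ab]
      have "(1, b) \<in> plus_boxes n p" using pp by auto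
      then have b1: "height p b < int b - 1" by (simp add: plus_boxes_def)
      \<comment> \<open>Otherwise the box \<open>(1, b)\<close> would be tested during the initial
        rises of \<open>p\<close>, at height \<open>b\<close>, again too large for
        membership.\<close>
      have "i < b"
      proof (rule ccontr)
        assume "\<not> i < b"
        then have "height p b = int b"
          by - (rule dyck_height_initial[OF p ij(3)]; use ij in auto)
        then show False using b1 by simp
      qed
      then have "2 * n - l \<le> n + b - 1" using pp by (simp add: l_def)
      then have "height q (n + b - 1) = 2 * int n - int (n + b - 1)"
        by - (rule dyck_height_final[OF q, of l]; use h kl pp in auto)
      moreover have "height q (n + b - 1) \<le> height q (c + b - 1) + int (n + b - 1 - (c + b - 1))"
        using c pp lq by (intro height_lipschitz) auto
      ultimately show "(c, b) \<in> minus_boxes n q"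
        using c pp by (auto simp: minus_boxes_def of_nat_diff)
    qed
  qed
qed

lemma admissible_iff_path_le:
  assumes n: "n \<ge> 2" and p: "p \<in> dyck_paths n" and q: "q \<in> dyck_paths n"
  shows "admissible n (plus_boxes n p) (minus_boxes n q) \<longleftrightarrow>
    path_le (dyck_bar n p) q \<and> path_le q p"
proof -
  have "plus_boxes n p \<subseteq> {(a, b). a \<in> {1..n} \<and> b \<in> {1..n} \<and> a < b}"
    unfolding plus_boxes_def using plus_boxes_props(2)[OF p] by (auto simp: plus_boxes_def)
  moreover have "minus_boxes n q \<subseteq> {(a, b). a \<in> {1..n} \<and> b \<in> {1..n} \<and> b < a}"
    by (auto simp: minus_boxes_def)
  moreover have "\<forall>a b. (a, b) \<in> plus_boxes n p \<longrightarrow>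
      (\<forall>a'\<in>{1..<a}. (a', b) \<in> plus_boxes n p) \<and> (\<forall>b'\<in>{b<..n}. (a, b') \<in> plus_boxes n p)"
    by (intro allI impI conjI ballI; erule plus_boxes_props(4,5)[OF p]) auto
  moreover have "\<forall>a b. (a, b) \<in> minus_boxes n q \<longrightarrow>
      (\<forall>c\<in>{b<..<a}. (c, b) \<in> minus_boxes n q \<and> (a, c) \<in> minus_boxes n q)"
    by (intro allI impI conjI ballI; erule minus_boxes_props[OF q]) auto
  ultimately show ?thesis
    unfolding admissible_def dyck_bar_le_iff_boxes[OF assms] path_le_iff_disjoint[OF p q] by blast
qed

lemma Phi_box_ideal:
  assumes n: "n \<ge> 2" and p: "p \<in> dyck_paths n" and q: "q \<in> dyck_paths n"
    and adm: "admissible n (plus_boxes n p) (minus_boxes n q)"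
  shows "Phi n (box_ideal n (plus_boxes n p) (minus_boxes n q)) = (p, q)"
proof -
  obtain u where u: "u \<in> lattice_paths n" "p = map east_rise u" using dyck_paths_lattice(1)[OF p] by blast
  obtain v where v: "v \<in> lattice_paths n" "q = map south_rise v" using dyck_paths_lattice(2)[OF q] by blast
  have "boundary_path n (plus_boxes n p) = u"
    using boundary_path_eq[OF u(1)] ne_boxes_east_rise[OF u(1)] u(2) by simp
  moreover have "boundary_path n (upper_boxes n \<union> minus_boxes n q) = v"
    using boundary_path_eq[OF v(1)] ne_boxes_south_rise[OF v(1)] v(2) q by simp
  ultimately show ?thesis
    by (simp add: Phi_def boxes_box_ideal[OF n adm] u(2)[symmetric] v(2)[symmetric])
qed

theorem proposition18:
  fixes n :: nat
  assumes "n \<ge> 2"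
  shows "bij_betw (Phi n) {I. quasi_abelian n I}
    {(p, q). p \<in> dyck_paths n \<and> q \<in> dyck_paths n \<and>
       path_le (dyck_bar n p) q \<and> path_le q p}"
proof -
  define F where "F = (\<lambda>(p, q). box_ideal n (plus_boxes n p) (minus_boxes n q))"
  let ?B = "{(p, q). p \<in> dyck_paths n \<and> q \<in> dyck_paths n \<and>
       path_le (dyck_bar n p) q \<and> path_le q p}"
  have F: "Phi n (F x) = x" "quasi_abelian n (F x)" if xB: "x \<in> ?B" for x
  proof -
    obtain p q where x: "x = (p, q)" "p \<in> dyck_paths n" "q \<in> dyck_paths n"
      "path_le (dyck_bar n p) q \<and> path_le q p" using xB by blast
    then have adm: "admissible n (plus_boxes n p) (minus_boxes n q)"
      using admissible_iff_path_le[OF assms] by blast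
    show "Phi n (F x) = x" "quasi_abelian n (F x)"
      using Phi_box_ideal[OF assms x(2,3) adm] box_ideal_quasi_abelian[OF assms adm]
      by (simp_all add: F_def x(1))
  qed
  \<comment> \<open>As \<open>Phi n\<close> undoes \<open>F\<close> on \<open>?B\<close>,
    surjectivity of \<open>F\<close> onto the quasi-abelian ideals makes \<open>F\<close> a
    two-sided inverse, and no separate injectivity argument for \<open>Phi n\<close> is called
    for.\<close>
  have surj: "\<exists>x\<in>?B. I = F x" if I: "quasi_abelian n I" for I
  proof -
    obtain P M where PM: "admissible n P M" "I = box_ideal n P M"
      using quasi_abelian_imp_box_ideal[OF assms I] by blast
    obtain p q where pq: "p \<in> dyck_paths n" "P = plus_boxes n p" "q \<in> dyck_paths n" "M = minus_boxes n q"
      using ex_plus_path[OF PM(1)] ex_minus_path[OF PM(1)] by blast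
    then have "(p, q) \<in> ?B" using PM(1) admissible_iff_path_le[OF assms] by blast
    moreover have "I = F (p, q)" using PM(2) pq by (simp add: F_def)
    ultimately show ?thesis by blast
  qed
  have inv: "F (Phi n I) = I \<and> Phi n I \<in> ?B" if I: "quasi_abelian n I" for I
  proof -
    obtain x where x: "x \<in> ?B" "I = F x" using surj[OF I] by blast
    then have Phi: "Phi n I = x" using F(1) by blast
    show ?thesis unfolding Phi using x(1) x(2)[symmetric] by (intro conjI)
  qed
  show ?thesis
  proof (rule bij_betw_byWitness[where f' = F])
    show "\<forall>I\<in>{I. quasi_abelian n I}. F (Phi n I) = I" using inv by simp
    show "\<forall>x\<in>?B. Phi n (F x) = x" by (rule ballI, erule F(1))
    show "Phi n ` {I. quasi_abelian n I} \<subseteq> ?B" using inv by (intro image_subsetI) simp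
    show "F ` ?B \<subseteq> {I. quasi_abelian n I}" by (rule image_subsetI, rule CollectI, erule F(2))
  qed
qed

end
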